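(* Let $T$ be a locally finite, infinite tree with root $o$ in which every vertex has forward degree at least $2$, let $\phi$ be an ultrametric element on $T$, and let $\mu$ be a Borel probability measure on $\partial T$ with $\operatorname{supp}(\mu)=\partial T$. Then there are a unique constant $C>0$ and a unique transient nearest neighbour random walk on $T$ satisfying $F(x,x^-)<1$ for all $x\in T\setminus\{o\}$ and $\lim_{x\to\infty}G(x,o)=0$, with the following properties: its limit distribution satisfies $\nu_o=\mu$, and the associated K-process on $\partial T$ coincides with the standard process induced by the ultrametric element $C\cdot\phi$ and the measure $\mu$ (i.e. $\mathcal{E}_{HD}(\varphi,\psi)=\frac12\iint(\varphi(\xi)-\varphi(\eta))(\psi(\xi)-\psi(\eta))J_{C\phi,\mu}(\xi,\eta)\,d\mu(\xi)\,d\mu(\eta)$ for all $\varphi,\psi\in\mathcal{D}(\partial T,P)$).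
   Context: Tree notation: for $x\neq o$, $x^-$ is the neighbour of $x$ on the geodesic from $o$ to $x$; forward degree of $x$ is $|\{y:y^-=x\}|$; $E(T)=\{[x^-,x]:x\neq o\}$. $\partial T$ is the space of ends (classes of geodesic rays modulo finite symmetric difference); $T_x=\{y:x \text{ on the geodesic from } o \text{ to } y\}$, $\partial T_x$ the ends represented by rays in $T_x$; for $\xi\neq\eta$, $\xi\wedge\eta$ is the last common vertex of the rays from $o$ to $\xi$ and $\eta$. An ultrametric element is $\phi:T\to(0,\infty)$ with $\phi(x^-)>\phi(x)$ ($x\neq o$) and $\phi\to0$ along every geodesic ray; it gives the ultrametric $d_\phi(\xi,\eta)=\phi(\xi\wedge\eta)$ ($\xi\neq\eta$) with closed balls $B_\phi(\xi,r)$. A nearest neighbour random walk is a stochastic matrix with $p(x,y)>0$ iff $x\sim y$; $G(x,y)=\sum_n p^{(n)}(x,y)$ (finite by transience); $F(x,y)$ the probability of ever reaching $y$ from $x$; $\nu_x$ the distribution of the almost sure limit end of the walk started at $x$; $h_\varphi(x)=\int\varphi\,d\nu_x$. With $\mathsf{m}(o)=1$, $\mathsf{m}(x)=\prod_{i=1}^kp(x_{i-1},x_i)/p(x_i,x_{i-1})$ along $[o=x_0,\dots,x_k=x]$, $a(x^-,x)=\mathsf{m}(x)p(x,x^-)$, $\mathcal{E}_T(f,g)=\sum_{[x^-,x]\in E(T)}(f(x)-f(x^-))(g(x)-g(x^-))a(x^-,x)$, $\mathcal{D}(\partial T,P)=\{\varphi\in L^1(\partial T,\nu_o):\mathcal{E}_T(h_\varphi,h_\varphi)<\infty\}$,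 $\mathcal{E}_{HD}(\varphi,\psi)=\mathcal{E}_T(h_\varphi,h_\psi)$. The K-process is the process on $\partial T$ associated with the Dirichlet form $\mathcal{E}_{HD}$. The standard process for an ultrametric element $\phi'$ and $\mu$ is the Hunt process with semigroup $P^tf(\xi)=\int P_rf(\xi)\,d\sigma_*^t(r)$, $P_rf(\xi)=\mu(B_{\phi'}(\xi,r))^{-1}\int_{B_{\phi'}(\xi,r)}f\,d\mu$, $\sigma_*^t([0,r))=e^{-t/r}$; its Dirichlet form is $\frac12\iint(u(\xi)-u(\eta))(v(\xi)-v(\eta))J_{\phi',\mu}\,d\mu\,d\mu$ with $J_{\phi',\mu}(\xi,\eta)=\frac1{\phi'(o)}+\int_{1/\phi'(o)}^{1/\phi'(\xi\wedge\eta)}\frac{dt}{\mu(B_{\phi'}(\xi,1/t))}$ ($\xi\neq\eta$). Processes are identified via their Dirichlet forms. *)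

theory Defs
  imports "HOL-Probability.Probability"
begin

section \<open>Rooted trees, given by a vertex set V, a root rt and the predecessor map up (x \<mapsto> x^-)\<close>

definition depth :: "'v \<Rightarrow> ('v \<Rightarrow> 'v) \<Rightarrow> 'v \<Rightarrow> nat" where
  "depth rt up x = (LEAST n. (up ^^ n) x = rt)"

definition rooted_tree :: "'v set \<Rightarrow> 'v \<Rightarrow> ('v \<Rightarrow> 'v) \<Rightarrow> bool" where
  "rooted_tree V rt up \<longleftrightarrow> rt \<in> V \<and> (\<forall>x\<in>V - {rt}. up x \<in> V) \<and> (\<forall>x\<in>V. \<exists>n. (up ^^ n) x = rt)"

definition adj :: "'v set \<Rightarrow> 'v \<Rightarrow> ('v \<Rightarrow> 'v) \<Rightarrow> 'v \<Rightarrow> 'v \<Rightarrow> bool" where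
  "adj V rt up x y \<longleftrightarrow> x \<in> V \<and> y \<in> V \<and> ((x \<noteq> rt \<and> up x = y) \<or> (y \<noteq> rt \<and> up y = x))"

definition nbrs :: "'v set \<Rightarrow> 'v \<Rightarrow> ('v \<Rightarrow> 'v) \<Rightarrow> 'v \<Rightarrow> 'v set" where
  "nbrs V rt up x = {y. adj V rt up x y}"

definition children :: "'v set \<Rightarrow> 'v \<Rightarrow> ('v \<Rightarrow> 'v) \<Rightarrow> 'v \<Rightarrow> 'v set" where
  "children V rt up x = {y \<in> V - {rt}. up y = x}"

definition forward_degree :: "'v set \<Rightarrow> 'v \<Rightarrow> ('v \<Rightarrow> 'v) \<Rightarrow> 'v \<Rightarrow> nat" where
  "forward_degree V rt up x = card (children V rt up x)"

definition locally_finite :: "'v set \<Rightarrow> 'v \<Rightarrow> ('v \<Rightarrow> 'v) \<Rightarrow> bool" where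
  "locally_finite V rt up \<longleftrightarrow> (\<forall>x\<in>V. finite (nbrs V rt up x))"

definition subtree :: "'v set \<Rightarrow> 'v \<Rightarrow> ('v \<Rightarrow> 'v) \<Rightarrow> 'v \<Rightarrow> 'v set" where
  "subtree V rt up x = {y \<in> V. \<exists>k \<le> depth rt up y. (up ^^ k) y = x}"

section \<open>Ends. Every end is represented by a unique geodesic ray starting at rt; we identify
  the end with that ray (a sequence of vertices).\<close>

definition ends :: "'v set \<Rightarrow> 'v \<Rightarrow> ('v \<Rightarrow> 'v) \<Rightarrow> (nat \<Rightarrow> 'v) set" where
  "ends V rt up = {\<omega>. \<omega> 0 = rt \<and> (\<forall>n. \<omega> (Suc n) \<in> V \<and> \<omega> (Suc n) \<noteq> rt \<and> up (\<omega> (Suc n)) = \<omega> n)}"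

definition ends_at :: "'v set \<Rightarrow> 'v \<Rightarrow> ('v \<Rightarrow> 'v) \<Rightarrow> 'v \<Rightarrow> (nat \<Rightarrow> 'v) set" where
  "ends_at V rt up x = {\<xi> \<in> ends V rt up. \<exists>n. \<xi> n = x}"

definition ends_open :: "'v set \<Rightarrow> 'v \<Rightarrow> ('v \<Rightarrow> 'v) \<Rightarrow> (nat \<Rightarrow> 'v) set \<Rightarrow> bool" where
  "ends_open V rt up U \<longleftrightarrow> U \<subseteq> ends V rt up \<and> (\<forall>\<xi>\<in>U. \<exists>n. ends_at V rt up (\<xi> n) \<subseteq> U)"

definition ends_borel :: "'v set \<Rightarrow> 'v \<Rightarrow> ('v \<Rightarrow> 'v) \<Rightarrow> (nat \<Rightarrow> 'v) measure" where
  "ends_borel V rt up = sigma (ends V rt up) {U. ends_open V rt up U}"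

definition measure_support :: "'v set \<Rightarrow> 'v \<Rightarrow> ('v \<Rightarrow> 'v) \<Rightarrow> (nat \<Rightarrow> 'v) measure \<Rightarrow> (nat \<Rightarrow> 'v) set" where
  "measure_support V rt up \<mu> =
     {\<xi> \<in> ends V rt up. \<forall>U. ends_open V rt up U \<and> \<xi> \<in> U \<longrightarrow> emeasure \<mu> U > 0}"

text \<open>confluent \<xi> \<and> \<eta>: last common vertex of the two rays (for \<xi> \<noteq> \<eta>)\<close>
definition confluent :: "(nat \<Rightarrow> 'v) \<Rightarrow> (nat \<Rightarrow> 'v) \<Rightarrow> 'v" where
  "confluent \<xi> \<eta> = \<xi> (LEAST n. \<xi> (Suc n) \<noteq> \<eta> (Suc n))"

definition ultrametric_element :: "'v set \<Rightarrow> 'v \<Rightarrow> ('v \<Rightarrow> 'v) \<Rightarrow> ('v \<Rightarrow> real) \<Rightarrow> bool" where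
  "ultrametric_element V rt up \<phi> \<longleftrightarrow>
     (\<forall>x\<in>V. \<phi> x > 0) \<and> (\<forall>x\<in>V - {rt}. \<phi> (up x) > \<phi> x) \<and>
     (\<forall>\<xi>\<in>ends V rt up. (\<lambda>n. \<phi> (\<xi> n)) \<longlonglongrightarrow> 0)"

definition um_ball :: "'v set \<Rightarrow> 'v \<Rightarrow> ('v \<Rightarrow> 'v) \<Rightarrow> ('v \<Rightarrow> real) \<Rightarrow> (nat \<Rightarrow> 'v) \<Rightarrow> real \<Rightarrow> (nat \<Rightarrow> 'v) set" where
  "um_ball V rt up \<phi> \<xi> r = {\<eta> \<in> ends V rt up. \<eta> = \<xi> \<or> \<phi> (confluent \<xi> \<eta>) \<le> r}"

text \<open>J_{\<phi>,\<mu>}(\<xi>,\<eta>) for \<xi> \<noteq> \<eta> (value on the diagonal irrelevant: it is multiplied by 0)\<close>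
definition jump_kernel :: "'v set \<Rightarrow> 'v \<Rightarrow> ('v \<Rightarrow> 'v) \<Rightarrow> ('v \<Rightarrow> real) \<Rightarrow> (nat \<Rightarrow> 'v) measure
    \<Rightarrow> (nat \<Rightarrow> 'v) \<Rightarrow> (nat \<Rightarrow> 'v) \<Rightarrow> real" where
  "jump_kernel V rt up \<phi> \<mu> \<xi> \<eta> =
     (if \<xi> = \<eta> then 0 else
       1 / \<phi> rt + (\<integral>t\<in>{1 / \<phi> rt .. 1 / \<phi> (confluent \<xi> \<eta>)}. 1 / measure \<mu> (um_ball V rt up \<phi> \<xi> (1 / t)) \<partial>lborel))"

definition standard_form :: "'v set \<Rightarrow> 'v \<Rightarrow> ('v \<Rightarrow> 'v) \<Rightarrow> ('v \<Rightarrow> real) \<Rightarrow> (nat \<Rightarrow> 'v) measure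
    \<Rightarrow> ((nat \<Rightarrow> 'v) \<Rightarrow> real) \<Rightarrow> ((nat \<Rightarrow> 'v) \<Rightarrow> real) \<Rightarrow> real" where
  "standard_form V rt up \<phi> \<mu> u v =
     1/2 * (\<integral>z. (u (fst z) - u (snd z)) * (v (fst z) - v (snd z)) *
                 jump_kernel V rt up \<phi> \<mu> (fst z) (snd z) \<partial>(\<mu> \<Otimes>\<^sub>M \<mu>))"

definition nn_random_walk :: "'v set \<Rightarrow> 'v \<Rightarrow> ('v \<Rightarrow> 'v) \<Rightarrow> ('v \<Rightarrow> 'v \<Rightarrow> real) \<Rightarrow> bool" where
  "nn_random_walk V rt up p \<longleftrightarrow>
     (\<forall>x y. p x y \<ge> 0 \<and> (p x y > 0 \<longleftrightarrow> adj V rt up x y)) \<and>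
     (\<forall>x\<in>V. (\<Sum>y\<in>nbrs V rt up x. p x y) = 1)"

fun trans_n :: "'v set \<Rightarrow> 'v \<Rightarrow> ('v \<Rightarrow> 'v) \<Rightarrow> ('v \<Rightarrow> 'v \<Rightarrow> real) \<Rightarrow> nat \<Rightarrow> 'v \<Rightarrow> 'v \<Rightarrow> real" where
  "trans_n V rt up p 0 x y = (if x = y then 1 else 0)"
| "trans_n V rt up p (Suc n) x y = (\<Sum>z\<in>nbrs V rt up x. p x z * trans_n V rt up p n z y)"

fun first_pass_n :: "'v set \<Rightarrow> 'v \<Rightarrow> ('v \<Rightarrow> 'v) \<Rightarrow> ('v \<Rightarrow> 'v \<Rightarrow> real) \<Rightarrow> nat \<Rightarrow> 'v \<Rightarrow> 'v \<Rightarrow> real" where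
  "first_pass_n V rt up p 0 x y = (if x = y then 1 else 0)"
| "first_pass_n V rt up p (Suc n) x y =
     (if x = y then 0 else (\<Sum>z\<in>nbrs V rt up x. p x z * first_pass_n V rt up p n z y))"

definition transient :: "'v set \<Rightarrow> 'v \<Rightarrow> ('v \<Rightarrow> 'v) \<Rightarrow> ('v \<Rightarrow> 'v \<Rightarrow> real) \<Rightarrow> bool" where
  "transient V rt up p \<longleftrightarrow> (\<forall>x\<in>V. \<forall>y\<in>V. summable (\<lambda>n. trans_n V rt up p n x y))"

definition green :: "'v set \<Rightarrow> 'v \<Rightarrow> ('v \<Rightarrow> 'v) \<Rightarrow> ('v \<Rightarrow> 'v \<Rightarrow> real) \<Rightarrow> 'v \<Rightarrow> 'v \<Rightarrow> real" where
  "green V rt up p x y = (\<Sum>n. trans_n V rt up p n x y)"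

definition hit_prob :: "'v set \<Rightarrow> 'v \<Rightarrow> ('v \<Rightarrow> 'v) \<Rightarrow> ('v \<Rightarrow> 'v \<Rightarrow> real) \<Rightarrow> 'v \<Rightarrow> 'v \<Rightarrow> real" where
  "hit_prob V rt up p x y = (\<Sum>n. first_pass_n V rt up p n x y)"

definition walk_law :: "'v set \<Rightarrow> ('v \<Rightarrow> 'v \<Rightarrow> real) \<Rightarrow> 'v \<Rightarrow> (nat \<Rightarrow> 'v) measure" where
  "walk_law V p x = (THE Q. sets Q = sets (PiM UNIV (\<lambda>_. count_space V)) \<and> prob_space Q \<and>
     (\<forall>n y. emeasure Q {\<omega> \<in> space Q. \<forall>i\<le>n. \<omega> i = y i} =
        ennreal ((if y 0 = x then 1 else 0) * (\<Prod>i<n. p (y i) (y (Suc i))))))"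

definition converges_to_end :: "'v set \<Rightarrow> 'v \<Rightarrow> ('v \<Rightarrow> 'v) \<Rightarrow> (nat \<Rightarrow> 'v) \<Rightarrow> (nat \<Rightarrow> 'v) \<Rightarrow> bool" where
  "converges_to_end V rt up \<omega> \<xi> \<longleftrightarrow>
     \<xi> \<in> ends V rt up \<and> (\<forall>n. eventually (\<lambda>m. \<omega> m \<in> subtree V rt up (\<xi> n)) sequentially)"

text \<open>limit end of a trajectory (a fixed dummy end on the null set of non-convergent paths)\<close>
definition limit_end :: "'v set \<Rightarrow> 'v \<Rightarrow> ('v \<Rightarrow> 'v) \<Rightarrow> (nat \<Rightarrow> 'v) \<Rightarrow> (nat \<Rightarrow> 'v)" where
  "limit_end V rt up \<omega> =
     (if \<exists>\<xi>. converges_to_end V rt up \<omega> \<xi> then THE \<xi>. converges_to_end V rt up \<omega> \<xi>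
      else SOME \<xi>. \<xi> \<in> ends V rt up)"

definition limit_distribution :: "'v set \<Rightarrow> 'v \<Rightarrow> ('v \<Rightarrow> 'v) \<Rightarrow> ('v \<Rightarrow> 'v \<Rightarrow> real) \<Rightarrow> 'v \<Rightarrow> (nat \<Rightarrow> 'v) measure" where
  "limit_distribution V rt up p x = distr (walk_law V p x) (ends_borel V rt up) (limit_end V rt up)"

definition harm_ext :: "'v set \<Rightarrow> 'v \<Rightarrow> ('v \<Rightarrow> 'v) \<Rightarrow> ('v \<Rightarrow> 'v \<Rightarrow> real) \<Rightarrow> ((nat \<Rightarrow> 'v) \<Rightarrow> real) \<Rightarrow> 'v \<Rightarrow> real" where
  "harm_ext V rt up p \<phi> x = (\<integral>\<xi>. \<phi> \<xi> \<partial>limit_distribution V rt up p x)"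

definition rev_measure :: "'v set \<Rightarrow> 'v \<Rightarrow> ('v \<Rightarrow> 'v) \<Rightarrow> ('v \<Rightarrow> 'v \<Rightarrow> real) \<Rightarrow> 'v \<Rightarrow> real" where
  "rev_measure V rt up p x = (\<Prod>k<depth rt up x. p ((up ^^ Suc k) x) ((up ^^ k) x) / p ((up ^^ k) x) ((up ^^ Suc k) x))"

definition conductance :: "'v set \<Rightarrow> 'v \<Rightarrow> ('v \<Rightarrow> 'v) \<Rightarrow> ('v \<Rightarrow> 'v \<Rightarrow> real) \<Rightarrow> 'v \<Rightarrow> real" where
  "conductance V rt up p x = rev_measure V rt up p x * p x (up x)"

definition tree_energy :: "'v set \<Rightarrow> 'v \<Rightarrow> ('v \<Rightarrow> 'v) \<Rightarrow> ('v \<Rightarrow> 'v \<Rightarrow> real) \<Rightarrow> ('v \<Rightarrow> real) \<Rightarrow> ('v \<Rightarrow> real) \<Rightarrow> real" where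
  "tree_energy V rt up p f g =
     (\<Sum>\<^sub>\<infinity>x\<in>V - {rt}. (f x - f (up x)) * (g x - g (up x)) * conductance V rt up p x)"

definition HD_domain :: "'v set \<Rightarrow> 'v \<Rightarrow> ('v \<Rightarrow> 'v) \<Rightarrow> ('v \<Rightarrow> 'v \<Rightarrow> real) \<Rightarrow> ((nat \<Rightarrow> 'v) \<Rightarrow> real) set" where
  "HD_domain V rt up p = {\<phi>. integrable (limit_distribution V rt up p rt) \<phi> \<and>
     (\<lambda>x. (harm_ext V rt up p \<phi> x - harm_ext V rt up p \<phi> (up x))^2 * conductance V rt up p x) summable_on (V - {rt})}"

definition HD_form :: "'v set \<Rightarrow> 'v \<Rightarrow> ('v \<Rightarrow> 'v) \<Rightarrow> ('v \<Rightarrow> 'v \<Rightarrow> real) \<Rightarrow> ((nat \<Rightarrow> 'v) \<Rightarrow> real) \<Rightarrow> ((nat \<Rightarrow> 'v) \<Rightarrow> real) \<Rightarrow> real" where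
  "HD_form V rt up p \<phi> \<psi> = tree_energy V rt up p (harm_ext V rt up p \<phi>) (harm_ext V rt up p \<psi>)"

end

theory Submission
  imports Defs
begin

text \<open>Write \<open>\<mu>\<^sub>x\<close> for the mass of the cylinder of \<open>x\<close>, \<open>g x = G(x, o)\<close>, \<open>F\<^sub>x = F(x, x\<^sup>-)\<close> and \<open>a\<close> for the
  conductances. The Wronskian of \<open>g\<close> and of \<open>z \<mapsto> \<nu>\<^sub>z(\<partial>T\<^sub>y)\<close> is a flow from \<open>o\<close> to \<open>y\<close>, hence constant along the geodesic;
  reading it off at \<open>y\<close> gives \<open>\<mu>\<^sub>y = a(y) (g(y\<^sup>-) - g(y))\<close>, and reading it off in between shows that \<open>\<nu>\<^sub>x\<close> is the mixture of
  \<open>\<nu>\<close> at \<open>x\<^sup>-\<close>, with weight \<open>F\<^sub>x\<close>, and of \<open>\<mu>\<close> conditioned on \<open>\<partial>T\<^sub>x\<close>.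

  For \<open>\<phi>\<close> with averages \<open>A\<close> over cylinders and harmonic extension \<open>h\<close>, this recursion and orthogonality of martingale
  increments give, level by level, \<open>\<Sum>\<^sub>i\<^sub><\<^sub>n e\<^sub>i = \<Sum>\<^sub>i\<^sub><\<^sub>n r\<^sub>i - q\<^sub>n\<close>, where \<open>e\<^sub>i\<close> is the energy of \<open>h\<close> between levels \<open>i\<close> and \<open>i + 1\<close>,
  \<open>r\<^sub>i = \<integral> (A\<^sub>i\<^sub>+\<^sub>1 - A\<^sub>i)\<^sup>2 / g\<close> and \<open>q\<^sub>n = \<integral> (A\<^sub>n - h\<^sub>n)\<^sup>2 / g\<close>. Almost sure convergence of \<open>A\<^sub>n\<close>, hence of \<open>h\<^sub>n\<close>, to \<open>\<phi>\<close> bounds \<open>q\<^sub>n\<close> by the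
  tail of the energy. The same sum \<open>\<Sum> r\<^sub>i\<close> is the jump form with kernel \<open>J\<close> of \<open>g\<close>, so the Dirichlet form of the walk is
  the standard form of the ultrametric element \<open>g\<close>.

  Indicators of sibling cylinders recover \<open>J\<close>, hence \<open>g = C \<phi>\<close>, then \<open>a\<close>, and \<open>C\<close> from \<open>\<Sum> a(y) = 1\<close> over the children \<open>y\<close> of \<open>o\<close>.
  Conversely these formulas define conductances for which \<open>C \<phi>\<close> is the Green function, by the maximum principle.\<close>

section \<open>Rooted trees and their ends\<close>

text \<open>The obstacle is integrability. A function in the domain is only known to be in L^1, so
  neither the energy of its extension nor its jump form is known to be finite when they are
  compared. The identities are therefore proved up to a finite level, where every integral is a
  finite sum over vertices, and the passage to the limit uses almost sure convergence of averages
  (from a maximal inequality), Jensen and Fatou. Levels also fit the kernel: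
  \<open>jump_kernel\<close> is a sum, over the common vertices of the two rays, of increments of
  1/g divided by cylinder masses, and exchanging the sum over common vertices with the sum over
  levels turns it into the weights 1/g of r_i. For uniqueness the unknown domain has to contain test
  functions. Indicators of cylinders lie in it for every admissible walk, because only finitely many
  of their r_i are nonzero. The constant C comes from m(o) = 1: the conductances at o sum to 1, and
  replacing phi by C phi divides all conductances by C.\<close>

locale rtree =
  fixes V :: "'v set" and rt :: 'v and up :: "'v \<Rightarrow> 'v"
  assumes tree: "rooted_tree V rt up"
    and lf: "locally_finite V rt up"
    and deg: "\<forall>x\<in>V. forward_degree V rt up x \<ge> 2"
begin

abbreviation "dep \<equiv> depth rt up"
abbreviation "ch \<equiv> children V rt up"
abbreviation "nb \<equiv> nbrs V rt up"
abbreviation "Ends \<equiv> ends V rt up"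
abbreviation "Cyl \<equiv> ends_at V rt up"
abbreviation "BE \<equiv> ends_borel V rt up"
abbreviation "T \<equiv> subtree V rt up"
abbreviation "ultra \<equiv> ultrametric_element V rt up"

definition level :: "nat \<Rightarrow> 'v set" where "level n = {x\<in>V. dep x = n}"

lemma rt_V [simp]: "rt \<in> V"
  using tree by (auto simp: rooted_tree_def)

lemma up_V: "x \<in> V \<Longrightarrow> x \<noteq> rt \<Longrightarrow> up x \<in> V"
  using tree by (auto simp: rooted_tree_def)

lemma dep_rt [simp]: "dep rt = 0"
  unfolding depth_def by (rule Least_eq_0) simp

lemma funpow_dep: "x \<in> V \<Longrightarrow> (up ^^ dep x) x = rt"
proof -
  assume "x \<in> V"
  then obtain n where "(up ^^ n) x = rt" using tree by (auto simp: rooted_tree_def)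
  then show ?thesis unfolding depth_def by (rule LeastI)
qed

lemma dep_Suc: assumes "x \<in> V" "x \<noteq> rt" shows "dep x = Suc (dep (up x))"
proof -
  obtain n where "(up ^^ n) x = rt" using tree assms by (auto simp: rooted_tree_def)
  then have "(LEAST n. (up ^^ n) x = rt) = Suc (LEAST m. (up ^^ Suc m) x = rt)"
    by (rule Least_Suc) (use assms in auto)
  then show ?thesis unfolding depth_def by (simp add: funpow_swap1)
qed

lemma dep_0_iff: "x \<in> V \<Longrightarrow> dep x = 0 \<longleftrightarrow> x = rt"
  using dep_Suc by fastforce

lemma funpow_V: "x \<in> V \<Longrightarrow> k \<le> dep x \<Longrightarrow> (up ^^ k) x \<in> V \<and> dep ((up ^^ k) x) = dep x - k"
proof (induction k)
  case (Suc k)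
  then have "(up ^^ k) x \<in> V" "dep ((up ^^ k) x) = dep x - k" by auto
  with Suc.prems show ?case
    using dep_Suc[of "(up ^^ k) x"] up_V[of "(up ^^ k) x"] by (cases "(up ^^ k) x = rt") auto
qed auto

lemma ch_iff: "y \<in> ch x \<longleftrightarrow> y \<in> V \<and> y \<noteq> rt \<and> up y = x"
  by (auto simp: children_def)

lemma ch_V: "y \<in> ch x \<Longrightarrow> y \<in> V" by (simp add: ch_iff)
lemma ch_parent_V: "y \<in> ch x \<Longrightarrow> x \<in> V" using up_V by (auto simp: ch_iff)
lemma dep_ch: "y \<in> ch x \<Longrightarrow> dep y = Suc (dep x)" using dep_Suc by (auto simp: ch_iff)
lemma ch_up: "x \<in> V \<Longrightarrow> x \<noteq> rt \<Longrightarrow> x \<in> ch (up x)" by (simp add: ch_iff)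

lemma nb_eq: "x \<in> V \<Longrightarrow> nb x = (if x = rt then ch x else insert (up x) (ch x))"
  using up_V by (auto simp: nbrs_def adj_def children_def)

lemma finite_nb: "x \<in> V \<Longrightarrow> finite (nb x)"
  using lf by (auto simp: locally_finite_def)

lemma finite_ch: "finite (ch x)"
proof (cases "x \<in> V")
  case True
  then show ?thesis using finite_nb[of x] nb_eq[of x] by (auto split: if_splits)
next
  case False
  then have "ch x = {}" using ch_parent_V by auto
  then show ?thesis by simp
qed

lemma up_notin_ch: "x \<in> V \<Longrightarrow> x \<noteq> rt \<Longrightarrow> up x \<notin> ch x"
  using dep_ch[of "up x" x] dep_Suc[of x] by auto

lemma sum_nb: "x \<in> V \<Longrightarrow> (\<Sum>y\<in>nb x. f y) = (if x = rt then 0 else f (up x)) + (\<Sum>y\<in>ch x. (f y :: 'b :: comm_monoid_add))"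
  using nb_eq[of x] up_notin_ch[of x] finite_ch[of x] by auto

lemma nb_V: "y \<in> nb x \<Longrightarrow> y \<in> V" by (auto simp: nbrs_def adj_def)
lemma nb_sym: "y \<in> nb x \<Longrightarrow> x \<in> nb y" by (auto simp: nbrs_def adj_def)
lemma adj_iff_nb: "adj V rt up x y \<longleftrightarrow> y \<in> nb x" by (auto simp: nbrs_def)
lemma nb_dom: "y \<in> nb x \<Longrightarrow> x \<in> V" by (auto simp: nbrs_def adj_def)

lemma two_children: "x \<in> V \<Longrightarrow> \<exists>y z. y \<in> ch x \<and> z \<in> ch x \<and> y \<noteq> z"
proof -
  assume "x \<in> V"
  then have "card (ch x) \<ge> 2" using deg by (auto simp: forward_degree_def)
  then obtain y where "y \<in> ch x" by fastforce
  moreover have "ch x \<noteq> {y}" using \<open>card (ch x) \<ge> 2\<close> by auto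
  ultimately show ?thesis by blast
qed

lemma ch_nonempty: "x \<in> V \<Longrightarrow> ch x \<noteq> {}" using two_children by blast

lemma level_0: "level 0 = {rt}" by (auto simp: level_def dep_0_iff)

lemma level_Suc: "level (Suc n) = (\<Union>u\<in>level n. ch u)"
proof (intro set_eqI iffI)
  fix x assume "x \<in> level (Suc n)"
  then have x: "x \<in> V" "dep x = Suc n" by (auto simp: level_def)
  then have "x \<noteq> rt" by auto
  then have "x \<in> ch (up x)" "up x \<in> level n" using x dep_Suc[of x] up_V by (auto simp: level_def ch_iff)
  then show "x \<in> (\<Union>u\<in>level n. ch u)" by blast
next
  fix x assume "x \<in> (\<Union>u\<in>level n. ch u)"
  then show "x \<in> level (Suc n)" using dep_ch ch_V by (auto simp: level_def)
qed

lemma finite_level: "finite (level n)"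
  by (induction n) (auto simp: level_0 level_Suc finite_ch)

lemma levelD: "x \<in> level n \<Longrightarrow> x \<in> V" "x \<in> level n \<Longrightarrow> dep x = n" by (auto simp: level_def)

lemma V_levels: "V = (\<Union>n. level n)" by (auto simp: level_def)

lemma countable_V: "countable V"
  by (subst V_levels, rule countable_UN) (simp_all add: countable_finite finite_level)

lemma sum_level_Suc: "(\<Sum>x\<in>level (Suc n). (f x :: 'b :: comm_monoid_add)) = (\<Sum>u\<in>level n. \<Sum>x\<in>ch u. f x)"
proof -
  have "\<forall>u\<in>level n. \<forall>v\<in>level n. u \<noteq> v \<longrightarrow> ch u \<inter> ch v = {}" by (auto simp: ch_iff)
  then show ?thesis unfolding level_Suc by (intro sum.UNION_disjoint) (simp_all add: finite_level finite_ch)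
qed

lemma ends_ch: "\<xi> \<in> Ends \<Longrightarrow> \<xi> (Suc n) \<in> ch (\<xi> n)"
  by (auto simp: ends_def ch_iff)

lemma ends_0: "\<xi> \<in> Ends \<Longrightarrow> \<xi> 0 = rt" by (auto simp: ends_def)

lemma ends_level: "\<xi> \<in> Ends \<Longrightarrow> \<xi> n \<in> level n"
  by (induction n) (auto simp: ends_0 level_0 level_Suc dest: ends_ch)

lemma ends_V: "\<xi> \<in> Ends \<Longrightarrow> \<xi> n \<in> V" using ends_level levelD by blast
lemma ends_dep: "\<xi> \<in> Ends \<Longrightarrow> dep (\<xi> n) = n" using ends_level levelD by blast
lemma ends_up: "\<xi> \<in> Ends \<Longrightarrow> up (\<xi> (Suc n)) = \<xi> n" by (auto simp: ends_def)
lemma ends_neq_rt: "\<xi> \<in> Ends \<Longrightarrow> \<xi> (Suc n) \<noteq> rt" by (auto simp: ends_def)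

lemma ends_funpow: "\<xi> \<in> Ends \<Longrightarrow> k \<le> n \<Longrightarrow> (up ^^ k) (\<xi> n) = \<xi> (n - k)"
proof (induction k)
  case (Suc k)
  then have "(up ^^ Suc k) (\<xi> n) = up (\<xi> (Suc (n - Suc k)))"
    by (simp add: Suc_diff_Suc)
  then show ?case using Suc.prems ends_up by metis
qed simp

lemma ends_agree: "\<xi> \<in> Ends \<Longrightarrow> \<eta> \<in> Ends \<Longrightarrow> \<xi> n = \<eta> n \<Longrightarrow> i \<le> n \<Longrightarrow> \<xi> i = \<eta> i"
  using ends_funpow[of \<xi> "n - i" n] ends_funpow[of \<eta> "n - i" n] by simp

lemma Cyl_iff: "\<xi> \<in> Cyl x \<longleftrightarrow> \<xi> \<in> Ends \<and> \<xi> (dep x) = x"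
  using ends_dep by (auto simp: ends_at_def)

lemma Cyl_sub: "Cyl x \<subseteq> Ends" by (auto simp: ends_at_def)

lemma Cyl_ends: "\<xi> \<in> Ends \<Longrightarrow> \<xi> \<in> Cyl (\<xi> n)" by (auto simp: Cyl_iff ends_dep)

lemma Cyl_rt: "Cyl rt = Ends" by (auto simp: Cyl_iff ends_0)

lemma Cyl_level: "x \<in> level n \<Longrightarrow> \<xi> \<in> Cyl x \<longleftrightarrow> \<xi> \<in> Ends \<and> \<xi> n = x"
  by (auto simp: Cyl_iff levelD)

lemma Cyl_ch: "u \<in> V \<Longrightarrow> Cyl u = (\<Union>x\<in>ch u. Cyl x)"
proof (intro set_eqI iffI)
  fix \<xi> assume "\<xi> \<in> Cyl u"
  then show "\<xi> \<in> (\<Union>x\<in>ch u. Cyl x)" using ends_ch[of \<xi> "dep u"] Cyl_ends[of \<xi> "Suc (dep u)"]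
    by (auto simp: Cyl_iff)
next
  fix \<xi> assume "\<xi> \<in> (\<Union>x\<in>ch u. Cyl x)"
  then obtain x where x: "x \<in> ch u" "\<xi> \<in> Ends" "\<xi> (dep x) = x" by (auto simp: Cyl_iff)
  then have "\<xi> (dep u) = u" using ends_up[of \<xi> "dep u"] dep_ch[OF x(1)] by (simp add: ch_iff)
  with x show "\<xi> \<in> Cyl u" by (simp add: Cyl_iff)
qed

lemma Cyl_disjoint: "dep x = dep y \<Longrightarrow> x \<noteq> y \<Longrightarrow> Cyl x \<inter> Cyl y = {}"
  by (auto simp: Cyl_iff)

lemma Cyl_nested: "dep x \<le> dep y \<Longrightarrow> Cyl y \<subseteq> Cyl x \<or> Cyl x \<inter> Cyl y = {}"
  using ends_agree by (auto simp: Cyl_iff) metis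

lemma Ends_level: "Ends = (\<Union>x\<in>level n. Cyl x)"
  using ends_level Cyl_ends Cyl_sub by blast

lemma disj_level: "disjoint_family_on Cyl (level n)"
  using Cyl_disjoint by (auto simp: disjoint_family_on_def levelD)

lemma disj_ch: "disjoint_family_on Cyl (ch u)"
  using Cyl_disjoint dep_ch by (auto simp: disjoint_family_on_def)

text \<open>Every vertex has a child, so the geodesic from the root to \<open>x\<close> can be
  continued forever; below \<open>x\<close> the ray consists of iterates of a chosen child
  \<open>c\<close>.\<close>

lemma Cyl_nonempty: assumes "x \<in> V" shows "Cyl x \<noteq> {}"
proof -
  define c where "c y = (SOME z. z \<in> ch y)" for y
  have c: "y \<in> V \<Longrightarrow> c y \<in> ch y" for y unfolding c_def using ch_nonempty[of y] some_in_eq by blast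
  have cV: "(c ^^ k) x \<in> V" for k using assms c ch_V by (induction k) auto
  define \<xi> where "\<xi> n = (if n \<le> dep x then (up ^^ (dep x - n)) x else (c ^^ (n - dep x)) x)" for n
  have "\<xi> 0 = rt" unfolding \<xi>_def using funpow_dep[OF assms] by simp
  moreover have "\<xi> (Suc n) \<in> ch (\<xi> n)" for n
  proof (cases "n < dep x")
    case True
    let ?z = "(up ^^ (dep x - Suc n)) x"
    have z: "?z \<in> V" "dep ?z = Suc n" using funpow_V[OF assms, of "dep x - Suc n"] True by auto
    then have "?z \<noteq> rt" by auto
    moreover have "up ?z = (up ^^ (dep x - n)) x" using True
      by (metis Suc_diff_Suc comp_apply funpow.simps(2))
    ultimately show ?thesis using True z by (auto simp: \<xi>_def ch_iff)
  next
    case False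
    then have "Suc n - dep x = Suc (n - dep x)" by simp
    then have "\<xi> (Suc n) = c ((c ^^ (n - dep x)) x)" "\<xi> n = (c ^^ (n - dep x)) x"
      using False by (auto simp: \<xi>_def)
    then show ?thesis using c cV by simp
  qed
  ultimately have "\<xi> \<in> Ends" unfolding ends_def by (auto simp: ch_iff)
  moreover have "\<xi> (dep x) = x" by (simp add: \<xi>_def)
  ultimately show ?thesis by (auto simp: Cyl_iff)
qed

lemma open_Cyl: "ends_open V rt up (Cyl x)"
  unfolding ends_open_def
proof (intro conjI ballI)
  fix \<xi> assume "\<xi> \<in> Cyl x"
  then have "\<xi> (dep x) = x" by (simp add: Cyl_iff)
  then show "\<exists>n. Cyl (\<xi> n) \<subseteq> Cyl x" by (intro exI[of _ "dep x"]) simp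
qed (rule Cyl_sub)

section \<open>Cylinders and the Borel sets of the boundary\<close>

lemma space_BE [simp]: "space BE = Ends"
  unfolding ends_borel_def by (rule space_measure_of) (auto simp: ends_open_def)

lemma Cyl_BE [measurable]: "Cyl x \<in> sets BE"
  unfolding ends_borel_def using open_Cyl by (subst sets_measure_of) (auto simp: ends_open_def)

text \<open>There are only countably many cylinders, and an open set is the union of those it
  contains. The empty set is added to make the family stable under intersections.\<close>

lemma sets_BE_Cyl: "sets BE = sigma_sets Ends (insert {} (Cyl ` V))"
proof -
  have 1: "sets BE = sigma_sets Ends {U. ends_open V rt up U}"
    unfolding ends_borel_def by (rule sets_measure_of) (auto simp: ends_open_def)
  have "sigma_sets Ends {U. ends_open V rt up U} = sigma_sets Ends (insert {} (Cyl ` V))"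
  proof (rule sigma_sets_eqI)
    fix U assume "U \<in> {U. ends_open V rt up U}"
    then have U: "ends_open V rt up U" by simp
    have "U = (\<Union>x\<in>{x\<in>V. Cyl x \<subseteq> U}. Cyl x)"
    proof (intro set_eqI iffI)
      fix \<xi> assume "\<xi> \<in> U"
      then obtain n where "Cyl (\<xi> n) \<subseteq> U" "\<xi> \<in> Ends" using U unfolding ends_open_def by blast
      then show "\<xi> \<in> (\<Union>x\<in>{x\<in>V. Cyl x \<subseteq> U}. Cyl x)" using Cyl_ends ends_V by blast
    qed auto
    also have "\<dots> \<in> sigma_sets Ends (insert {} (Cyl ` V))"
      by (intro sigma_sets_UNION countable_subset[OF _ countable_image[OF countable_V, of Cyl]] countable_image)
         (auto intro: countable_subset[OF _ countable_V])
    finally show "U \<in> sigma_sets Ends (insert {} (Cyl ` V))" .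
  next
    fix U assume "U \<in> insert {} (Cyl ` V)"
    then show "U \<in> sigma_sets Ends {U. ends_open V rt up U}"
      using open_Cyl by (auto intro: sigma_sets.Empty)
  qed
  with 1 show ?thesis by simp
qed

lemma Int_stable_Cyl: "Int_stable (insert {} (Cyl ` V))"
proof -
  have "Cyl x \<inter> Cyl y \<in> insert {} (Cyl ` V)" if "x \<in> V" "y \<in> V" for x y
  proof (cases "dep x \<le> dep y")
    case True
    then have "Cyl y \<subseteq> Cyl x \<or> Cyl x \<inter> Cyl y = {}" by (rule Cyl_nested)
    then show ?thesis using that by (auto simp: Int_absorb1)
  next
    case False
    then have "Cyl x \<subseteq> Cyl y \<or> Cyl y \<inter> Cyl x = {}" by (intro Cyl_nested) simp
    then show ?thesis using that by (auto simp: Int_absorb2)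
  qed
  then show ?thesis by (auto simp: Int_stable_def)
qed

text \<open>Cylinders are nested or disjoint, hence a pi-system, and \<open>Ends\<close> is itself
  the cylinder of the root. Identities between measures on the boundary are reduced to cylinders in
  this way.\<close>

lemma measure_eqI_Cyl:
  assumes "sets M = sets BE" "sets N = sets BE" "emeasure M Ends \<noteq> \<infinity>"
    and "\<And>x. x \<in> V \<Longrightarrow> emeasure M (Cyl x) = emeasure N (Cyl x)"
  shows "M = N"
proof (rule measure_eqI_generator_eq[OF Int_stable_Cyl, where \<Omega> = Ends and A = "\<lambda>_. Ends"])
  show "insert {} (Cyl ` V) \<subseteq> Pow Ends" using Cyl_sub by auto
  show "sets M = sigma_sets Ends (insert {} (Cyl ` V))" "sets N = sigma_sets Ends (insert {} (Cyl ` V))"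
    using assms sets_BE_Cyl by auto
  show "range (\<lambda>_. Ends) \<subseteq> insert {} (Cyl ` V)" using Cyl_rt by auto
qed (use assms in auto)

lemma measurable_coord: "(\<lambda>\<xi>. \<xi> n) \<in> BE \<rightarrow>\<^sub>M count_space V"
proof (rule measurable_count_space_eq_countable[OF countable_V, THEN iffD2], safe)
  fix \<xi> assume "\<xi> \<in> space BE" then show "\<xi> n \<in> V" using ends_V by simp
next
  fix x assume "x \<in> V"
  have "(\<lambda>\<xi>. \<xi> n) -` {x} \<inter> space BE = (if x \<in> level n then Cyl x else {})"
    using ends_level[of _ n] Cyl_level[of x n] by (auto simp: Cyl_iff levelD ends_dep)
  then show "(\<lambda>\<xi>. \<xi> n) -` {x} \<inter> space BE \<in> sets BE" by simp
qed

lemma measurable_lev [measurable]: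
  fixes f :: "'v \<Rightarrow> 'b :: topological_space"
  shows "(\<lambda>\<xi>. f (\<xi> n)) \<in> borel_measurable BE"
  using measurable_compose[OF measurable_coord[of n], of f borel] by simp

end

section \<open>Averages over cylinders and their almost sure convergence\<close>

text \<open>Full support enters as positive mass of every cylinder. The measure is a parameter
  because the results apply both to the prescribed measure and to the limit distribution of a
  walk.\<close>

locale end_measure = rtree V rt up + prob_space \<mu>
  for V :: "'v set" and rt :: 'v and up :: "'v \<Rightarrow> 'v" and \<mu> :: "(nat \<Rightarrow> 'v) measure" +
  assumes sets_mu [measurable_cong]: "sets \<mu> = sets (ends_borel V rt up)"
    and mu_pos: "x \<in> V \<Longrightarrow> 0 < measure \<mu> (ends_at V rt up x)"
begin

abbreviation "mu x \<equiv> measure \<mu> (Cyl x)"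

text \<open>The conditional expectation of \<open>f\<close> given the vertex of the ray at level
  \<open>dep x\<close>; along a random ray the averages form a martingale.\<close>

definition avg :: "((nat \<Rightarrow> 'v) \<Rightarrow> real) \<Rightarrow> 'v \<Rightarrow> real" where
  "avg f x = (LINT \<xi>:Cyl x|\<mu>. f \<xi>) / mu x"

lemma space_mu [simp]: "space \<mu> = Ends"
  using sets_eq_imp_space_eq[OF sets_mu] by simp

lemma Cyl_mu [measurable, simp]: "Cyl x \<in> sets \<mu>"
  using Cyl_BE sets_mu by simp

lemma Ends_mu [measurable, simp]: "Ends \<in> sets \<mu>"
  using Cyl_mu[of rt] by (simp add: Cyl_rt)

lemma mu_rt [simp]: "mu rt = 1" using prob_space by (simp add: Cyl_rt)

lemma mu_neq_0: "x \<in> V \<Longrightarrow> mu x \<noteq> 0" using mu_pos by fastforce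

lemma mu_ch: "u \<in> V \<Longrightarrow> mu u = (\<Sum>x\<in>ch u. mu x)"
  by (subst Cyl_ch) (auto intro!: finite_measure_finite_Union finite_ch disj_ch)

lemma measurable_lev_mu [measurable]:
  fixes f :: "'v \<Rightarrow> 'b :: topological_space"
  shows "(\<lambda>\<xi>. f (\<xi> n)) \<in> borel_measurable \<mu>"
  using measurable_lev[of f n] measurable_cong_sets[OF sets_mu refl] by blast

lemma set_int: "integrable \<mu> f \<Longrightarrow> set_integrable \<mu> (Cyl x) (f :: _ \<Rightarrow> real)"
  unfolding set_integrable_def by (rule integrable_mult_indicator) auto

lemma set_integral_ch: "integrable \<mu> f \<Longrightarrow> u \<in> V \<Longrightarrow> (LINT \<xi>:Cyl u|\<mu>. f \<xi>) = (\<Sum>x\<in>ch u. LINT \<xi>:Cyl x|\<mu>. (f \<xi> :: real))"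
  by (subst Cyl_ch) (auto intro!: set_integral_finite_Union finite_ch disj_ch set_int)

lemma mu_avg: "x \<in> V \<Longrightarrow> mu x * avg f x = (LINT \<xi>:Cyl x|\<mu>. f \<xi>)"
  using mu_neq_0 by (simp add: avg_def)

lemma avg_ch: "integrable \<mu> f \<Longrightarrow> u \<in> V \<Longrightarrow> mu u * avg f u = (\<Sum>x\<in>ch u. mu x * avg f x)"
  by (simp add: mu_avg set_integral_ch ch_V cong: sum.cong)

lemma avg_rt: "integrable \<mu> f \<Longrightarrow> avg f rt = (\<integral>\<xi>. f \<xi> \<partial>\<mu>)"
  using set_integral_space[of \<mu> f] prob_space by (simp add: avg_def Cyl_rt)

lemma avg_const: "x \<in> V \<Longrightarrow> avg (\<lambda>_. c) x = c"
  using mu_neq_0[of x] by (simp add: avg_def set_integral_const emeasure_eq_measure)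

lemma avg_add: "integrable \<mu> f \<Longrightarrow> integrable \<mu> g \<Longrightarrow> avg (\<lambda>\<xi>. f \<xi> + g \<xi>) x = avg f x + avg g x"
  by (simp add: avg_def set_integral_add set_int add_divide_distrib)

lemma avg_cmult: "avg (\<lambda>\<xi>. c * f \<xi>) x = c * avg f x"
  by (simp add: avg_def)

lemma avg_diff: "integrable \<mu> f \<Longrightarrow> integrable \<mu> g \<Longrightarrow> avg (\<lambda>\<xi>. f \<xi> - g \<xi>) x = avg f x - avg g x"
  by (simp add: avg_def set_integral_diff set_int diff_divide_distrib)

lemma avg_mono: "integrable \<mu> f \<Longrightarrow> integrable \<mu> g \<Longrightarrow> (\<And>\<xi>. f \<xi> \<le> g \<xi>) \<Longrightarrow> avg f x \<le> avg g x"
  unfolding avg_def by (intro divide_right_mono set_integral_mono set_int) auto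

lemma avg_abs_le: "integrable \<mu> f \<Longrightarrow> \<bar>avg f x\<bar> \<le> avg (\<lambda>\<xi>. \<bar>f \<xi>\<bar>) x"
  using avg_mono[of f "\<lambda>\<xi>. \<bar>f \<xi>\<bar>" x] avg_mono[of "\<lambda>\<xi>. -\<bar>f \<xi>\<bar>" f x] avg_cmult[of "-1" "\<lambda>\<xi>. \<bar>f \<xi>\<bar>" x]
  by fastforce

section \<open>The maximal inequality for averages\<close>

definition maxset :: "((nat \<Rightarrow> 'v) \<Rightarrow> real) \<Rightarrow> real \<Rightarrow> 'v \<Rightarrow> nat \<Rightarrow> (nat \<Rightarrow> 'v) set" where
  "maxset f l x k = {\<xi>\<in>Cyl x. \<exists>i\<in>{dep x..dep x + k}. l < avg f (\<xi> i)}"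

lemma maxset_sets [measurable, simp]: "maxset f l x k \<in> sets \<mu>"
proof -
  have "maxset f l x k = Cyl x \<inter> {\<xi>\<in>space \<mu>. \<exists>i\<in>{dep x..dep x + k}. l < avg f (\<xi> i)}"
    using Cyl_sub by (auto simp: maxset_def)
  also have "\<dots> \<in> sets \<mu>" by measurable
  finally show ?thesis .
qed

text \<open>A stopping argument: if the average at \<open>x\<close> exceeds \<open>l\<close>, then
  \<open>l * mu x\<close> is already below the integral; otherwise the set splits over the children
  and the induction hypotheses add up. The induction needs arbitrary starting vertices, although
  only the root is used afterwards.\<close>

lemma maximal_aux:
  assumes f: "integrable \<mu> f" "\<And>\<xi>. 0 \<le> f \<xi>" and l: "0 \<le> l" and x: "x \<in> V"
  shows "l * measure \<mu> (maxset f l x k) \<le> (LINT \<xi>:Cyl x|\<mu>. f \<xi>)"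
  using x
proof (induction k arbitrary: x)
  have big: "l * measure \<mu> (maxset f l x k) \<le> (LINT \<xi>:Cyl x|\<mu>. f \<xi>)" if "x \<in> V" "l < avg f x" for x k
  proof -
    have "measure \<mu> (maxset f l x k) \<le> mu x"
      by (intro finite_measure_mono) (auto simp: maxset_def)
    then have "l * measure \<mu> (maxset f l x k) \<le> avg f x * mu x"
      using that l by (intro mult_mono) auto
    then show ?thesis using mu_avg[OF that(1)] by (simp add: mult.commute)
  qed
  have nonneg: "0 \<le> (LINT \<xi>:Cyl x|\<mu>. f \<xi>)" for x
    unfolding set_lebesgue_integral_def using f by (intro integral_nonneg_AE) auto
  {
    case 0
    show ?case
    proof (cases "l < avg f x")
      case False
      then have "maxset f l x 0 = {}" by (auto simp: maxset_def Cyl_iff)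
      then show ?thesis using nonneg by simp
    qed (use 0 big in blast)
  next
    case (Suc k)
    show ?case
    proof (cases "l < avg f x")
      case False
      have sub: "maxset f l x (Suc k) \<subseteq> (\<Union>y\<in>ch x. maxset f l y k)"
      proof
        fix \<xi> assume "\<xi> \<in> maxset f l x (Suc k)"
        then obtain i where i: "\<xi> \<in> Cyl x" "dep x \<le> i" "i \<le> dep x + Suc k" "l < avg f (\<xi> i)"
          by (auto simp: maxset_def)
        then obtain y where y: "y \<in> ch x" "\<xi> \<in> Cyl y" using Cyl_ch Suc.prems by blast
        have "i \<noteq> dep x" using i False by (auto simp: Cyl_iff)
        with i y dep_ch[OF y(1)] show "\<xi> \<in> (\<Union>y\<in>ch x. maxset f l y k)"
          by (auto simp: maxset_def intro!: bexI[of _ y] bexI[of _ i])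
      qed
      have "l * measure \<mu> (maxset f l x (Suc k)) \<le> l * measure \<mu> (\<Union>y\<in>ch x. maxset f l y k)"
        using l finite_ch[of x] by (intro mult_left_mono finite_measure_mono sub) auto
      also have "\<dots> \<le> l * (\<Sum>y\<in>ch x. measure \<mu> (maxset f l y k))"
        using l finite_ch by (intro mult_left_mono measure_UNION_le) auto
      also have "\<dots> \<le> (\<Sum>y\<in>ch x. LINT \<xi>:Cyl y|\<mu>. f \<xi>)"
        unfolding sum_distrib_left using Suc.IH ch_V by (intro sum_mono) auto
      also have "\<dots> = (LINT \<xi>:Cyl x|\<mu>. f \<xi>)" using set_integral_ch f Suc.prems by simp
      finally show ?thesis .
    qed (use Suc.prems big in blast)
  }
qed

lemma maximal:
  assumes f: "integrable \<mu> f" "\<And>\<xi>. 0 \<le> f \<xi>" and l: "0 \<le> l"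
  shows "l * measure \<mu> {\<xi>\<in>Ends. \<exists>i. l < avg f (\<xi> i)} \<le> (\<integral>\<xi>. f \<xi> \<partial>\<mu>)"
proof -
  have eq: "{\<xi>\<in>Ends. \<exists>i. l < avg f (\<xi> i)} = (\<Union>k. maxset f l rt k)"
    by (fastforce simp: maxset_def Cyl_rt)
  have "incseq (maxset f l rt)"
    by (intro incseq_SucI) (auto simp: maxset_def)
  then have "(\<lambda>k. measure \<mu> (maxset f l rt k)) \<longlonglongrightarrow> measure \<mu> (\<Union>k. maxset f l rt k)"
    by (intro finite_Lim_measure_incseq) auto
  then have "(\<lambda>k. l * measure \<mu> (maxset f l rt k)) \<longlonglongrightarrow> l * measure \<mu> (\<Union>k. maxset f l rt k)"
    by (intro tendsto_intros)
  moreover have "l * measure \<mu> (maxset f l rt k) \<le> (\<integral>\<xi>. f \<xi> \<partial>\<mu>)" for k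
    using maximal_aux[OF f l rt_V, of k] set_integral_space[OF f(1)] by (simp add: Cyl_rt)
  ultimately show ?thesis unfolding eq by (intro LIMSEQ_le_const2) auto
qed

section \<open>Almost sure convergence of averages to the function\<close>

definition cnv :: "((nat \<Rightarrow> 'v) \<Rightarrow> real) \<Rightarrow> bool" where
  "cnv f \<longleftrightarrow> (AE \<xi> in \<mu>. (\<lambda>n. avg f (\<xi> n)) \<longlonglongrightarrow> f \<xi>)"

lemma cnv_add: "integrable \<mu> f \<Longrightarrow> integrable \<mu> g \<Longrightarrow> cnv f \<Longrightarrow> cnv g \<Longrightarrow> cnv (\<lambda>\<xi>. f \<xi> + g \<xi>)"
  unfolding cnv_def by (elim AE_mp, intro AE_I2) (auto simp: avg_add intro: tendsto_add)

lemma cnv_cmult: "cnv f \<Longrightarrow> cnv (\<lambda>\<xi>. c * f \<xi>)"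
  unfolding cnv_def by (elim AE_mp, intro AE_I2) (auto simp: avg_cmult intro: tendsto_mult_left)

lemma cnv_const: "cnv (\<lambda>_. c)"
  unfolding cnv_def
proof (rule AE_I2)
  fix \<xi> assume "\<xi> \<in> space \<mu>"
  then have "avg (\<lambda>_. c) (\<xi> n) = c" for n by (simp add: avg_const ends_V)
  then show "(\<lambda>n. avg (\<lambda>_. c) (\<xi> n)) \<longlonglongrightarrow> c" by simp
qed

lemma cnv_sum: "finite I \<Longrightarrow> (\<And>i. i \<in> I \<Longrightarrow> integrable \<mu> (f i)) \<Longrightarrow> (\<And>i. i \<in> I \<Longrightarrow> cnv (f i)) \<Longrightarrow> cnv (\<lambda>\<xi>. \<Sum>i\<in>I. f i \<xi>)"
  by (induction I rule: finite_induct) (auto simp: cnv_const intro!: cnv_add)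

text \<open>For an approximant \<open>g\<close> the error splits into the average of
  \<open>f - g\<close>, the error of \<open>g\<close>, and \<open>f - g\<close> itself. The maximal
  inequality controls the first part, Markov's inequality the last.\<close>

lemma cnv_closed:
  assumes f: "integrable \<mu> f"
    and app: "\<And>e. 0 < e \<Longrightarrow> \<exists>g. integrable \<mu> g \<and> cnv g \<and> (\<integral>\<xi>. \<bar>f \<xi> - g \<xi>\<bar> \<partial>\<mu>) \<le> e"
  shows "cnv f"
proof -
  have fm [measurable]: "f \<in> borel_measurable \<mu>" using f by auto
  \<comment> \<open>One \<open>l\<close> for each of the three parts of the error; the exceptional
    sets \<open>S\<close> and \<open>R\<close> below belong to the first and the last part.\<close>
  define Bad where "Bad l = {\<xi>\<in>space \<mu>. \<not> (\<exists>N. \<forall>n\<ge>N. \<bar>avg f (\<xi> n) - f \<xi>\<bar> \<le> 3 * l)}" for l :: real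
  have Bad_sets [measurable]: "Bad l \<in> sets \<mu>" for l unfolding Bad_def by measurable
  have "measure \<mu> (Bad l) = 0" if l: "0 < l" for l
  proof -
    have "measure \<mu> (Bad l) \<le> 0 + e" if e: "0 < e" for e
    proof -
      \<comment> \<open>Both inequalities divide by \<open>l\<close>, so this accuracy leaves mass
        at most \<open>e / 2\<close> for each exceptional set.\<close>
      obtain g where g: "integrable \<mu> g" "cnv g" "(\<integral>\<xi>. \<bar>f \<xi> - g \<xi>\<bar> \<partial>\<mu>) \<le> e * l / 2"
        using app[of "e * l / 2"] e l by auto
      let ?d = "\<lambda>\<xi>. \<bar>f \<xi> - g \<xi>\<bar>"
      have gm [measurable]: "g \<in> borel_measurable \<mu>" using g by auto
      have d: "integrable \<mu> ?d" using f g by auto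
      define S where "S = {\<xi>\<in>Ends. \<exists>i. l < avg ?d (\<xi> i)}"
      define R where "R = {\<xi>\<in>space \<mu>. l \<le> ?d \<xi>}"
      have S_sets: "S \<in> sets \<mu>"
        unfolding S_def space_mu[symmetric] by measurable
      have R_sets: "R \<in> sets \<mu>" unfolding R_def by measurable
      have "AE \<xi> in \<mu>. \<xi> \<in> Bad l \<longrightarrow> \<xi> \<in> S \<union> R"
        using g(2)[unfolded cnv_def] AE_space
      proof eventually_elim
        case (elim \<xi>)
        show ?case
        proof (rule impI, rule ccontr)
          assume B: "\<xi> \<in> Bad l" and nS: "\<xi> \<notin> S \<union> R"
          from elim(1) obtain N where N: "\<And>n. n \<ge> N \<Longrightarrow> \<bar>avg g (\<xi> n) - g \<xi>\<bar> < l"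
            using l by (auto simp: LIMSEQ_def dist_real_def)
          have "\<bar>avg f (\<xi> n) - f \<xi>\<bar> \<le> 3 * l" if "n \<ge> N" for n
          proof -
            have "\<bar>avg f (\<xi> n) - avg g (\<xi> n)\<bar> \<le> avg ?d (\<xi> n)"
              using avg_abs_le[of "\<lambda>\<xi>. f \<xi> - g \<xi>" "\<xi> n"] f g by (simp add: avg_diff)
            moreover have "avg ?d (\<xi> n) \<le> l" "?d \<xi> \<le> l" using nS elim by (auto simp: S_def R_def not_less)
            ultimately show ?thesis using N[OF that] by linarith
          qed
          with B show False by (auto simp: Bad_def)
        qed
      qed
      then have "measure \<mu> (Bad l) \<le> measure \<mu> (S \<union> R)"
        using S_sets R_sets by (intro finite_measure_mono_AE) auto
      also have "\<dots> \<le> measure \<mu> S + measure \<mu> R"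
        using S_sets R_sets by (intro measure_Un_le) auto
      also have "measure \<mu> S \<le> e / 2"
      proof -
        have "l * measure \<mu> S \<le> (\<integral>\<xi>. ?d \<xi> \<partial>\<mu>)"
          using maximal[OF d, of l] l unfolding S_def[symmetric] by simp
        then have "l * measure \<mu> S \<le> l * (e / 2)" using g(3) by (simp add: mult.commute)
        then show ?thesis using l by (simp only: mult_le_cancel_left_pos)
      qed
      also have "measure \<mu> R \<le> e / 2"
      proof -
        have "measure \<mu> R \<le> (\<integral>\<xi>. ?d \<xi> \<partial>\<mu>) / l"
          unfolding R_def using integral_Markov_inequality_measure[OF d, of "{}" l] l by simp
        also have "\<dots> \<le> (e * l / 2) / l" using g(3) l by (intro divide_right_mono) auto
        finally show ?thesis using l by simp
      qed
      finally show ?thesis by simp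
    qed
    then have "measure \<mu> (Bad l) \<le> 0" by (rule field_le_epsilon)
    then show ?thesis by (simp add: measure_le_0_iff)
  qed
  then have "AE \<xi> in \<mu>. \<xi> \<notin> Bad (1 / real (Suc k))" for k
    by (intro AE_not_in) (auto simp: null_sets_def emeasure_eq_measure)
  then have "AE \<xi> in \<mu>. \<forall>k. \<xi> \<notin> Bad (1 / real (Suc k))" by (simp add: AE_all_countable)
  then show ?thesis unfolding cnv_def using AE_space
  proof eventually_elim
    case (elim \<xi>)
    show ?case
    proof (rule LIMSEQ_I)
      fix r :: real assume "0 < r"
      then obtain k where k: "1 / real (Suc k) < r / 3" using nat_approx_posE[of "r / 3"] by auto
      have "\<xi> \<notin> Bad (1 / real (Suc k))" using elim by blast
      then obtain N where N: "\<forall>n\<ge>N. \<bar>avg f (\<xi> n) - f \<xi>\<bar> \<le> 3 * (1 / real (Suc k))"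
        using elim unfolding Bad_def by blast
      have "\<forall>n\<ge>N. \<bar>avg f (\<xi> n) - f \<xi>\<bar> < r"
      proof (intro allI impI)
        fix n assume "N \<le> n"
        then have "\<bar>avg f (\<xi> n) - f \<xi>\<bar> \<le> 3 * (1 / real (Suc k))" using N by blast
        then show "\<bar>avg f (\<xi> n) - f \<xi>\<bar> < r" using k by linarith
      qed
      then show "\<exists>no. \<forall>n\<ge>no. norm (avg f (\<xi> n) - f \<xi>) < r" by auto
    qed
  qed
qed

lemma integrable_ind: "A \<in> sets \<mu> \<Longrightarrow> integrable \<mu> (indicator A :: _ \<Rightarrow> real)"
  by (simp add: integrable_indicator_iff emeasure_eq_measure)

text \<open>Averages of the indicator of a cylinder are eventually constant along each ray, since
  cylinders are nested or disjoint. Complements follow by linearity, and a disjoint union is the L^1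
  limit of its finite partial unions.\<close>

lemma cnv_indicator:
  assumes "A \<in> sets \<mu>" shows "cnv (indicator A)"
proof -
  have sg: "sets \<mu> = sigma_sets Ends (insert {} (Cyl ` V))" using sets_mu sets_BE_Cyl by simp
  have "insert {} (Cyl ` V) \<subseteq> Pow Ends" using Cyl_sub by auto
  moreover have "A \<in> sigma_sets Ends (insert {} (Cyl ` V))" using assms sg by simp
  ultimately show ?thesis
  proof (induction rule: sigma_sets_induct_disjoint[OF Int_stable_Cyl, consumes 2, case_names basic empty compl union])
    case (basic A)
    show ?case
    proof (cases "A = {}")
      case True
      then show ?thesis using cnv_const[of 0] by (simp add: indicator_def)
    next
      case False
      then obtain x where x: "x \<in> V" "A = Cyl x" using basic by auto
      have "(\<lambda>n. avg (indicator A) (\<xi> n)) \<longlonglongrightarrow> indicator A \<xi>" if xi: "\<xi> \<in> Ends" for \<xi>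
      proof (rule tendsto_eventually)
        have "avg (indicator A) (\<xi> n) = indicator A \<xi>" if n: "n \<ge> dep x" for n
        proof -
          have "Cyl (\<xi> n) \<subseteq> Cyl x \<or> Cyl x \<inter> Cyl (\<xi> n) = {}" using n xi by (intro Cyl_nested) (simp add: ends_dep)
          moreover have "\<xi> \<in> Cyl (\<xi> n)" using xi by (rule Cyl_ends)
          ultimately have "indicator A \<eta> = (indicator A \<xi> :: real)" if "\<eta> \<in> Cyl (\<xi> n)" for \<eta>
            using that x by (auto simp: indicator_def)
          then have "avg (indicator A) (\<xi> n) = avg (\<lambda>_. indicator A \<xi>) (\<xi> n)"
            unfolding avg_def by (intro arg_cong2[where f = "(/)"] set_lebesgue_integral_cong) auto
          then show ?thesis using xi by (simp add: avg_const ends_V)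
        qed
        then show "\<forall>\<^sub>F n in sequentially. avg (indicator A) (\<xi> n) = indicator A \<xi>"
          unfolding eventually_sequentially by blast
      qed
      then show ?thesis unfolding cnv_def by (intro AE_I2) simp
    qed
  next
    case empty
    then show ?case using cnv_const[of 0] by (simp add: indicator_def)
  next
    case (compl A)
    then have A: "A \<in> sets \<mu>" by (simp add: sg)
    have "cnv (\<lambda>\<xi>. 1 + (-1) * indicator A \<xi>)"
      using compl integrable_ind[OF A] by (intro cnv_add cnv_cmult cnv_const) auto
    moreover have "AE \<xi> in \<mu>. indicator (Ends - A) \<xi> = 1 + (-1) * (indicator A \<xi> :: real)"
      by (intro AE_I2) (auto simp: indicator_def)
    moreover have "avg (indicator (Ends - A)) x = avg (\<lambda>\<xi>. 1 + (-1) * indicator A \<xi>) x" for x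
      unfolding avg_def using Cyl_sub
      by (intro arg_cong2[where f = "(/)"] set_lebesgue_integral_cong) (auto simp: indicator_def)
    ultimately show ?case unfolding cnv_def by auto
  next
    case (union F)
    have F: "F i \<in> sets \<mu>" for i using union(2) rangeI[of F i] unfolding sg by blast
    let ?U = "\<Union>i. F i"
    show ?case
    proof (rule cnv_closed)
      show "integrable \<mu> (indicator ?U :: _ \<Rightarrow> real)" using F by (intro integrable_ind) auto
      fix e :: real assume e: "0 < e"
      have "(\<lambda>i. measure \<mu> (F i)) sums measure \<mu> ?U"
        using F union by (intro finite_measure_UNION) auto
      then have "(\<lambda>k. \<Sum>i<k. measure \<mu> (F i)) \<longlonglongrightarrow> measure \<mu> ?U" by (simp add: sums_def)
      then obtain k where k: "\<bar>(\<Sum>i<k. measure \<mu> (F i)) - measure \<mu> ?U\<bar> < e"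
        using e unfolding LIMSEQ_def dist_real_def by blast
      let ?g = "\<lambda>\<xi>. \<Sum>i<k. (indicator (F i) \<xi> :: real)"
      have g: "integrable \<mu> ?g" using F integrable_ind by auto
      have g': "?g = indicator (\<Union>i<k. F i)"
        using union(1) by (intro ext indicator_UN_disjoint[symmetric]) (auto simp: disjoint_family_on_def)
      have "?g \<xi> \<le> indicator ?U \<xi>" for \<xi>
        unfolding fun_cong[OF g', of \<xi>] by (auto simp: indicator_def)
      then have "\<bar>indicator ?U \<xi> - ?g \<xi>\<bar> = indicator ?U \<xi> - ?g \<xi>" for \<xi>
        by (simp only: abs_of_nonneg diff_ge_0_iff_ge)
      then have "(\<integral>\<xi>. \<bar>indicator ?U \<xi> - ?g \<xi>\<bar> \<partial>\<mu>) = (\<integral>\<xi>. indicator ?U \<xi> - ?g \<xi> \<partial>\<mu>)" by presburger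
      also have "\<dots> = measure \<mu> ?U - (\<Sum>i<k. measure \<mu> (F i))"
      proof -
        have FE: "F i \<inter> Ends = F i" for i using sets.sets_into_space[OF F[of i]] by auto
        then have UE: "?U \<inter> Ends = ?U" by blast
        show ?thesis
          using F integrable_ind UE FE by (subst Bochner_Integration.integral_diff) (simp_all add: g)
      qed
      also have "\<dots> \<le> e" using k by linarith
      finally show "\<exists>g. integrable \<mu> g \<and> cnv g \<and> (\<integral>\<xi>. \<bar>indicator ?U \<xi> - g \<xi>\<bar> \<partial>\<mu>) \<le> e"
        using g cnv_sum[of "{..<k}" "\<lambda>i. indicator (F i)"] F integrable_ind union by blast
    qed
  qed
qed

lemma cnv_integrable: "integrable \<mu> f \<Longrightarrow> cnv f"
proof (induction rule: integrable_induct)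
  case (base A c)
  then show ?case using cnv_cmult[OF cnv_indicator[of A], of c] by (simp add: mult.commute)
next
  case (add f g)
  then show ?case by (simp add: cnv_add)
next
  case (lim f s)
  show ?case
  proof (rule cnv_closed)
    fix e :: real assume e: "0 < e"
    have "(\<lambda>i. \<integral>\<xi>. \<bar>f \<xi> - s i \<xi>\<bar> \<partial>\<mu>) \<longlonglongrightarrow> (\<integral>\<xi>. 0 \<partial>\<mu>)"
    \<comment> \<open>The approximants satisfy |s| <= 2 |f|, whence the factor 3.\<close>
    proof (rule integral_dominated_convergence[where w = "\<lambda>\<xi>. 3 * \<bar>f \<xi>\<bar>"])
      show "AE \<xi> in \<mu>. (\<lambda>i. \<bar>f \<xi> - s i \<xi>\<bar>) \<longlonglongrightarrow> 0"
      proof (rule AE_I2)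
        fix \<xi> assume "\<xi> \<in> space \<mu>"
        then have "(\<lambda>i. \<bar>f \<xi> - s i \<xi>\<bar>) \<longlonglongrightarrow> \<bar>f \<xi> - f \<xi>\<bar>" using lim.hyps(2) by (intro tendsto_intros)
        then show "(\<lambda>i. \<bar>f \<xi> - s i \<xi>\<bar>) \<longlonglongrightarrow> 0" by simp
      qed
      show "AE \<xi> in \<mu>. norm \<bar>f \<xi> - s i \<xi>\<bar> \<le> 3 * \<bar>f \<xi>\<bar>" for i
      proof (rule AE_I2)
        fix \<xi> assume "\<xi> \<in> space \<mu>"
        then have "norm (s i \<xi>) \<le> 2 * norm (f \<xi>)" using lim.hyps(3) by blast
        then show "norm \<bar>f \<xi> - s i \<xi>\<bar> \<le> 3 * \<bar>f \<xi>\<bar>" by simp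
      qed
    qed (use lim in auto)
    then have "(\<lambda>i. \<integral>\<xi>. \<bar>f \<xi> - s i \<xi>\<bar> \<partial>\<mu>) \<longlonglongrightarrow> 0" by simp
    then obtain i where "(\<integral>\<xi>. \<bar>f \<xi> - s i \<xi>\<bar> \<partial>\<mu>) < e"
      using e order_tendstoD(2)[of _ 0 sequentially e] by (metis (no_types, lifting) eventually_sequentially order_refl)
    then show "\<exists>g. integrable \<mu> g \<and> cnv g \<and> (\<integral>\<xi>. \<bar>f \<xi> - g \<xi>\<bar> \<partial>\<mu>) \<le> e"
      using lim by (intro exI[of _ "s i"]) auto
  qed (use lim in auto)
qed

section \<open>Functions of one level, and Jensen's inequality on cylinders\<close>

lemma nn_integral_lev: "(\<integral>\<^sup>+\<xi>. f (\<xi> n) \<partial>\<mu>) = (\<Sum>x\<in>level n. ennreal (mu x) * f x)"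
proof -
  have "(\<integral>\<^sup>+\<xi>. f (\<xi> n) \<partial>\<mu>) = (\<integral>\<^sup>+\<xi>. (\<Sum>x\<in>level n. f x * indicator (Cyl x) \<xi>) \<partial>\<mu>)"
  proof (rule nn_integral_cong)
    fix \<xi> assume "\<xi> \<in> space \<mu>"
    then have xi: "\<xi> \<in> Ends" by simp
    have "(\<Sum>x\<in>level n. f x * indicator (Cyl x) \<xi>) = (\<Sum>x\<in>level n. if x = \<xi> n then f x else 0)"
      using xi by (intro sum.cong) (auto simp: Cyl_level indicator_def)
    also have "\<dots> = f (\<xi> n)" using finite_level[of n] ends_level[OF xi, of n] by (simp add: sum.delta')
    finally show "f (\<xi> n) = (\<Sum>x\<in>level n. f x * indicator (Cyl x) \<xi>)" by simp
  qed
  also have "\<dots> = (\<Sum>x\<in>level n. \<integral>\<^sup>+\<xi>. f x * indicator (Cyl x) \<xi> \<partial>\<mu>)"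
    by (intro nn_integral_sum) auto
  also have "\<dots> = (\<Sum>x\<in>level n. ennreal (mu x) * f x)"
    by (intro sum.cong) (auto simp: nn_integral_cmult_indicator emeasure_eq_measure mult.commute)
  finally show ?thesis .
qed

lemma integrable_lev [simp]: "integrable \<mu> (\<lambda>\<xi>. f (\<xi> n) :: real)"
proof (rule integrable_const_bound)
  show "AE \<xi> in \<mu>. norm (f (\<xi> n)) \<le> Max (insert 0 ((\<lambda>x. \<bar>f x\<bar>) ` level n))"
    using finite_level[of n] ends_level[of _ n] by (intro AE_I2 Max_ge) auto
qed measurable

lemma integral_lev: "(\<integral>\<xi>. f (\<xi> n) \<partial>\<mu>) = (\<Sum>x\<in>level n. mu x * (f x :: real))"
proof -
  have "(\<integral>\<xi>. f (\<xi> n) \<partial>\<mu>) = (\<integral>\<xi>. (\<Sum>x\<in>level n. f x * indicator (Cyl x) \<xi>) \<partial>\<mu>)"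
  proof (rule Bochner_Integration.integral_cong[OF refl])
    fix \<xi> assume "\<xi> \<in> space \<mu>"
    then have xi: "\<xi> \<in> Ends" by simp
    have "(\<Sum>x\<in>level n. f x * indicator (Cyl x) \<xi>) = (\<Sum>x\<in>level n. if x = \<xi> n then f x else 0)"
      using xi by (intro sum.cong) (auto simp: Cyl_level indicator_def)
    also have "\<dots> = f (\<xi> n)" using finite_level[of n] ends_level[OF xi, of n] by (simp add: sum.delta')
    finally show "f (\<xi> n) = (\<Sum>x\<in>level n. f x * indicator (Cyl x) \<xi>)" by simp
  qed
  also have "\<dots> = (\<Sum>x\<in>level n. \<integral>\<xi>. f x * indicator (Cyl x) \<xi> \<partial>\<mu>)"
    using integrable_ind by (intro Bochner_Integration.integral_sum integrable_mult_right) auto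
  also have "\<dots> = (\<Sum>x\<in>level n. mu x * f x)"
    by (intro sum.cong) (auto simp: mult.commute Int_absorb2[OF Cyl_sub])
  finally show ?thesis .
qed

text \<open>Nonnegative integrals are used because \<open>f\<close> is only integrable: when the
  square is not integrable on the cylinder, the right side is infinite and nothing is to be
  shown.\<close>

lemma jensen_Cyl:
  assumes f: "integrable \<mu> f" and x: "x \<in> V"
  shows "ennreal (mu x * (avg f x - c)^2) \<le> (\<integral>\<^sup>+\<xi>. ennreal ((f \<xi> - c)^2) * indicator (Cyl x) \<xi> \<partial>\<mu>)"
proof (cases "(\<integral>\<^sup>+\<xi>. ennreal ((f \<xi> - c)^2) * indicator (Cyl x) \<xi> \<partial>\<mu>) = \<infinity>")
  case False
  have fm [measurable]: "f \<in> borel_measurable \<mu>" using f by auto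
  have e: "ennreal ((f \<xi> - c)^2) * indicator (Cyl x) \<xi> = ennreal (indicator (Cyl x) \<xi> * (f \<xi> - c)^2)" for \<xi>
    by (auto simp: indicator_def)
  let ?a = "avg f x"
  let ?F = "\<lambda>\<xi>. indicator (Cyl x) \<xi> * (f \<xi> - c)^2"
  have F: "integrable \<mu> ?F"
    using False unfolding e by (intro integrableI_nonneg) (auto simp: top.not_eq_extremum)
  \<comment> \<open>\<open>p + q * t\<close> is the tangent of (t - c)^2 at t = \<open>?a\<close>:
    it lies below the parabola, and the average of \<open>p + q * f\<close> over the cylinder is the
    value of the tangent at \<open>?a\<close>.\<close>
  define p where "p = (?a - c)^2 - 2 * (?a - c) * ?a"
  define q where "q = 2 * (?a - c)"
  let ?G = "\<lambda>\<xi>. indicator (Cyl x) \<xi> *\<^sub>R (p + q * f \<xi>)"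
  have gi: "integrable \<mu> (\<lambda>\<xi>. p + q * f \<xi>)" using f by auto
  have G: "integrable \<mu> ?G"
    using set_int[OF gi, of x] by (simp add: set_integrable_def)
  have "avg (\<lambda>\<xi>. p + q * f \<xi>) x = p + q * ?a"
    using f by (subst avg_add) (auto simp: avg_const[OF x] avg_cmult)
  then have "mu x * avg (\<lambda>\<xi>. p + q * f \<xi>) x = mu x * (?a - c)^2" by (simp add: p_def q_def)
  then have "mu x * (?a - c)^2 = (\<integral>\<xi>. ?G \<xi> \<partial>\<mu>)"
    using mu_avg[OF x] by (simp add: set_lebesgue_integral_def)
  also have "\<dots> \<le> (\<integral>\<xi>. ?F \<xi> \<partial>\<mu>)"
  proof (rule integral_mono[OF G F])
    fix \<xi>
    have "0 \<le> (f \<xi> - ?a)^2" by simp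
    then have "p + q * f \<xi> \<le> (f \<xi> - c)^2"
      unfolding p_def q_def by (simp add: power2_eq_square algebra_simps)
    then show "?G \<xi> \<le> ?F \<xi>" by (auto simp: indicator_def)
  qed
  finally have "ennreal (mu x * (?a - c)^2) \<le> ennreal (\<integral>\<xi>. ?F \<xi> \<partial>\<mu>)" by (rule ennreal_leI)
  also have "\<dots> = (\<integral>\<^sup>+\<xi>. ennreal (?F \<xi>) \<partial>\<mu>)" by (rule nn_integral_eq_integral[OF F, symmetric]) simp
  finally show ?thesis unfolding e .
qed simp

end

section \<open>The energy of the harmonic extension in terms of the averages\<close>

text \<open>A Cesaro theorem with weights \<open>s (Suc n) - s n\<close>: as \<open>s\<close> is
  unbounded, any initial part is negligible. It serves for s = 1/g and H = h/g along a ray.\<close>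

lemma weighted_average_limit:
  fixes s a H :: "nat \<Rightarrow> real"
  assumes s: "\<And>n. 0 < s n" "\<And>n. s n \<le> s (Suc n)" "filterlim s at_top sequentially"
    and a: "a \<longlonglongrightarrow> L"
    and H: "\<And>n. H (Suc n) = H n + (s (Suc n) - s n) * a (Suc n)"
  shows "(\<lambda>n. H n / s n) \<longlonglongrightarrow> L"
proof (rule LIMSEQ_I)
  fix r :: real assume r: "0 < r"
  \<comment> \<open>\<open>K\<close> is the error before division by \<open>s n\<close>; after time
    \<open>N\<close> it grows by at most \<open>r / 2\<close> times the growth of
    \<open>s\<close>.\<close>
  define K where "K n = H n - L * s n" for n
  obtain N where N: "\<And>n. n \<ge> N \<Longrightarrow> \<bar>a n - L\<bar> < r / 2"
    using LIMSEQ_D[OF a, of "r / 2"] r by auto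
  have K: "\<bar>K (N + k)\<bar> \<le> \<bar>K N\<bar> + r / 2 * (s (N + k) - s N)" for k
  proof (induction k)
    case (Suc k)
    have "K (N + Suc k) = K (N + k) + (s (N + Suc k) - s (N + k)) * (a (N + Suc k) - L)"
      by (simp add: K_def H algebra_simps)
    also have "\<bar>\<dots>\<bar> \<le> \<bar>K (N + k)\<bar> + (s (N + Suc k) - s (N + k)) * (r / 2)"
    proof (rule order_trans[OF abs_triangle_ineq add_left_mono])
      have "0 \<le> s (N + Suc k) - s (N + k)" "\<bar>a (N + Suc k) - L\<bar> \<le> r / 2"
        using s(2)[of "N + k"] N[of "N + Suc k"] by auto
      then show "\<bar>(s (N + Suc k) - s (N + k)) * (a (N + Suc k) - L)\<bar> \<le> (s (N + Suc k) - s (N + k)) * (r / 2)"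
        unfolding abs_mult by (intro mult_mono) auto
    qed
    finally show ?case using Suc.IH by (simp add: algebra_simps)
  qed simp
  have "\<forall>\<^sub>F n in sequentially. 2 * \<bar>K N\<bar> / r < s n"
    using s(3) by (simp add: filterlim_at_top_dense)
  then obtain M where M: "\<And>n. n \<ge> M \<Longrightarrow> 2 * \<bar>K N\<bar> / r < s n" by (auto simp: eventually_sequentially)
  have "norm (H n / s n - L) < r" if "n \<ge> max M N" for n
  proof -
    have "H n / s n - L = K n / s n" using s(1)[of n] by (simp add: K_def field_simps)
    moreover have "\<bar>K n\<bar> \<le> \<bar>K N\<bar> + r / 2 * (s n - s N)" using K[of "n - N"] that by simp
    moreover have "\<bar>K N\<bar> < r / 2 * s n" using M[of n] that r by (simp add: field_simps)
    moreover have "0 < r / 2 * s N" using r s(1) by simp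
    moreover have "r / 2 * (s n - s N) = r * s n / 2 - r / 2 * s N" by (simp add: field_simps)
    moreover have "r / 2 * s n = r * s n / 2" by simp
    ultimately have "\<bar>K n\<bar> < r * s n" by linarith
    then show ?thesis using s(1)[of n] \<open>H n / s n - L = K n / s n\<close> by (simp add: field_simps)
  qed
  then show "\<exists>no. \<forall>n\<ge>no. norm (H n / s n - L) < r" by blast
qed

text \<open>The inductive step of (sum b_i)^2 <= (sum c_i) (sum b_i^2 / c_i), with \<open>G\<close>
  and \<open>S\<close> bounding the sums so far. The mixed term 2ab is absorbed by
  \<open>?p + ?q\<close>, since \<open>?p * ?q\<close> is at least a^2 b^2.\<close>

lemma cauchy_schwarz_step:
  fixes a b G S c :: real
  assumes "a^2 \<le> G * S" "0 \<le> G" "0 \<le> S" "0 < c"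
  shows "(a + b)^2 \<le> (G + c) * (S + b^2 / c)"
proof -
  let ?p = "G * b^2 / c" and ?q = "c * S"
  have "0 \<le> (?p - ?q)^2" by simp
  then have "4 * (?p * ?q) \<le> (?p + ?q)^2" by (simp add: power2_eq_square algebra_simps)
  moreover have "?p * ?q = G * S * b^2" using assms(4) by simp
  moreover have "a^2 * b^2 \<le> G * S * b^2" using assms(1) by (intro mult_right_mono) auto
  ultimately have "(2 * (a * b))^2 \<le> (?p + ?q)^2" by (simp add: power_mult_distrib)
  moreover have "0 \<le> ?p + ?q" using assms by simp
  ultimately have "2 * (a * b) \<le> ?p + ?q" using power2_le_imp_le by blast
  moreover have "(G + c) * (S + b^2 / c) = G * S + ?p + ?q + b^2"
    using assms(4) by (simp add: field_simps)
  moreover have "(a + b)^2 = a^2 + b^2 + 2 * (a * b)" by (simp add: power2_sum)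
  ultimately show ?thesis using assms(1) by linarith
qed

section \<open>Orthogonality of the increments of averages\<close>

context end_measure
begin

lemma integral_cong_ends: "(\<And>\<xi>. \<xi> \<in> Ends \<Longrightarrow> f \<xi> = f' \<xi>) \<Longrightarrow> (\<integral>\<xi>. f \<xi> \<partial>\<mu>) = (\<integral>\<xi>. (f' \<xi> :: real) \<partial>\<mu>)"
  by (rule Bochner_Integration.integral_cong) auto

lemma integrable_cong_ends: "(\<And>\<xi>. \<xi> \<in> Ends \<Longrightarrow> f \<xi> = f' \<xi>) \<Longrightarrow> integrable \<mu> f \<longleftrightarrow> integrable \<mu> (f' :: _ \<Rightarrow> real)"
  by (rule Bochner_Integration.integrable_cong) auto

text \<open>The vertex at level n is the predecessor of the one at level n + 1, so a function of an
  edge of the ray is a function of a single vertex.\<close>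

lemma integrable_lev2 [simp]: "integrable \<mu> (\<lambda>\<xi>. F (\<xi> n) (\<xi> (Suc n)) :: real)"
proof -
  have "integrable \<mu> (\<lambda>\<xi>. (\<lambda>x. F (up x) x) (\<xi> (Suc n)))" by (rule integrable_lev)
  then show ?thesis by (rule integrable_cong_ends[THEN iffD1, rotated]) (simp add: ends_up)
qed

lemma integral_lev2: "(\<integral>\<xi>. F (\<xi> n) (\<xi> (Suc n)) \<partial>\<mu>) = (\<Sum>u\<in>level n. \<Sum>x\<in>ch u. mu x * (F u x :: real))"
proof -
  have "(\<integral>\<xi>. F (\<xi> n) (\<xi> (Suc n)) \<partial>\<mu>) = (\<integral>\<xi>. (\<lambda>x. F (up x) x) (\<xi> (Suc n)) \<partial>\<mu>)"
    by (rule integral_cong_ends) (simp add: ends_up)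
  also have "\<dots> = (\<Sum>x\<in>level (Suc n). mu x * F (up x) x)" by (rule integral_lev)
  also have "\<dots> = (\<Sum>u\<in>level n. \<Sum>x\<in>ch u. mu x * F u x)"
    unfolding sum_level_Suc by (intro sum.cong) (auto simp: ch_iff)
  finally show ?thesis .
qed

lemma avg_martingale:
  assumes "integrable \<mu> f"
  shows "(\<integral>\<xi>. w (\<xi> n) * avg f (\<xi> (Suc n)) \<partial>\<mu>) = (\<integral>\<xi>. w (\<xi> n) * avg f (\<xi> n) \<partial>\<mu>)"
proof -
  have "(\<integral>\<xi>. w (\<xi> n) * avg f (\<xi> (Suc n)) \<partial>\<mu>) = (\<Sum>u\<in>level n. \<Sum>x\<in>ch u. mu x * (w u * avg f x))"
    using integral_lev2[of "\<lambda>u x. w u * avg f x"] by simp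
  also have "\<dots> = (\<Sum>u\<in>level n. w u * (\<Sum>x\<in>ch u. mu x * avg f x))"
    by (simp add: sum_distrib_left algebra_simps)
  also have "\<dots> = (\<Sum>u\<in>level n. w u * (mu u * avg f u))"
    by (intro sum.cong refl) (simp add: avg_ch[OF assms] levelD)
  also have "\<dots> = (\<integral>\<xi>. w (\<xi> n) * avg f (\<xi> n) \<partial>\<mu>)"
    using integral_lev[of "\<lambda>u. w u * avg f u"] by (simp add: algebra_simps)
  finally show ?thesis .
qed

text \<open>The weight \<open>W\<close> and the centre \<open>b\<close> depend only on the vertex at
  level n, so \<open>avg_martingale\<close> makes the cross term vanish.\<close>

lemma avg_pythagoras:
  assumes f: "integrable \<mu> f"
  shows "(\<integral>\<xi>. W (\<xi> n) * (avg f (\<xi> (Suc n)) - b (\<xi> n))^2 \<partial>\<mu>) =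
    (\<integral>\<xi>. W (\<xi> n) * (avg f (\<xi> n) - b (\<xi> n))^2 \<partial>\<mu>) + (\<integral>\<xi>. W (\<xi> n) * (avg f (\<xi> (Suc n)) - avg f (\<xi> n))^2 \<partial>\<mu>)"
proof -
  let ?A = "avg f"
  let ?w = "\<lambda>x. 2 * W x * (?A x - b x)"
  have i1: "integrable \<mu> (\<lambda>\<xi>. W (\<xi> n) * (?A (\<xi> n) - b (\<xi> n))^2)"
    using integrable_lev[of "\<lambda>x. W x * (?A x - b x)^2"] by simp
  have i2: "integrable \<mu> (\<lambda>\<xi>. W (\<xi> n) * (?A (\<xi> (Suc n)) - ?A (\<xi> n))^2)"
    using integrable_lev2[of "\<lambda>x y. W x * (?A y - ?A x)^2"] by simp
  have i3: "integrable \<mu> (\<lambda>\<xi>. ?w (\<xi> n) * ?A (\<xi> (Suc n)))"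
    using integrable_lev2[of "\<lambda>x y. ?w x * ?A y"] by simp
  have i4: "integrable \<mu> (\<lambda>\<xi>. ?w (\<xi> n) * ?A (\<xi> n))"
    using integrable_lev[of "\<lambda>x. ?w x * ?A x"] by simp
  have "(\<integral>\<xi>. W (\<xi> n) * (?A (\<xi> (Suc n)) - b (\<xi> n))^2 \<partial>\<mu>) =
    (\<integral>\<xi>. (W (\<xi> n) * (?A (\<xi> n) - b (\<xi> n))^2 + W (\<xi> n) * (?A (\<xi> (Suc n)) - ?A (\<xi> n))^2)
       + (?w (\<xi> n) * ?A (\<xi> (Suc n)) - ?w (\<xi> n) * ?A (\<xi> n)) \<partial>\<mu>)"
    by (rule integral_cong_ends) (simp add: power2_eq_square algebra_simps)
  also have "\<dots> = (\<integral>\<xi>. W (\<xi> n) * (?A (\<xi> n) - b (\<xi> n))^2 \<partial>\<mu>) + (\<integral>\<xi>. W (\<xi> n) * (?A (\<xi> (Suc n)) - ?A (\<xi> n))^2 \<partial>\<mu>)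
      + ((\<integral>\<xi>. ?w (\<xi> n) * ?A (\<xi> (Suc n)) \<partial>\<mu>) - (\<integral>\<xi>. ?w (\<xi> n) * ?A (\<xi> n) \<partial>\<mu>))"
    using i1 i2 i3 i4 by (subst Bochner_Integration.integral_add Bochner_Integration.integral_diff; simp)+
  also have "(\<integral>\<xi>. ?w (\<xi> n) * ?A (\<xi> (Suc n)) \<partial>\<mu>) = (\<integral>\<xi>. ?w (\<xi> n) * ?A (\<xi> n) \<partial>\<mu>)"
    by (rule avg_martingale[OF f])
  finally show ?thesis by simp
qed

text \<open>\<open>avg_energy\<close>, \<open>ext_energy\<close> and \<open>defect\<close> are r_n,
  e_n and q_n of the overview. In e_n, cylinder mass divided by the decrease of \<open>g\<close> is
  the conductance of an edge once \<open>g\<close> is the Green function, so that e_n becomes an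
  energy between two levels.\<close>

definition avg_energy :: "((nat \<Rightarrow> 'v) \<Rightarrow> real) \<Rightarrow> ('v \<Rightarrow> real) \<Rightarrow> nat \<Rightarrow> real" where
  "avg_energy f g n = (\<integral>\<xi>. (avg f (\<xi> (Suc n)) - avg f (\<xi> n))^2 / g (\<xi> n) \<partial>\<mu>)"

definition ext_energy :: "('v \<Rightarrow> real) \<Rightarrow> ('v \<Rightarrow> real) \<Rightarrow> nat \<Rightarrow> real" where
  "ext_energy h g n = (\<integral>\<xi>. (h (\<xi> (Suc n)) - h (\<xi> n))^2 / (g (\<xi> n) - g (\<xi> (Suc n))) \<partial>\<mu>)"

definition defect :: "((nat \<Rightarrow> 'v) \<Rightarrow> real) \<Rightarrow> ('v \<Rightarrow> real) \<Rightarrow> ('v \<Rightarrow> real) \<Rightarrow> nat \<Rightarrow> real" where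
  "defect f h g n = (\<integral>\<xi>. (avg f (\<xi> n) - h (\<xi> n))^2 / g (\<xi> n) \<partial>\<mu>)"

end

locale weighted_ends = end_measure V rt up \<mu>
  for V :: "'v set" and rt up \<mu> +
  fixes g :: "'v \<Rightarrow> real"
  assumes g: "ultrametric_element V rt up g"
begin

lemma g_pos: "x \<in> V \<Longrightarrow> 0 < g x" using g by (auto simp: ultrametric_element_def)
lemma g_up: "x \<in> V \<Longrightarrow> x \<noteq> rt \<Longrightarrow> g x < g (up x)" using g by (auto simp: ultrametric_element_def)
lemma g_Suc: "\<xi> \<in> Ends \<Longrightarrow> g (\<xi> (Suc n)) < g (\<xi> n)"
  using g_up[of "\<xi> (Suc n)"] by (simp add: ends_up ends_V ends_neq_rt)
lemma g_strict: "\<xi> \<in> Ends \<Longrightarrow> i < j \<Longrightarrow> g (\<xi> j) < g (\<xi> i)"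
  by (induction j) (use g_Suc in \<open>force simp: less_Suc_eq intro: less_trans\<close>)+
lemma g_mono: "\<xi> \<in> Ends \<Longrightarrow> i \<le> j \<Longrightarrow> g (\<xi> j) \<le> g (\<xi> i)"
  using g_strict[of \<xi> i j] by (cases "i = j") auto

lemma g_lim: "\<xi> \<in> Ends \<Longrightarrow> (\<lambda>n. g (\<xi> n)) \<longlonglongrightarrow> 0" using g by (auto simp: ultrametric_element_def)

lemma avg_energy_nonneg: "0 \<le> avg_energy f g n"
  unfolding avg_energy_def by (intro integral_nonneg_AE AE_I2) (simp add: g_pos ends_V less_imp_le)

end

text \<open>An abstract harmonic extension: the integrated form of the recursion for nu_x, with F(x,
  x^-) written as \<open>g x / g (up x)\<close>.\<close>

locale harmonic_average = weighted_ends V rt up \<mu> g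
  for V :: "'v set" and rt up \<mu> g +
  fixes f :: "(nat \<Rightarrow> 'v) \<Rightarrow> real" and h :: "'v \<Rightarrow> real"
  assumes f: "integrable \<mu> f"
    and h_rt: "h rt = avg f rt"
    and h_up: "\<And>x. x \<in> V \<Longrightarrow> x \<noteq> rt \<Longrightarrow> h x = g x / g (up x) * h (up x) + (1 - g x / g (up x)) * avg f x"
begin

lemma h_Suc: "\<xi> \<in> Ends \<Longrightarrow> h (\<xi> (Suc n)) = g (\<xi> (Suc n)) / g (\<xi> n) * h (\<xi> n) + (1 - g (\<xi> (Suc n)) / g (\<xi> n)) * avg f (\<xi> (Suc n))"
  using h_up[of "\<xi> (Suc n)"] by (simp add: ends_up ends_V ends_neq_rt)

text \<open>The new value of \<open>h\<close> divides the segment from the old value to the average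
  in the ratio (G - c) : c. With z = (A - k) / G both differences are multiples of z, and the two
  quotients add up to G z^2.\<close>

lemma energy_split:
  assumes "\<xi> \<in> Ends"
  shows "(h (\<xi> (Suc n)) - h (\<xi> n))^2 / (g (\<xi> n) - g (\<xi> (Suc n)))
       + (avg f (\<xi> (Suc n)) - h (\<xi> (Suc n)))^2 / g (\<xi> (Suc n)) = (avg f (\<xi> (Suc n)) - h (\<xi> n))^2 / g (\<xi> n)"
proof -
  define c where "c = g (\<xi> (Suc n))"
  define G where "G = g (\<xi> n)"
  define A where "A = avg f (\<xi> (Suc n))"
  define k where "k = h (\<xi> n)"
  have pos: "0 < c" "c < G" using g_pos g_Suc assms ends_V by (auto simp: c_def G_def)
  have hS: "h (\<xi> (Suc n)) = c / G * k + (1 - c / G) * A" using h_Suc[OF assms] by (simp add: c_def G_def A_def k_def)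
  define z where "z = (A - k) / G"
  have "h (\<xi> (Suc n)) - k = (G - c) * z" "A - h (\<xi> (Suc n)) = c * z"
    unfolding hS z_def using pos by (simp_all add: field_simps)
  then have "(h (\<xi> (Suc n)) - k)^2 / (G - c) + (A - h (\<xi> (Suc n)))^2 / c = (G - c) * z^2 + c * z^2"
    using pos by (simp add: power2_eq_square)
  also have "\<dots> = G * ((A - k) / G)^2" by (simp add: algebra_simps z_def)
  also have "\<dots> = (A - k)^2 / G" using pos by (simp add: power2_eq_square)
  finally show ?thesis by (simp add: c_def G_def A_def k_def)
qed

text \<open>Integrating the pointwise split gives the weighted squared distance between the new
  average and the old \<open>h\<close>; Pythagoras separates it into the old defect and the
  increment of the averages.\<close>

lemma ext_energy_defect: "ext_energy h g n + defect f h g (Suc n) = defect f h g n + avg_energy f g n"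
proof -
  have "ext_energy h g n + defect f h g (Suc n) =
    (\<integral>\<xi>. (h (\<xi> (Suc n)) - h (\<xi> n))^2 / (g (\<xi> n) - g (\<xi> (Suc n))) + (avg f (\<xi> (Suc n)) - h (\<xi> (Suc n)))^2 / g (\<xi> (Suc n)) \<partial>\<mu>)"
    unfolding ext_energy_def defect_def
    using integrable_lev2[of "\<lambda>x y. (h y - h x)^2 / (g x - g y)" n] integrable_lev[of "\<lambda>x. (avg f x - h x)^2 / g x" "Suc n"]
    by (subst Bochner_Integration.integral_add) auto
  also have "\<dots> = (\<integral>\<xi>. (1 / g (\<xi> n)) * (avg f (\<xi> (Suc n)) - h (\<xi> n))^2 \<partial>\<mu>)"
    by (rule integral_cong_ends) (simp add: energy_split)
  also have "\<dots> = defect f h g n + avg_energy f g n"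
    using avg_pythagoras[OF f, of "\<lambda>x. 1 / g x" n h] by (simp add: defect_def avg_energy_def)
  finally show ?thesis .
qed

lemma defect_0: "defect f h g 0 = 0"
proof -
  have "defect f h g 0 = (\<integral>\<xi>. 0 \<partial>\<mu>)" unfolding defect_def
    by (rule integral_cong_ends) (simp add: ends_0 h_rt)
  then show ?thesis by simp
qed

lemma sum_ext_energy: "(\<Sum>i<n. ext_energy h g i) = (\<Sum>i<n. avg_energy f g i) - defect f h g n"
proof (induction n)
  case (Suc n)
  then show ?case using ext_energy_defect[of n] by simp
qed (simp add: defect_0)

lemma defect_nonneg: "0 \<le> defect f h g n"
  unfolding defect_def by (intro integral_nonneg_AE AE_I2) (simp add: g_pos ends_V less_imp_le)

lemma ext_energy_nonneg: "0 \<le> ext_energy h g n"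
  unfolding ext_energy_def by (intro integral_nonneg_AE AE_I2) (simp add: g_Suc less_imp_le)

text \<open>After division by \<open>g\<close> the recursion says that h/g grows by the average
  times the increment of 1/g. Thus \<open>h\<close> is a weighted mean of the averages along the
  ray, with infinite total weight because \<open>g\<close> tends to 0.\<close>

lemma h_conv: "AE \<xi> in \<mu>. (\<lambda>n. h (\<xi> n)) \<longlonglongrightarrow> f \<xi>"
  using cnv_integrable[OF f, unfolded cnv_def] AE_space
proof eventually_elim
  case (elim \<xi>)
  then have xi: "\<xi> \<in> Ends" by simp
  note gp = g_pos[OF ends_V[OF xi]]
  have lim: "(\<lambda>n. (h (\<xi> n) / g (\<xi> n)) / (1 / g (\<xi> n))) \<longlonglongrightarrow> f \<xi>"
  proof (rule weighted_average_limit[OF _ _ _ elim(1)])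
    show "0 < 1 / g (\<xi> n)" for n using gp by simp
    show "1 / g (\<xi> n) \<le> 1 / g (\<xi> (Suc n))" for n using gp g_Suc[OF xi, of n] by (intro divide_left_mono) (auto simp: less_imp_le)
    have "filterlim (\<lambda>n. inverse (g (\<xi> n))) at_top sequentially"
      using g_lim[OF xi] gp by (intro filterlim_inverse_at_top) (auto simp: )
    then show "filterlim (\<lambda>n. 1 / g (\<xi> n)) at_top sequentially" by (simp add: inverse_eq_divide)
    show "h (\<xi> (Suc n)) / g (\<xi> (Suc n)) = h (\<xi> n) / g (\<xi> n) + (1 / g (\<xi> (Suc n)) - 1 / g (\<xi> n)) * avg f (\<xi> (Suc n))" for n
      unfolding h_Suc[OF xi, of n] using gp[of n] gp[of "Suc n"] by (simp add: field_simps)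
  qed
  moreover have "(h (\<xi> n) / g (\<xi> n)) / (1 / g (\<xi> n)) = h (\<xi> n)" for n using gp[of n] by simp
  ultimately show ?case by simp
qed

abbreviation (input) "et \<xi> i \<equiv> (h (\<xi> (Suc i)) - h (\<xi> i))^2 / (g (\<xi> i) - g (\<xi> (Suc i)))"

lemma et_nonneg: "\<xi> \<in> Ends \<Longrightarrow> 0 \<le> et \<xi> i" using g_Suc by (simp add: less_imp_le)

lemma h_increment:
  assumes xi: "\<xi> \<in> Ends"
  shows "(h (\<xi> (n + k)) - h (\<xi> n))^2 \<le> (g (\<xi> n) - g (\<xi> (n + k))) * (\<Sum>i<k. et \<xi> (n + i))"
proof (induction k)
  case (Suc k)
  have "g (\<xi> (n + k)) \<le> g (\<xi> n)"
    by (induction k) (use g_Suc[OF xi] in \<open>auto intro: order_trans less_imp_le\<close>)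
  then have "((h (\<xi> (n + k)) - h (\<xi> n)) + (h (\<xi> (Suc (n + k))) - h (\<xi> (n + k))))^2 \<le>
     ((g (\<xi> n) - g (\<xi> (n + k))) + (g (\<xi> (n + k)) - g (\<xi> (Suc (n + k))))) * ((\<Sum>i<k. et \<xi> (n + i)) + et \<xi> (n + k))"
    using g_Suc[OF xi, of "n + k"] et_nonneg[OF xi]
    by (intro cauchy_schwarz_step Suc.IH sum_nonneg) auto
  then show ?case by simp
qed simp

text \<open>On each cylinder Jensen replaces the average by \<open>f\<close>, which is almost surely
  the limit of \<open>h\<close> along the ray. Cauchy-Schwarz bounds the squared distance from
  \<open>h x\<close> to that limit by \<open>g x\<close> times the energy along the rest of the ray,
  and \<open>g x\<close> cancels the weight \<open>1 / g x\<close>.\<close>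

lemma defect_le_tail:
  assumes sm: "summable (ext_energy h g)"
  shows "defect f h g n \<le> (\<Sum>i. ext_energy h g (i + n))"
proof -
  have fm [measurable]: "f \<in> borel_measurable \<mu>" using f by auto
  have meas: "(\<lambda>\<xi>. ennreal (et \<xi> i)) \<in> borel_measurable \<mu>" for i
    using integrable_lev2[of "\<lambda>x y. (h y - h x)^2 / (g x - g y)" i]
    by (intro measurable_compose[OF borel_measurable_integrable measurable_ennreal]) auto
  have nn_e: "(\<integral>\<^sup>+\<xi>. ennreal (et \<xi> i) \<partial>\<mu>) = ennreal (ext_energy h g i)" for i
    unfolding ext_energy_def using integrable_lev2[of "\<lambda>x y. (h y - h x)^2 / (g x - g y)" i] et_nonneg
    by (intro nn_integral_eq_integral) auto
  have "ennreal (defect f h g n) = (\<integral>\<^sup>+\<xi>. ennreal ((avg f (\<xi> n) - h (\<xi> n))^2 / g (\<xi> n)) \<partial>\<mu>)"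
    unfolding defect_def
    using integrable_lev[of "\<lambda>x. (avg f x - h x)^2 / g x" n]
    by (intro nn_integral_eq_integral[symmetric]) (auto intro!: AE_I2 simp: g_pos ends_V less_imp_le)
  also have "\<dots> = (\<Sum>x\<in>level n. ennreal (mu x) * ennreal ((avg f x - h x)^2 / g x))"
    by (rule nn_integral_lev)
  also have "\<dots> \<le> (\<Sum>x\<in>level n. ennreal (1 / g x) * (\<integral>\<^sup>+\<xi>. ennreal ((f \<xi> - h x)^2) * indicator (Cyl x) \<xi> \<partial>\<mu>))"
  proof (rule sum_mono)
    fix x assume x: "x \<in> level n"
    then have gx: "0 < g x" using g_pos levelD by blast
    have "ennreal (mu x) * ennreal ((avg f x - h x)^2 / g x) = ennreal (1 / g x) * ennreal (mu x * (avg f x - h x)^2)"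
      using gx by (simp add: ennreal_mult[symmetric])
    also have "\<dots> \<le> ennreal (1 / g x) * (\<integral>\<^sup>+\<xi>. ennreal ((f \<xi> - h x)^2) * indicator (Cyl x) \<xi> \<partial>\<mu>)"
      using x levelD by (intro mult_left_mono jensen_Cyl f) auto
    finally show "ennreal (mu x) * ennreal ((avg f x - h x)^2 / g x) \<le> ennreal (1 / g x) * (\<integral>\<^sup>+\<xi>. ennreal ((f \<xi> - h x)^2) * indicator (Cyl x) \<xi> \<partial>\<mu>)" .
  qed
  also have "\<dots> = (\<integral>\<^sup>+\<xi>. (\<Sum>x\<in>level n. ennreal (1 / g x) * (ennreal ((f \<xi> - h x)^2) * indicator (Cyl x) \<xi>)) \<partial>\<mu>)"
    by (subst nn_integral_sum) (auto intro!: sum.cong nn_integral_cmult[symmetric])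
  also have "\<dots> \<le> (\<integral>\<^sup>+\<xi>. (\<Sum>i. ennreal (et \<xi> (i + n))) \<partial>\<mu>)"
  proof (rule nn_integral_mono_AE)
    show "AE \<xi> in \<mu>. (\<Sum>x\<in>level n. ennreal (1 / g x) * (ennreal ((f \<xi> - h x)^2) * indicator (Cyl x) \<xi>)) \<le> (\<Sum>i. ennreal (et \<xi> (i + n)))"
      using h_conv AE_space
    proof eventually_elim
      case (elim \<xi>)
      then have xi: "\<xi> \<in> Ends" by simp
      let ?x = "\<xi> n"
      have gx: "0 < g ?x" using g_pos ends_V xi by blast
      have "(\<Sum>x\<in>level n. ennreal (1 / g x) * (ennreal ((f \<xi> - h x)^2) * indicator (Cyl x) \<xi>))
        = (\<Sum>x\<in>level n. if x = ?x then ennreal (1 / g x) * ennreal ((f \<xi> - h x)^2) else 0)"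
        using xi by (intro sum.cong) (auto simp: Cyl_level indicator_def)
      also have "\<dots> = ennreal (1 / g ?x * (f \<xi> - h ?x)^2)"
        using finite_level[of n] ends_level[OF xi, of n] gx by (subst ennreal_mult) (simp_all add: sum.delta')
      also have "\<dots> \<le> (\<Sum>i. ennreal (et \<xi> (i + n)))"
      proof (rule tendsto_upperbound)
        have "(\<lambda>k. h (\<xi> (n + k))) \<longlonglongrightarrow> f \<xi>" using LIMSEQ_ignore_initial_segment[OF elim(1), of n] by (simp add: add.commute)
        then show "(\<lambda>k. ennreal (1 / g ?x * (h (\<xi> (n + k)) - h ?x)^2)) \<longlonglongrightarrow> ennreal (1 / g ?x * (f \<xi> - h ?x)^2)"
          by (intro tendsto_intros)
        have "ennreal (1 / g ?x * (h (\<xi> (n + k)) - h ?x)^2) \<le> (\<Sum>i. ennreal (et \<xi> (i + n)))" for k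
        proof -
          have S0: "0 \<le> (\<Sum>i<k. et \<xi> (n + i))" using et_nonneg[OF xi] by (intro sum_nonneg) auto
          have "(h (\<xi> (n + k)) - h ?x)^2 \<le> (g ?x - g (\<xi> (n + k))) * (\<Sum>i<k. et \<xi> (n + i))"
            by (rule h_increment[OF xi])
          \<comment> \<open>The total decrease of \<open>g\<close> is at most its initial value, so
            the bound does not depend on the length \<open>k\<close>.\<close>
          also have "\<dots> \<le> g ?x * (\<Sum>i<k. et \<xi> (n + i))"
            using S0 g_pos[OF ends_V[OF xi]] by (intro mult_right_mono) (auto simp: less_imp_le)
          finally have "1 / g ?x * (h (\<xi> (n + k)) - h ?x)^2 \<le> (\<Sum>i<k. et \<xi> (n + i))"
            using gx by (simp add: field_simps)
          then have "ennreal (1 / g ?x * (h (\<xi> (n + k)) - h ?x)^2) \<le> ennreal (\<Sum>i<k. et \<xi> (n + i))" by (rule ennreal_leI)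
          also have "\<dots> = (\<Sum>i<k. ennreal (et \<xi> (i + n)))"
            using et_nonneg[OF xi] by (subst sum_ennreal[symmetric]) (auto simp: add.commute)
          also have "\<dots> \<le> (\<Sum>i. ennreal (et \<xi> (i + n)))" by (rule sum_le_suminf) auto
          finally show ?thesis .
        qed
        then show "\<forall>\<^sub>F k in sequentially. ennreal (1 / g ?x * (h (\<xi> (n + k)) - h ?x)^2) \<le> (\<Sum>i. ennreal (et \<xi> (i + n)))" by simp
      qed simp
      finally show ?case .
    qed
  qed
  also have "\<dots> = (\<Sum>i. ennreal (ext_energy h g (i + n)))"
    using meas by (subst nn_integral_suminf) (auto simp: nn_e)
  also have "\<dots> = ennreal (\<Sum>i. ext_energy h g (i + n))"
    using sm ext_energy_nonneg by (intro suminf_ennreal2) (auto simp: summable_iff_shift)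
  finally show ?thesis
    using sm ext_energy_nonneg by (subst (asm) ennreal_le_iff) (auto intro!: suminf_nonneg simp: summable_iff_shift)
qed

lemma ext_energy_summable_imp: "summable (ext_energy h g) \<Longrightarrow> avg_energy f g sums (\<Sum>i. ext_energy h g i)"
proof -
  assume sm: "summable (ext_energy h g)"
  have "(\<lambda>n. \<Sum>i. ext_energy h g (i + n)) \<longlonglongrightarrow> 0"
    using sm by (rule suminf_exist_split2)
  then have "(\<lambda>n. defect f h g n) \<longlonglongrightarrow> 0"
    by (rule tendsto_sandwich[OF _ _ tendsto_const, rotated 2])
       (auto simp: defect_nonneg defect_le_tail[OF sm])
  moreover have "(\<lambda>n. \<Sum>i<n. ext_energy h g i) \<longlonglongrightarrow> (\<Sum>i. ext_energy h g i)"
    using sm by (rule summable_LIMSEQ)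
  ultimately have "(\<lambda>n. (\<Sum>i<n. ext_energy h g i) + defect f h g n) \<longlonglongrightarrow> (\<Sum>i. ext_energy h g i) + 0"
    by (intro tendsto_add)
  then show ?thesis by (simp add: sums_def sum_ext_energy)
qed

text \<open>If the energy is finite, the defect vanishes in the limit together with the tail;
  conversely \<open>defect_nonneg\<close> bounds the partial energies by \<open>s\<close>. The
  equivalence describes the domain in terms of averages alone.\<close>

lemma energy_sums_iff: "ext_energy h g sums s \<longleftrightarrow> avg_energy f g sums s"
proof
  assume "ext_energy h g sums s"
  then show "avg_energy f g sums s" using ext_energy_summable_imp by (simp add: sums_iff)
next
  assume r: "avg_energy f g sums s"
  have "summable (ext_energy h g)"
  proof (rule summableI_nonneg_bounded)
    fix n
    have "(\<Sum>i<n. avg_energy f g i) \<le> s"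
      using r avg_energy_nonneg sum_le_suminf[of "avg_energy f g" "{..<n}"] by (auto simp: sums_iff)
    then show "(\<Sum>i<n. ext_energy h g i) \<le> s" using sum_ext_energy[of n] defect_nonneg[of n] by simp
  qed (rule ext_energy_nonneg)
  then show "ext_energy h g sums s" using ext_energy_summable_imp r by (metis sums_iff summable_sums sums_unique2)
qed

end

section \<open>The jump form in terms of the averages\<close>

context weighted_ends
begin

text \<open>Increments of 1/g along a ray, as if 1/g were 0 before the root; the first one becomes
  the constant term of the jump kernel.\<close>

definition step :: "'v \<Rightarrow> real" where
  "step x = (if x = rt then 1 / g rt else 1 / g x - 1 / g (up x))"

lemma step_pos: "x \<in> V \<Longrightarrow> 0 < step x"
  using g_pos[of x] g_pos[OF up_V, of x] g_up[of x] by (auto simp: step_def frac_less2)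

lemma sum_step: "\<xi> \<in> Ends \<Longrightarrow> (\<Sum>i\<le>n. step (\<xi> i)) = 1 / g (\<xi> n)"
  by (induction n) (auto simp: step_def ends_0 ends_neq_rt ends_up)

lemma branching:
  assumes xi: "\<xi> \<in> Ends" "\<eta> \<in> Ends" and ne: "\<xi> \<noteq> \<eta>"
  obtains k where "confluent \<xi> \<eta> = \<xi> k" "confluent \<xi> \<eta> = \<eta> k" "\<And>i. \<xi> i = \<eta> i \<longleftrightarrow> i \<le> k"
proof -
  let ?P = "\<lambda>n. \<xi> (Suc n) \<noteq> \<eta> (Suc n)"
  obtain m where m: "\<xi> m \<noteq> \<eta> m" using ne by auto
  then have "m \<noteq> 0" using xi ends_0 by metis
  then have ex: "?P (m - 1)" using m by simp
  define k where "k = (LEAST n. ?P n)"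
  have k: "?P k" unfolding k_def using ex by (rule LeastI)
  have lt: "\<xi> (Suc n) = \<eta> (Suc n)" if "n < k" for n using not_less_Least[of n ?P] that unfolding k_def by blast
  have "\<xi> i = \<eta> i \<longleftrightarrow> i \<le> k" for i
  proof
    assume "i \<le> k" then show "\<xi> i = \<eta> i" using lt[of "i - 1"] xi by (cases i) (auto simp: ends_0)
  next
    assume "\<xi> i = \<eta> i"
    show "i \<le> k"
    proof (rule ccontr)
      assume "\<not> i \<le> k"
      then have "\<xi> (Suc k) = \<eta> (Suc k)" using ends_agree[OF xi \<open>\<xi> i = \<eta> i\<close>, of "Suc k"] by simp
      with k show False by simp
    qed
  qed
  moreover have "confluent \<xi> \<eta> = \<xi> k" unfolding confluent_def k_def by simp
  ultimately show ?thesis using that[of k] by auto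
qed

text \<open>A radius matters only through the first vertex of the ray at which \<open>g\<close> does
  not exceed it. For n = 0 there is no earlier vertex, and every radius from \<open>g rt\<close> on
  gives the whole boundary.\<close>

lemma um_ball_eq:
  assumes xi: "\<xi> \<in> Ends" and r: "g (\<xi> n) \<le> r" "n = 0 \<or> r < g (\<xi> (n - 1))"
  shows "um_ball V rt up g \<xi> r = Cyl (\<xi> n)"
proof (intro set_eqI iffI)
  fix \<eta> assume "\<eta> \<in> um_ball V rt up g \<xi> r"
  then have et: "\<eta> \<in> Ends" and c: "\<eta> = \<xi> \<or> g (confluent \<xi> \<eta>) \<le> r" by (auto simp: um_ball_def)
  show "\<eta> \<in> Cyl (\<xi> n)"
  proof (cases "\<eta> = \<xi>")
    case False
    then obtain k where k: "confluent \<xi> \<eta> = \<xi> k" "\<And>i. \<xi> i = \<eta> i \<longleftrightarrow> i \<le> k" using branching[OF xi et] by metis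
    have "n \<le> k"
    proof (rule ccontr)
      assume "\<not> n \<le> k"
      then have "g (\<xi> (n - 1)) \<le> g (\<xi> k)" "n \<noteq> 0" using xi by (auto intro!: g_mono)
      then show False using c False r k by auto
    qed
    then have "\<xi> n = \<eta> n" using k(2)[of n] by simp
    then show ?thesis using et xi by (simp add: Cyl_iff ends_dep)
  qed (use xi Cyl_ends in auto)
next
  fix \<eta> assume "\<eta> \<in> Cyl (\<xi> n)"
  then have et: "\<eta> \<in> Ends" "\<xi> n = \<eta> n" using xi by (auto simp: Cyl_iff ends_dep)
  show "\<eta> \<in> um_ball V rt up g \<xi> r"
  proof (cases "\<eta> = \<xi>")
    case False
    then obtain k where k: "confluent \<xi> \<eta> = \<xi> k" "\<And>i. \<xi> i = \<eta> i \<longleftrightarrow> i \<le> k" using branching[OF xi et(1)] by metis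
    then have "n \<le> k" using et by blast
    then have "g (\<xi> k) \<le> g (\<xi> n)" using xi by (intro g_mono)
    then have "g (confluent \<xi> \<eta>) \<le> r" using k(1) r(1) by simp
    then show ?thesis using et by (simp add: um_ball_def)
  qed (use xi in \<open>auto simp: um_ball_def\<close>)
qed

text \<open>For t in (1/g(xi_i), 1/g(xi_(i+1))] the ball of radius 1/t is the cylinder of xi_(i+1).
  The left endpoint of the interval, where the ball is the whole boundary, is kept as a term of its
  own that integrates to 0.\<close>

lemma ball_step_function:
  assumes xi: "\<xi> \<in> Ends"
  shows "indicator {1 / g rt..1 / g (\<xi> k)} t *\<^sub>R (1 / measure \<mu> (um_ball V rt up g \<xi> (1 / t))) =
    indicator {1 / g rt} t + (\<Sum>i<k. 1 / mu (\<xi> (Suc i)) * indicator {1 / g (\<xi> i)<..1 / g (\<xi> (Suc i))} t)"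
proof (induction k)
  case 0
  have "um_ball V rt up g \<xi> (g rt) = Cyl (\<xi> 0)" using xi by (intro um_ball_eq) (auto simp: ends_0)
  then show ?case using xi by (auto simp: ends_0 indicator_def)
next
  case (Suc k)
  let ?f = "\<lambda>t. 1 / measure \<mu> (um_ball V rt up g \<xi> (1 / t))"
  let ?a = "1 / g (\<xi> k)" and ?b = "1 / g (\<xi> (Suc k))"
  have gp: "0 < g (\<xi> i)" for i using g_pos ends_V xi by blast
  have ab: "?a < ?b" using gp g_Suc[OF xi, of k] by (simp add: frac_less2)
  have ra: "1 / g rt \<le> ?a" using g_mono[OF xi, of 0 k] gp gp[of 0] xi by (simp add: ends_0 frac_le)
  have val: "?f t = 1 / mu (\<xi> (Suc k))" if "?a < t" "t \<le> ?b"
  proof -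
    have t: "0 < t" using that gp[of k] by (meson less_trans zero_less_divide_1_iff)
    have "g (\<xi> (Suc k)) \<le> 1 / t" "1 / t < g (\<xi> k)" using that t gp[of k] gp[of "Suc k"] by (auto simp: field_simps)
    then show ?thesis using um_ball_eq[OF xi, of "Suc k" "1 / t"] by simp
  qed
  have "indicator {1 / g rt..?b} t *\<^sub>R ?f t = indicator {1 / g rt..?a} t *\<^sub>R ?f t + 1 / mu (\<xi> (Suc k)) * indicator {?a<..?b} t"
    using ab ra val by (auto simp: indicator_def)
  then show ?case unfolding Suc.IH by simp
qed

text \<open>The integral of the step function supplies the terms i >= 1; the constant
  \<open>1 / g rt\<close> is the term i = 0, because the root has mass 1.\<close>

lemma jump_kernel_eq:
  assumes xi: "\<xi> \<in> Ends" "\<eta> \<in> Ends" "\<xi> \<noteq> \<eta>" and k: "\<And>i. \<xi> i = \<eta> i \<longleftrightarrow> i \<le> k"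
  shows "jump_kernel V rt up g \<mu> \<xi> \<eta> = (\<Sum>i\<le>k. step (\<xi> i) / mu (\<xi> i))"
proof -
  obtain k' where k': "confluent \<xi> \<eta> = \<xi> k'" "\<And>i. \<xi> i = \<eta> i \<longleftrightarrow> i \<le> k'" using branching[OF xi] by metis
  then have kk: "k' = k" using k by (metis order_antisym order_refl)
  have gp: "0 < g (\<xi> i)" for i using g_pos ends_V xi by blast
  have len: "measure lborel {1 / g (\<xi> i)<..1 / g (\<xi> (Suc i))} = step (\<xi> (Suc i))" for i
    using gp[of i] gp[of "Suc i"] g_Suc[OF xi(1), of i] xi by (simp add: step_def ends_neq_rt ends_up frac_le)
  have int: "integrable lborel (indicator {1 / g (\<xi> i)<..1 / g (\<xi> (Suc i))} :: real \<Rightarrow> real)" for i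
    using gp[of i] gp[of "Suc i"] g_Suc[OF xi(1), of i] by (simp add: integrable_indicator_iff frac_le)
  have "(LINT t:{1 / g rt..1 / g (\<xi> k)}|lborel. 1 / measure \<mu> (um_ball V rt up g \<xi> (1 / t)))
    = (\<integral>t. indicator {1 / g rt} t + (\<Sum>i<k. 1 / mu (\<xi> (Suc i)) * indicator {1 / g (\<xi> i)<..1 / g (\<xi> (Suc i))} t) \<partial>lborel)"
    unfolding set_lebesgue_integral_def by (simp only: ball_step_function[OF xi(1)])
  also have "\<dots> = measure lborel {1 / g rt} + (\<Sum>i<k. 1 / mu (\<xi> (Suc i)) * measure lborel {1 / g (\<xi> i)<..1 / g (\<xi> (Suc i))})"
    using int by (subst Bochner_Integration.integral_add) (simp_all add: integrable_indicator_iff)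
  also have "\<dots> = (\<Sum>i<k. step (\<xi> (Suc i)) / mu (\<xi> (Suc i)))"
    unfolding len by simp
  finally have "(LINT t:{1 / g rt..1 / g (\<xi> k)}|lborel. 1 / measure \<mu> (um_ball V rt up g \<xi> (1 / t)))
    = (\<Sum>i<k. step (\<xi> (Suc i)) / mu (\<xi> (Suc i)))" .
  moreover have "(\<Sum>i\<le>k. step (\<xi> i) / mu (\<xi> i)) = step (\<xi> 0) / mu (\<xi> 0) + (\<Sum>i<k. step (\<xi> (Suc i)) / mu (\<xi> (Suc i)))"
    by (simp add: sum.atMost_shift)
  ultimately show ?thesis using xi k' kk by (simp add: jump_kernel_def ends_0 step_def)
qed

abbreviation (input) "J \<equiv> jump_kernel V rt up g \<mu>"

lemma jump_kernel_nonneg: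
  assumes "\<xi> \<in> Ends" "\<eta> \<in> Ends" shows "0 \<le> J \<xi> \<eta>"
proof (cases "\<xi> = \<eta>")
  case False
  then obtain k where "\<And>i. \<xi> i = \<eta> i \<longleftrightarrow> i \<le> k" using branching[OF assms] by metis
  from jump_kernel_eq[OF assms False this] show ?thesis
    using step_pos ends_V[OF assms(1)] by (auto intro!: sum_nonneg simp: less_imp_le)
qed (simp add: jump_kernel_def)

text \<open>The level-i term of the jump kernel, extended to the diagonal. There the sum over i
  diverges, but it only ever meets a vanishing squared difference.\<close>

definition kern :: "nat \<Rightarrow> (nat \<Rightarrow> 'v) \<Rightarrow> (nat \<Rightarrow> 'v) \<Rightarrow> real" where
  "kern i \<xi> \<eta> = (if \<xi> i = \<eta> i then step (\<xi> i) / mu (\<xi> i) else 0)"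

lemma kern_nonneg: "\<xi> \<in> Ends \<Longrightarrow> 0 \<le> kern i \<xi> \<eta>"
  using step_pos[of "\<xi> i"] ends_V by (auto simp: kern_def less_imp_le)

lemma jump_sums:
  assumes "\<xi> \<in> Ends" "\<eta> \<in> Ends" "\<xi> \<noteq> \<eta>"
  shows "(\<lambda>i. kern i \<xi> \<eta>) sums J \<xi> \<eta>"
proof -
  obtain k where k: "\<And>i. \<xi> i = \<eta> i \<longleftrightarrow> i \<le> k" using branching[OF assms] by metis
  have "(\<lambda>i. kern i \<xi> \<eta>) sums (\<Sum>i\<in>{..k}. kern i \<xi> \<eta>)"
    by (rule sums_finite) (auto simp: kern_def k)
  also have "(\<Sum>i\<in>{..k}. kern i \<xi> \<eta>) = J \<xi> \<eta>"
    unfolding jump_kernel_eq[OF assms k] by (intro sum.cong) (auto simp: kern_def k)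
  finally show ?thesis .
qed

section \<open>The jump form as a sum over levels\<close>

lemma ennreal_jump:
  assumes "\<xi> \<in> Ends" "\<eta> \<in> Ends"
  shows "ennreal ((f \<xi> - f \<eta>)^2 * J \<xi> \<eta>) = (\<Sum>i. ennreal ((f \<xi> - f \<eta>)^2 * kern i \<xi> \<eta>))"
proof (cases "\<xi> = \<eta>")
  case False
  have "(\<lambda>i. (f \<xi> - f \<eta>)^2 * kern i \<xi> \<eta>) sums ((f \<xi> - f \<eta>)^2 * J \<xi> \<eta>)"
    using jump_sums[OF assms False] by (rule sums_mult)
  then show ?thesis using kern_nonneg[OF assms(1)] by (subst suminf_ennreal2) (auto simp: sums_iff)
qed simp

lemma measurable_lev_pair:
  fixes F :: "'v \<Rightarrow> 'v \<Rightarrow> 'b :: topological_space"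
  shows "(\<lambda>z. F (fst z i) (snd z i)) \<in> borel_measurable (\<mu> \<Otimes>\<^sub>M \<mu>)"
proof -
  have c: "(\<lambda>\<xi>. \<xi> i) \<in> \<mu> \<rightarrow>\<^sub>M count_space V"
    using measurable_coord[of i] measurable_cong_sets[OF sets_mu refl] by blast
  have "(\<lambda>z. (fst z i, snd z i)) \<in> (\<mu> \<Otimes>\<^sub>M \<mu>) \<rightarrow>\<^sub>M (count_space V \<Otimes>\<^sub>M count_space V)"
    using measurable_compose[OF measurable_fst c] measurable_compose[OF measurable_snd c] by (rule measurable_Pair)
  then have "(\<lambda>z. (fst z i, snd z i)) \<in> (\<mu> \<Otimes>\<^sub>M \<mu>) \<rightarrow>\<^sub>M count_space (V \<times> V)"
    using countable_V by (simp add: pair_measure_countable)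
  from measurable_compose[OF this, of "\<lambda>(x, y). F x y" borel] show ?thesis by simp
qed

lemma measurable_kern [measurable]: "(\<lambda>z. kern i (fst z) (snd z)) \<in> borel_measurable (\<mu> \<Otimes>\<^sub>M \<mu>)"
  unfolding kern_def by (rule measurable_lev_pair)

lemma space_pair: "space (\<mu> \<Otimes>\<^sub>M \<mu>) = Ends \<times> Ends" by (simp add: space_pair_measure)

lemma measurable_sq_kern:
  assumes [measurable]: "f \<in> borel_measurable \<mu>"
  shows "(\<lambda>z. ennreal ((f (fst z) - f (snd z))^2 * kern i (fst z) (snd z))) \<in> borel_measurable (\<mu> \<Otimes>\<^sub>M \<mu>)"
  by measurable

text \<open>The diagonal is a countable intersection of conditions on single levels.\<close>

lemma ends_eq_sets: "{z \<in> space (\<mu> \<Otimes>\<^sub>M \<mu>). fst z = snd z} \<in> sets (\<mu> \<Otimes>\<^sub>M \<mu>)"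
proof -
  have "{z \<in> space (\<mu> \<Otimes>\<^sub>M \<mu>). fst z = snd z} = {z \<in> space (\<mu> \<Otimes>\<^sub>M \<mu>). \<forall>i. (if fst z i = snd z i then 0 else 1) = (0::real)}"
    by (auto simp: fun_eq_iff)
  also have "\<dots> \<in> sets (\<mu> \<Otimes>\<^sub>M \<mu>)"
    using measurable_lev_pair[of "\<lambda>x y. if x = y then 0 else (1::real)"] by measurable
  finally show ?thesis .
qed

lemma measurable_jump: "(\<lambda>z. J (fst z) (snd z)) \<in> borel_measurable (\<mu> \<Otimes>\<^sub>M \<mu>)"
proof -
  have "(\<lambda>z. if fst z = snd z then 0 else (\<Sum>i. kern i (fst z) (snd z))) \<in> borel_measurable (\<mu> \<Otimes>\<^sub>M \<mu>)"
    using ends_eq_sets by (intro measurable_If) auto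
  then show ?thesis
    by (rule measurable_cong[THEN iffD1, rotated])
       (use jump_sums in \<open>auto simp: space_pair sums_iff jump_kernel_def\<close>)
qed

text \<open>The quadratic form without the factor 1/2, with values in [0, infinity], so that it
  makes sense before any finiteness is known.\<close>

definition jform :: "((nat \<Rightarrow> 'v) \<Rightarrow> real) \<Rightarrow> ennreal" where
  "jform f = (\<integral>\<^sup>+z. ennreal ((f (fst z) - f (snd z))^2 * J (fst z) (snd z)) \<partial>(\<mu> \<Otimes>\<^sub>M \<mu>))"

definition part :: "((nat \<Rightarrow> 'v) \<Rightarrow> real) \<Rightarrow> nat \<Rightarrow> ennreal" where
  "part f i = (\<integral>\<^sup>+z. ennreal ((f (fst z) - f (snd z))^2 * kern i (fst z) (snd z)) \<partial>(\<mu> \<Otimes>\<^sub>M \<mu>))"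

lemma jform_eq: 
  assumes "f \<in> borel_measurable \<mu>"
  shows "jform f = (\<Sum>i. part f i)"
proof -
  have "jform f = (\<integral>\<^sup>+z. (\<Sum>i. ennreal ((f (fst z) - f (snd z))^2 * kern i (fst z) (snd z))) \<partial>(\<mu> \<Otimes>\<^sub>M \<mu>))"
    unfolding jform_def by (intro nn_integral_cong) (auto simp: space_pair ennreal_jump)
  also have "\<dots> = (\<Sum>i. part f i)"
    unfolding part_def by (intro nn_integral_suminf measurable_sq_kern assms)
  finally show ?thesis .
qed

interpretation pp: pair_sigma_finite \<mu> \<mu> ..

interpretation pp: pair_prob_space \<mu> \<mu> ..

text \<open>The level-i kernel is constant on each square \<open>Cyl u\<close> times
  \<open>Cyl u\<close> with \<open>u\<close> at level i and vanishes off these squares; Tonelli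
  leaves one double integral per square.\<close>

lemma part_iterated:
  assumes f: "f \<in> borel_measurable \<mu>"
  shows "part f i = (\<Sum>u\<in>level i. ennreal (step u / mu u) *
     (\<integral>\<^sup>+\<xi>. (\<integral>\<^sup>+\<eta>. ennreal ((f \<xi> - f \<eta>)^2) * indicator (Cyl u) \<eta> \<partial>\<mu>) * indicator (Cyl u) \<xi> \<partial>\<mu>))"
proof -
  have fm [measurable]: "f \<in> borel_measurable \<mu>" by fact
  have pt: "ennreal ((f \<xi> - f \<eta>)^2 * kern i \<xi> \<eta>) =
    (\<Sum>u\<in>level i. ennreal (step u / mu u) * (ennreal ((f \<xi> - f \<eta>)^2) * indicator (Cyl u) \<eta>) * indicator (Cyl u) \<xi>)"
    if xi: "\<xi> \<in> Ends" "\<eta> \<in> Ends" for \<xi> \<eta>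
  proof -
    have "(\<Sum>u\<in>level i. ennreal (step u / mu u) * (ennreal ((f \<xi> - f \<eta>)^2) * indicator (Cyl u) \<eta>) * indicator (Cyl u) \<xi>)
      = (\<Sum>u\<in>level i. if u = \<xi> i then ennreal (step u / mu u) * (ennreal ((f \<xi> - f \<eta>)^2) * indicator (Cyl u) \<eta>) else 0)"
      using xi by (intro sum.cong) (auto simp: Cyl_level indicator_def)
    also have "\<dots> = ennreal (step (\<xi> i) / mu (\<xi> i)) * (ennreal ((f \<xi> - f \<eta>)^2) * indicator (Cyl (\<xi> i)) \<eta>)"
      using finite_level[of i] ends_level[OF xi(1), of i] by (simp add: sum.delta')
    also have "\<dots> = ennreal ((f \<xi> - f \<eta>)^2 * kern i \<xi> \<eta>)"
    proof (cases "\<xi> i = \<eta> i")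
      case True
      then have "\<eta> \<in> Cyl (\<xi> i)" using Cyl_ends[OF xi(2), of i] by simp
      then show ?thesis using True step_pos[OF ends_V[OF xi(1)], of i]
        by (simp add: kern_def ennreal_mult[symmetric] less_imp_le mult.commute)
    next
      case False
      then have "\<eta> \<notin> Cyl (\<xi> i)" using Cyl_level[OF ends_level[OF xi(1), of i]] by auto
      then show ?thesis using False by (simp add: kern_def)
    qed
    finally show ?thesis by simp
  qed
  have "part f i = (\<integral>\<^sup>+\<xi>. (\<integral>\<^sup>+\<eta>. ennreal ((f \<xi> - f \<eta>)^2 * kern i \<xi> \<eta>) \<partial>\<mu>) \<partial>\<mu>)"
    unfolding part_def using nn_integral_fst[OF measurable_sq_kern[OF f], of i] by simp
  also have "\<dots> = (\<integral>\<^sup>+\<xi>. (\<integral>\<^sup>+\<eta>. (\<Sum>u\<in>level i. ennreal (step u / mu u) * (ennreal ((f \<xi> - f \<eta>)^2) * indicator (Cyl u) \<eta>) * indicator (Cyl u) \<xi>) \<partial>\<mu>) \<partial>\<mu>)"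
    by (intro nn_integral_cong) (simp add: pt)
  also have "\<dots> = (\<integral>\<^sup>+\<xi>. (\<Sum>u\<in>level i. ennreal (step u / mu u) * ((\<integral>\<^sup>+\<eta>. ennreal ((f \<xi> - f \<eta>)^2) * indicator (Cyl u) \<eta> \<partial>\<mu>) * indicator (Cyl u) \<xi>)) \<partial>\<mu>)"
  proof (rule nn_integral_cong)
    fix \<xi>
    show "(\<integral>\<^sup>+\<eta>. (\<Sum>u\<in>level i. ennreal (step u / mu u) * (ennreal ((f \<xi> - f \<eta>)^2) * indicator (Cyl u) \<eta>) * indicator (Cyl u) \<xi>) \<partial>\<mu>)
       = (\<Sum>u\<in>level i. ennreal (step u / mu u) * ((\<integral>\<^sup>+\<eta>. ennreal ((f \<xi> - f \<eta>)^2) * indicator (Cyl u) \<eta> \<partial>\<mu>) * indicator (Cyl u) \<xi>))"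
      by (subst nn_integral_sum, measurable)
         (intro sum.cong refl, subst nn_integral_multc, measurable, subst nn_integral_cmult, measurable, simp add: mult.assoc)
  qed
  also have "\<dots> = (\<Sum>u\<in>level i. ennreal (step u / mu u) * (\<integral>\<^sup>+\<xi>. (\<integral>\<^sup>+\<eta>. ennreal ((f \<xi> - f \<eta>)^2) * indicator (Cyl u) \<eta> \<partial>\<mu>) * indicator (Cyl u) \<xi> \<partial>\<mu>))"
    by (subst nn_integral_sum) (auto simp: nn_integral_cmult)
  finally show ?thesis .
qed

lemma integral_Cyl_level:
  assumes "integrable \<mu> f"
  shows "(\<integral>\<xi>. f \<xi> \<partial>\<mu>) = (\<Sum>u\<in>level i. LINT \<xi>:Cyl u|\<mu>. (f \<xi> :: real))"
proof -
  have "(\<integral>\<xi>. f \<xi> \<partial>\<mu>) = (LINT \<xi>:(\<Union>u\<in>level i. Cyl u)|\<mu>. f \<xi>)"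
    using set_integral_space[OF assms] by (simp add: Ends_level[symmetric])
  also have "\<dots> = (\<Sum>u\<in>level i. LINT \<xi>:Cyl u|\<mu>. f \<xi>)"
    using assms by (intro set_integral_finite_Union finite_level disj_level set_int) auto
  finally show ?thesis .
qed

lemma part_lev_ge: "n \<le> i \<Longrightarrow> part (\<lambda>\<xi>. F (\<xi> n)) i = 0"
proof -
  assume n: "n \<le> i"
  have "part (\<lambda>\<xi>. F (\<xi> n)) i = (\<integral>\<^sup>+z. 0 \<partial>(\<mu> \<Otimes>\<^sub>M \<mu>))"
    unfolding part_def
  proof (rule nn_integral_cong)
    fix z assume "z \<in> space (\<mu> \<Otimes>\<^sub>M \<mu>)"
    then have "fst z \<in> Ends" "snd z \<in> Ends" by (auto simp: space_pair)
    then have "fst z i = snd z i \<Longrightarrow> fst z n = snd z n" using ends_agree[of "fst z" "snd z" i n] n by simp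
    then show "ennreal ((F (fst z n) - F (snd z n))^2 * kern i (fst z) (snd z)) = 0" by (auto simp: kern_def)
  qed
  then show ?thesis by simp
qed

text \<open>The usual identity between a double integral of squared differences and the variance:
  expanding around the mean \<open>c\<close> leaves no cross term, since F - c averages to zero over
  the cylinder.\<close>

lemma double_square:
  fixes F :: "'v \<Rightarrow> real" and n :: nat
  assumes u: "u \<in> V"
  defines "c \<equiv> avg (\<lambda>\<xi>. F (\<xi> n)) u"
  shows "(\<integral>\<^sup>+\<xi>. (\<integral>\<^sup>+\<eta>. ennreal ((F (\<xi> n) - F (\<eta> n))^2) * indicator (Cyl u) \<eta> \<partial>\<mu>) * indicator (Cyl u) \<xi> \<partial>\<mu>)
    = ennreal (2 * mu u * (LINT \<xi>:Cyl u|\<mu>. (F (\<xi> n) - c)^2))"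
proof -
  define S where "S = (LINT \<xi>:Cyl u|\<mu>. (F (\<xi> n) - c)^2)"
  have S0: "0 \<le> S" unfolding S_def set_lebesgue_integral_def by (intro integral_nonneg_AE) auto
  have i1: "integrable \<mu> (\<lambda>\<xi>. (F (\<xi> n) - c)^2)" using integrable_lev[of "\<lambda>x. (F x - c)^2"] by simp
  have i2: "integrable \<mu> (\<lambda>\<xi>. 2 * a * (F (\<xi> n) - c))" for a using integrable_lev[of "\<lambda>x. 2 * a * (F x - c)"] by simp
  have zero: "(LINT \<xi>:Cyl u|\<mu>. 2 * a * (F (\<xi> n) - c)) = 0" for a
  proof -
    have "avg (\<lambda>\<xi>. F (\<xi> n) - c) u = 0" using avg_diff[OF integrable_lev, of "\<lambda>_. c" F n u] by (simp add: avg_const[OF u] c_def)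
    then show ?thesis using mu_avg[OF u, of "\<lambda>\<xi>. F (\<xi> n) - c"] by simp
  qed
  have cst: "(LINT \<xi>:Cyl u|\<mu>. a) = mu u * a" for a :: real
    using mu_avg[OF u, of "\<lambda>_. a"] by (simp add: avg_const[OF u])
  have nn: "(\<integral>\<^sup>+\<eta>. ennreal (h \<eta>) * indicator (Cyl u) \<eta> \<partial>\<mu>) = ennreal (LINT \<xi>:Cyl u|\<mu>. h \<xi>)"
    if "integrable \<mu> h" "\<And>\<xi>. 0 \<le> h \<xi>" for h
  proof -
    have "(\<integral>\<^sup>+\<eta>. ennreal (h \<eta>) * indicator (Cyl u) \<eta> \<partial>\<mu>) = (\<integral>\<^sup>+\<eta>. ennreal (indicator (Cyl u) \<eta> *\<^sub>R h \<eta>) \<partial>\<mu>)"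
      by (intro nn_integral_cong) (auto simp: indicator_def)
    also have "\<dots> = ennreal (LINT \<xi>:Cyl u|\<mu>. h \<xi>)"
      unfolding set_lebesgue_integral_def using set_int[OF that(1), of u] that(2)
      by (intro nn_integral_eq_integral) (auto simp: set_integrable_def)
    finally show ?thesis .
  qed
  have inner: "(\<integral>\<^sup>+\<eta>. ennreal ((F (\<xi> n) - F (\<eta> n))^2) * indicator (Cyl u) \<eta> \<partial>\<mu>) = ennreal (mu u * (F (\<xi> n) - c)^2 + S)" for \<xi>
  proof -
    let ?a = "F (\<xi> n) - c"
    have "(\<integral>\<^sup>+\<eta>. ennreal ((F (\<xi> n) - F (\<eta> n))^2) * indicator (Cyl u) \<eta> \<partial>\<mu>) = ennreal (LINT \<eta>:Cyl u|\<mu>. (F (\<xi> n) - F (\<eta> n))^2)"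
      using integrable_lev[of "\<lambda>x. (F (\<xi> n) - F x)^2"] by (intro nn) auto
    also have "(LINT \<eta>:Cyl u|\<mu>. (F (\<xi> n) - F (\<eta> n))^2) = (LINT \<eta>:Cyl u|\<mu>. (?a^2 - 2 * ?a * (F (\<eta> n) - c)) + (F (\<eta> n) - c)^2)"
      by (intro arg_cong[where f = "set_lebesgue_integral \<mu> (Cyl u)"] ext) (simp add: power2_eq_square algebra_simps)
    also have "\<dots> = (LINT \<eta>:Cyl u|\<mu>. ?a^2) - (LINT \<eta>:Cyl u|\<mu>. 2 * ?a * (F (\<eta> n) - c)) + S"
    proof -
      have s1: "set_integrable \<mu> (Cyl u) (\<lambda>\<eta>. ?a^2)" by (rule set_int) simp
      note s2 = set_int[OF i2, of u ?a] and s3 = set_int[OF i1, of u]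
      show ?thesis unfolding S_def
        by (simp only: set_integral_add(2)[OF set_integral_diff(1)[OF s1 s2] s3] set_integral_diff(2)[OF s1 s2])
    qed
    also have "\<dots> = mu u * ?a^2 - 0 + S" by (simp only: zero cst)
    finally show ?thesis by simp
  qed
  have "(\<integral>\<^sup>+\<xi>. ennreal (mu u * (F (\<xi> n) - c)^2 + S) * indicator (Cyl u) \<xi> \<partial>\<mu>) = ennreal (LINT \<xi>:Cyl u|\<mu>. mu u * (F (\<xi> n) - c)^2 + S)"
    using i1 S0 by (intro nn) auto
  also have "(LINT \<xi>:Cyl u|\<mu>. mu u * (F (\<xi> n) - c)^2 + S) = mu u * S + mu u * S"
    using i1 by (simp add: set_integral_add set_int cst S_def)
  finally show ?thesis unfolding inner S_def[symmetric] by (simp add: mult_ac)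
qed

text \<open>The tower property, obtained by ascending one level at a time with
  \<open>avg_martingale\<close>.\<close>

lemma avg_lev:
  assumes f: "integrable \<mu> f" and u: "u \<in> V"
  shows "avg (\<lambda>\<xi>. avg f (\<xi> (dep u + k))) u = avg f u"
proof (induction k)
  case 0
  have "avg (\<lambda>\<xi>. avg f (\<xi> (dep u + 0))) u = avg (\<lambda>_. avg f u) u"
    unfolding avg_def[of "\<lambda>_. avg f u"] avg_def[of "\<lambda>\<xi>. avg f (\<xi> (dep u + 0))"]
    by (intro arg_cong2[where f = "(/)"] set_lebesgue_integral_cong) (auto simp: Cyl_iff)
  then show ?case using u by (simp add: avg_const)
next
  case (Suc k)
  let ?n = "dep u + k"
  \<comment> \<open>The indicator of \<open>Cyl u\<close> as a function of the vertex at level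
    \<open>dep u + k\<close>, the form in which \<open>avg_martingale\<close> takes its
    weight.\<close>
  define w where "w x = (if (up ^^ k) x = u then 1 else 0 :: real)" for x
  have w: "w (\<xi> ?n) = indicator (Cyl u) \<xi>" if "\<xi> \<in> Ends" for \<xi>
    using ends_funpow[OF that, of k ?n] that by (auto simp: w_def indicator_def Cyl_iff)
  have "(LINT \<xi>:Cyl u|\<mu>. avg f (\<xi> (Suc ?n))) = (\<integral>\<xi>. w (\<xi> ?n) * avg f (\<xi> (Suc ?n)) \<partial>\<mu>)"
    unfolding set_lebesgue_integral_def by (rule integral_cong_ends) (simp add: w)
  also have "\<dots> = (\<integral>\<xi>. w (\<xi> ?n) * avg f (\<xi> ?n) \<partial>\<mu>)" by (rule avg_martingale[OF f])
  also have "\<dots> = (LINT \<xi>:Cyl u|\<mu>. avg f (\<xi> ?n))"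
    unfolding set_lebesgue_integral_def by (rule integral_cong_ends) (simp add: w)
  finally show ?case using Suc.IH by (simp add: avg_def[of "\<lambda>\<xi>. avg f (\<xi> _)"])
qed

text \<open>The variance of the level-n averages inside the cylinders of level i, weighted by
  \<open>step\<close>: for i < n, half of what level i contributes to the jump form of these
  averages.\<close>

definition osc :: "((nat \<Rightarrow> 'v) \<Rightarrow> real) \<Rightarrow> nat \<Rightarrow> nat \<Rightarrow> real" where
  "osc f i n = (\<integral>\<xi>. step (\<xi> i) * (avg f (\<xi> n) - avg f (\<xi> i))^2 \<partial>\<mu>)"

lemma osc_Suc:
  assumes f: "integrable \<mu> f" and i: "i \<le> n"
  shows "osc f i (Suc n) = osc f i n + (\<integral>\<xi>. step (\<xi> i) * (avg f (\<xi> (Suc n)) - avg f (\<xi> n))^2 \<partial>\<mu>)"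
proof -
  let ?s = "\<lambda>x. step ((up ^^ (n - i)) x)" and ?b = "\<lambda>x. avg f ((up ^^ (n - i)) x)"
  have e: "(up ^^ (n - i)) (\<xi> n) = \<xi> i" if "\<xi> \<in> Ends" for \<xi> using ends_funpow[OF that, of "n - i" n] i by simp
  have "osc f i (Suc n) = (\<integral>\<xi>. ?s (\<xi> n) * (avg f (\<xi> (Suc n)) - ?b (\<xi> n))^2 \<partial>\<mu>)"
    unfolding osc_def by (rule integral_cong_ends) (simp add: e)
  also have "\<dots> = (\<integral>\<xi>. ?s (\<xi> n) * (avg f (\<xi> n) - ?b (\<xi> n))^2 \<partial>\<mu>) + (\<integral>\<xi>. ?s (\<xi> n) * (avg f (\<xi> (Suc n)) - avg f (\<xi> n))^2 \<partial>\<mu>)"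
    by (rule avg_pythagoras[OF f])
  also have "(\<integral>\<xi>. ?s (\<xi> n) * (avg f (\<xi> n) - ?b (\<xi> n))^2 \<partial>\<mu>) = osc f i n"
    unfolding osc_def by (rule integral_cong_ends) (simp add: e)
  also have "(\<integral>\<xi>. ?s (\<xi> n) * (avg f (\<xi> (Suc n)) - avg f (\<xi> n))^2 \<partial>\<mu>) = (\<integral>\<xi>. step (\<xi> i) * (avg f (\<xi> (Suc n)) - avg f (\<xi> n))^2 \<partial>\<mu>)"
    by (rule integral_cong_ends) (simp add: e)
  finally show ?thesis .
qed

lemma integrable_anc:
  fixes F :: "'v \<Rightarrow> 'v \<Rightarrow> 'v \<Rightarrow> real"
  assumes "i \<le> n"
  shows "integrable \<mu> (\<lambda>\<xi>. F (\<xi> i) (\<xi> n) (\<xi> (Suc n)))"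
proof -
  have "integrable \<mu> (\<lambda>\<xi>. (\<lambda>x y. F ((up ^^ (n - i)) x) x y) (\<xi> n) (\<xi> (Suc n)))" by (rule integrable_lev2)
  then show ?thesis
    by (rule integrable_cong_ends[THEN iffD1, rotated]) (use assms ends_funpow[of _ "n - i" n] in simp)
qed

text \<open>Passing to level n + 1 adds to each \<open>osc f i\<close> the squared increment of the
  average weighted by \<open>step (\<xi> i)\<close>. For i <= n these weights add up to 1/g(xi_n),
  which produces r_n; the new term i = n starts from zero.\<close>

lemma sum_osc:
  assumes f: "integrable \<mu> f"
  shows "(\<Sum>i<n. osc f i n) = (\<Sum>j<n. avg_energy f g j)"
proof (induction n)
  case (Suc n)
  have "(\<Sum>i<Suc n. osc f i (Suc n)) = (\<Sum>i\<le>n. osc f i n + (\<integral>\<xi>. step (\<xi> i) * (avg f (\<xi> (Suc n)) - avg f (\<xi> n))^2 \<partial>\<mu>))"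
    unfolding lessThan_Suc_atMost by (intro sum.cong) (auto simp: osc_Suc[OF f])
  also have "\<dots> = (\<Sum>i\<le>n. osc f i n) + (\<integral>\<xi>. (\<Sum>i\<le>n. step (\<xi> i) * (avg f (\<xi> (Suc n)) - avg f (\<xi> n))^2) \<partial>\<mu>)"
    unfolding sum.distrib
    by (subst Bochner_Integration.integral_sum) (auto intro!: integrable_anc[where F = "\<lambda>x y z. step x * (avg f z - avg f y)^2"])
  also have "(\<integral>\<xi>. (\<Sum>i\<le>n. step (\<xi> i) * (avg f (\<xi> (Suc n)) - avg f (\<xi> n))^2) \<partial>\<mu>) = avg_energy f g n"
    unfolding avg_energy_def by (rule integral_cong_ends) (simp add: sum_distrib_right[symmetric] sum_step)
  also have "(\<Sum>i\<le>n. osc f i n) = (\<Sum>i<n. osc f i n)"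
    unfolding lessThan_Suc_atMost[symmetric] by (simp add: osc_def)
  finally show ?case using Suc.IH by simp
qed simp

lemma part_lev_less:
  assumes f: "integrable \<mu> f" and i: "i < n"
  shows "part (\<lambda>\<xi>. avg f (\<xi> n)) i = ennreal (2 * osc f i n)"
proof -
  let ?S = "\<lambda>u. (LINT \<xi>:Cyl u|\<mu>. (avg f (\<xi> n) - avg f u)^2)"
  have S0: "0 \<le> ?S u" for u unfolding set_lebesgue_integral_def by (intro integral_nonneg_AE) auto
  have "part (\<lambda>\<xi>. avg f (\<xi> n)) i = (\<Sum>u\<in>level i. ennreal (2 * (step u * ?S u)))"
  proof (subst part_iterated, measurable, intro sum.cong refl)
    fix u assume u: "u \<in> level i"
    then have uV: "u \<in> V" "dep u = i" by (auto dest: levelD)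
    have "avg (\<lambda>\<xi>. avg f (\<xi> n)) u = avg f u" using avg_lev[OF f uV(1), of "n - i"] uV i by simp
    then have "ennreal (step u / mu u) * (\<integral>\<^sup>+\<xi>. (\<integral>\<^sup>+\<eta>. ennreal ((avg f (\<xi> n) - avg f (\<eta> n))^2) * indicator (Cyl u) \<eta> \<partial>\<mu>) * indicator (Cyl u) \<xi> \<partial>\<mu>)
      = ennreal (step u / mu u) * ennreal (2 * mu u * ?S u)"
      by (simp add: double_square[OF uV(1)])
    also have "\<dots> = ennreal (2 * (step u * ?S u))"
      using mu_pos[OF uV(1)] step_pos[OF uV(1)] S0[of u] by (simp add: ennreal_mult[symmetric] less_imp_le)
    finally show "ennreal (step u / mu u) * (\<integral>\<^sup>+\<xi>. (\<integral>\<^sup>+\<eta>. ennreal ((avg f (\<xi> n) - avg f (\<eta> n))^2) * indicator (Cyl u) \<eta> \<partial>\<mu>) * indicator (Cyl u) \<xi> \<partial>\<mu>) = ennreal (2 * (step u * ?S u))" .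
  qed
  also have "\<dots> = ennreal (2 * (\<Sum>u\<in>level i. step u * ?S u))"
  proof -
    have "0 \<le> step u * ?S u" if "u \<in> level i" for u
      using S0[of u] step_pos[of u] levelD(1)[OF that] by (simp add: less_imp_le)
    then show ?thesis by (subst sum_ennreal) (auto simp: sum_distrib_left)
  qed
  also have "(\<Sum>u\<in>level i. step u * ?S u) = osc f i n"
  proof -
    have "integrable \<mu> (\<lambda>\<xi>. step (\<xi> i) * (avg f (\<xi> n) - avg f (\<xi> i))^2)"
      using integrable_anc[of i n "\<lambda>x y z. step x * (avg f y - avg f x)^2"] i by simp
    then have "osc f i n = (\<Sum>u\<in>level i. LINT \<xi>:Cyl u|\<mu>. step (\<xi> i) * (avg f (\<xi> n) - avg f (\<xi> i))^2)"
      unfolding osc_def by (rule integral_Cyl_level)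
    also have "\<dots> = (\<Sum>u\<in>level i. LINT \<xi>:Cyl u|\<mu>. step u * (avg f (\<xi> n) - avg f u)^2)"
      by (intro sum.cong set_lebesgue_integral_cong) (auto simp: Cyl_level)
    also have "\<dots> = (\<Sum>u\<in>level i. step u * ?S u)" by simp
    finally show ?thesis by simp
  qed
  finally show ?thesis .
qed

lemma osc_nonneg: "0 \<le> osc f i n"
  unfolding osc_def by (intro integral_nonneg_AE AE_I2) (simp add: step_pos ends_V less_imp_le)

lemma jform_lev:
  assumes f: "integrable \<mu> f"
  shows "jform (\<lambda>\<xi>. avg f (\<xi> n)) = (\<Sum>j<n. ennreal (2 * avg_energy f g j))"
proof -
  have "jform (\<lambda>\<xi>. avg f (\<xi> n)) = (\<Sum>i. part (\<lambda>\<xi>. avg f (\<xi> n)) i)" by (rule jform_eq) measurable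
  also have "\<dots> = (\<Sum>i<n. part (\<lambda>\<xi>. avg f (\<xi> n)) i)"
    by (rule suminf_finite) (auto simp: part_lev_ge)
  also have "\<dots> = (\<Sum>i<n. ennreal (2 * osc f i n))" by (intro sum.cong) (auto simp: part_lev_less[OF f])
  also have "\<dots> = ennreal (2 * (\<Sum>i<n. osc f i n))"
    using osc_nonneg by (subst sum_ennreal) (auto simp: sum_distrib_left)
  also have "\<dots> = (\<Sum>j<n. ennreal (2 * avg_energy f g j))"
    unfolding sum_osc[OF f] using avg_energy_nonneg by (subst sum_ennreal) (auto simp: sum_distrib_left)
  finally show ?thesis .
qed

text \<open>\<open>jensen_Cyl\<close> summed over the set \<open>L\<close> of descendants of
  \<open>u\<close> at level n.\<close>

lemma jensen_level:
  assumes f: "integrable \<mu> f" and u: "u \<in> level i" and i: "i \<le> n"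
  shows "(\<integral>\<^sup>+\<xi>. ennreal ((avg f (\<xi> n) - c)^2) * indicator (Cyl u) \<xi> \<partial>\<mu>) \<le> (\<integral>\<^sup>+\<xi>. ennreal ((f \<xi> - c)^2) * indicator (Cyl u) \<xi> \<partial>\<mu>)"
proof -
  have fm [measurable]: "f \<in> borel_measurable \<mu>" using f by auto
  define L where "L = {x\<in>level n. (up ^^ (n - i)) x = u}"
  have L: "finite L" "L \<subseteq> level n" using finite_level[of n] by (auto simp: L_def)
  have ind: "indicator (Cyl u) \<xi> = (\<Sum>x\<in>L. indicator (Cyl x) \<xi> :: ennreal)" if xi: "\<xi> \<in> Ends" for \<xi>
  proof -
    have "(\<Sum>x\<in>L. indicator (Cyl x) \<xi> :: ennreal) = (\<Sum>x\<in>L. if x = \<xi> n then 1 else 0)"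
      using xi L by (intro sum.cong) (auto simp: Cyl_level indicator_def)
    also have "\<dots> = (if \<xi> n \<in> L then 1 else 0)" using L by (simp add: sum.delta')
    also have "\<xi> n \<in> L \<longleftrightarrow> \<xi> \<in> Cyl u"
      using ends_level[OF xi, of n] ends_funpow[OF xi, of "n - i" n] i u xi by (auto simp: L_def Cyl_level)
    finally show ?thesis by (simp add: indicator_def)
  qed
  have "(\<integral>\<^sup>+\<xi>. ennreal ((avg f (\<xi> n) - c)^2) * indicator (Cyl u) \<xi> \<partial>\<mu>)
    = (\<integral>\<^sup>+\<xi>. (\<Sum>x\<in>L. ennreal ((avg f x - c)^2) * indicator (Cyl x) \<xi>) \<partial>\<mu>)"
  proof (rule nn_integral_cong)
    fix \<xi> assume "\<xi> \<in> space \<mu>"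
    then have xi: "\<xi> \<in> Ends" by simp
    have "(\<Sum>x\<in>L. ennreal ((avg f (\<xi> n) - c)^2) * indicator (Cyl x) \<xi>) = (\<Sum>x\<in>L. ennreal ((avg f x - c)^2) * indicator (Cyl x) \<xi>)"
      using L by (intro sum.cong) (auto simp: Cyl_level indicator_def)
    then show "ennreal ((avg f (\<xi> n) - c)^2) * indicator (Cyl u) \<xi> = (\<Sum>x\<in>L. ennreal ((avg f x - c)^2) * indicator (Cyl x) \<xi>)"
      by (simp add: ind[OF xi] sum_distrib_left)
  qed
  also have "\<dots> = (\<Sum>x\<in>L. ennreal (mu x * (avg f x - c)^2))"
    by (subst nn_integral_sum, simp)
       (intro sum.cong refl, subst nn_integral_cmult_indicator, simp, simp add: emeasure_eq_measure ennreal_mult mult.commute)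
  also have "\<dots> \<le> (\<Sum>x\<in>L. \<integral>\<^sup>+\<xi>. ennreal ((f \<xi> - c)^2) * indicator (Cyl x) \<xi> \<partial>\<mu>)"
    using L levelD by (intro sum_mono jensen_Cyl f) auto
  also have "\<dots> = (\<integral>\<^sup>+\<xi>. (\<Sum>x\<in>L. ennreal ((f \<xi> - c)^2) * indicator (Cyl x) \<xi>) \<partial>\<mu>)"
    by (subst nn_integral_sum) auto
  also have "\<dots> = (\<integral>\<^sup>+\<xi>. ennreal ((f \<xi> - c)^2) * indicator (Cyl u) \<xi> \<partial>\<mu>)"
    by (intro nn_integral_cong) (simp add: ind sum_distrib_left)
  finally show ?thesis .
qed

text \<open>Jensen is applied to one variable at a time: to the inner one with the outer one fixed,
  and after exchanging the integrals to the other.\<close>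

lemma part_lev_le:
  assumes f: "integrable \<mu> f"
  shows "part (\<lambda>\<xi>. avg f (\<xi> n)) i \<le> part f i"
proof (cases "n \<le> i")
  case False
  have fm [measurable]: "f \<in> borel_measurable \<mu>" using f by auto
  let ?A = "\<lambda>\<xi>. avg f (\<xi> n)"
  have "(\<integral>\<^sup>+\<xi>. (\<integral>\<^sup>+\<eta>. ennreal ((?A \<xi> - ?A \<eta>)^2) * indicator (Cyl u) \<eta> \<partial>\<mu>) * indicator (Cyl u) \<xi> \<partial>\<mu>)
    \<le> (\<integral>\<^sup>+\<eta>. (\<integral>\<^sup>+\<xi>. ennreal ((f \<xi> - f \<eta>)^2) * indicator (Cyl u) \<xi> \<partial>\<mu>) * indicator (Cyl u) \<eta> \<partial>\<mu>)" if u: "u \<in> level i" for u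
  proof -
    have j: "(\<integral>\<^sup>+\<eta>. ennreal ((c - ?A \<eta>)^2) * indicator (Cyl u) \<eta> \<partial>\<mu>) \<le> (\<integral>\<^sup>+\<eta>. ennreal ((c - f \<eta>)^2) * indicator (Cyl u) \<eta> \<partial>\<mu>)" for c
      using jensen_level[OF f u, of n c] False by (simp add: power2_commute[of _ c])
    have "(\<integral>\<^sup>+\<xi>. (\<integral>\<^sup>+\<eta>. ennreal ((?A \<xi> - ?A \<eta>)^2) * indicator (Cyl u) \<eta> \<partial>\<mu>) * indicator (Cyl u) \<xi> \<partial>\<mu>)
      \<le> (\<integral>\<^sup>+\<xi>. (\<integral>\<^sup>+\<eta>. ennreal ((?A \<xi> - f \<eta>)^2) * indicator (Cyl u) \<eta> \<partial>\<mu>) * indicator (Cyl u) \<xi> \<partial>\<mu>)"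
      by (rule nn_integral_mono, rule mult_right_mono[OF j]) simp
    also have "\<dots> = (\<integral>\<^sup>+\<xi>. (\<integral>\<^sup>+\<eta>. ennreal ((?A \<xi> - f \<eta>)^2) * indicator (Cyl u) \<eta> * indicator (Cyl u) \<xi> \<partial>\<mu>) \<partial>\<mu>)"
      by (intro nn_integral_cong nn_integral_multc[symmetric]) measurable
    also have "\<dots> = (\<integral>\<^sup>+\<eta>. (\<integral>\<^sup>+\<xi>. ennreal ((?A \<xi> - f \<eta>)^2) * indicator (Cyl u) \<eta> * indicator (Cyl u) \<xi> \<partial>\<mu>) \<partial>\<mu>)"
      by (rule pp.Fubini'[symmetric]) measurable
    also have "\<dots> = (\<integral>\<^sup>+\<eta>. (\<integral>\<^sup>+\<xi>. ennreal ((?A \<xi> - f \<eta>)^2) * indicator (Cyl u) \<xi> \<partial>\<mu>) * indicator (Cyl u) \<eta> \<partial>\<mu>)"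
      by (intro nn_integral_cong, subst nn_integral_multc[symmetric]) (auto simp: mult_ac)
    also have "\<dots> \<le> (\<integral>\<^sup>+\<eta>. (\<integral>\<^sup>+\<xi>. ennreal ((f \<xi> - f \<eta>)^2) * indicator (Cyl u) \<xi> \<partial>\<mu>) * indicator (Cyl u) \<eta> \<partial>\<mu>)"
      using False by (intro nn_integral_mono mult_right_mono[OF jensen_level[OF f u]]) auto
    finally show ?thesis .
  qed
  moreover have "(\<integral>\<^sup>+\<eta>. (\<integral>\<^sup>+\<xi>. ennreal ((f \<xi> - f \<eta>)^2) * indicator (Cyl u) \<xi> \<partial>\<mu>) * indicator (Cyl u) \<eta> \<partial>\<mu>)
    = (\<integral>\<^sup>+\<xi>. (\<integral>\<^sup>+\<eta>. ennreal ((f \<xi> - f \<eta>)^2) * indicator (Cyl u) \<eta> \<partial>\<mu>) * indicator (Cyl u) \<xi> \<partial>\<mu>)" for u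
    by (subst power2_commute) (rule refl)
  ultimately show ?thesis by (simp add: part_iterated sum_mono mult_left_mono)
qed (simp add: part_lev_ge)

text \<open>Both sides are compared with the level-n averages, for which \<open>jform_lev\<close> is
  exact: averaging decreases every part of the form, and Fatou along the almost surely convergent
  averages gives the other inequality.\<close>

theorem jform_eq_avg_energy:
  assumes f: "integrable \<mu> f"
  shows "jform f = (\<Sum>j. ennreal (2 * avg_energy f g j))"
proof (rule antisym)
  have fm [measurable]: "f \<in> borel_measurable \<mu>" using f by auto
  have "(\<Sum>j<n. ennreal (2 * avg_energy f g j)) \<le> jform f" for n
  proof -
    have "(\<Sum>j<n. ennreal (2 * avg_energy f g j)) = (\<Sum>i. part (\<lambda>\<xi>. avg f (\<xi> n)) i)"
      using jform_lev[OF f] jform_eq[of "\<lambda>\<xi>. avg f (\<xi> n)"] by simp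
    also have "\<dots> \<le> (\<Sum>i. part f i)" by (intro suminf_le part_lev_le f) auto
    also have "\<dots> = jform f" by (simp add: jform_eq)
    finally show ?thesis .
  qed
  then show "(\<Sum>j. ennreal (2 * avg_energy f g j)) \<le> jform f" by (intro suminf_le_const) auto
next
  have fm [measurable]: "f \<in> borel_measurable \<mu>" using f by auto
  note [measurable] = measurable_jump
  have cv: "AE \<xi> in \<mu>. (\<lambda>n. avg f (\<xi> n)) \<longlonglongrightarrow> f \<xi>" using cnv_integrable[OF f] by (simp add: cnv_def)
  \<comment> \<open>Invariance under exchange of the coordinates reduces the second marginal to the
    first.\<close>
  have "distr (\<mu> \<Otimes>\<^sub>M \<mu>) \<mu> fst = distr (distr (\<mu> \<Otimes>\<^sub>M \<mu>) (\<mu> \<Otimes>\<^sub>M \<mu>) (\<lambda>(x, y). (y, x))) \<mu> fst"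
    using pp.distr_pair_swap by simp
  also have "\<dots> = distr (\<mu> \<Otimes>\<^sub>M \<mu>) \<mu> snd"
    by (subst distr_distr) (auto simp: comp_def case_prod_beta)
  finally have snd: "distr (\<mu> \<Otimes>\<^sub>M \<mu>) \<mu> snd = \<mu>" by (simp add: distr_pair_fst)
  have "AE z in \<mu> \<Otimes>\<^sub>M \<mu>. (\<lambda>n. avg f (fst z n)) \<longlonglongrightarrow> f (fst z)"
    by (rule AE_distrD[OF measurable_fst, where P = "\<lambda>\<xi>. (\<lambda>n. avg f (\<xi> n)) \<longlonglongrightarrow> f \<xi>"], subst distr_pair_fst, rule cv)
  moreover have "AE z in \<mu> \<Otimes>\<^sub>M \<mu>. (\<lambda>n. avg f (snd z n)) \<longlonglongrightarrow> f (snd z)"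
    by (rule AE_distrD[OF measurable_snd, where P = "\<lambda>\<xi>. (\<lambda>n. avg f (\<xi> n)) \<longlonglongrightarrow> f \<xi>"], subst snd, rule cv)
  ultimately have "AE z in \<mu> \<Otimes>\<^sub>M \<mu>. ennreal ((f (fst z) - f (snd z))^2 * J (fst z) (snd z)) =
     liminf (\<lambda>n. ennreal ((avg f (fst z n) - avg f (snd z n))^2 * J (fst z) (snd z)))"
  proof eventually_elim
    case (elim z)
    then have "(\<lambda>n. ennreal ((avg f (fst z n) - avg f (snd z n))^2 * J (fst z) (snd z))) \<longlonglongrightarrow> ennreal ((f (fst z) - f (snd z))^2 * J (fst z) (snd z))"
      by (intro tendsto_intros)
    then show ?case by (simp add: lim_imp_Liminf)
  qed
  then have "jform f = (\<integral>\<^sup>+z. liminf (\<lambda>n. ennreal ((avg f (fst z n) - avg f (snd z n))^2 * J (fst z) (snd z))) \<partial>(\<mu> \<Otimes>\<^sub>M \<mu>))"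
    unfolding jform_def by (rule nn_integral_cong_AE)
  also have "\<dots> \<le> liminf (\<lambda>n. jform (\<lambda>\<xi>. avg f (\<xi> n)))"
    unfolding jform_def
  proof (rule nn_integral_liminf)
    fix n
    have [measurable]: "(\<lambda>z. avg f (fst z n)) \<in> borel_measurable (\<mu> \<Otimes>\<^sub>M \<mu>)" "(\<lambda>z. avg f (snd z n)) \<in> borel_measurable (\<mu> \<Otimes>\<^sub>M \<mu>)"
      using measurable_compose[OF measurable_fst measurable_lev_mu] measurable_compose[OF measurable_snd measurable_lev_mu] by auto
    show "(\<lambda>z. ennreal ((avg f (fst z n) - avg f (snd z n))^2 * J (fst z) (snd z))) \<in> borel_measurable (\<mu> \<Otimes>\<^sub>M \<mu>)" by measurable
  qed
  also have "\<dots> = liminf (\<lambda>n. \<Sum>j<n. ennreal (2 * avg_energy f g j))" by (simp add: jform_lev[OF f])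
  also have "\<dots> = (\<Sum>j. ennreal (2 * avg_energy f g j))"
    by (intro lim_imp_Liminf summable_LIMSEQ) auto
  finally show "jform f \<le> (\<Sum>j. ennreal (2 * avg_energy f g j))" .
qed

lemma jump_integrable:
  assumes f: "integrable \<mu> f" and s: "avg_energy f g sums s"
  shows "integrable (\<mu> \<Otimes>\<^sub>M \<mu>) (\<lambda>z. (f (fst z) - f (snd z))^2 * J (fst z) (snd z))"
    and "(\<integral>z. (f (fst z) - f (snd z))^2 * J (fst z) (snd z) \<partial>(\<mu> \<Otimes>\<^sub>M \<mu>)) = 2 * s"
proof -
  have fm [measurable]: "f \<in> borel_measurable \<mu>" using f by auto
  note [measurable] = measurable_jump
  have s0: "0 \<le> s" using s avg_energy_nonneg by (metis sums_iff suminf_nonneg)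
  have "(\<lambda>j. 2 * avg_energy f g j) sums (2 * s)" using s by (rule sums_mult)
  then have "jform f = ennreal (2 * s)"
    unfolding jform_eq_avg_energy[OF f] using avg_energy_nonneg by (subst suminf_ennreal2) (auto simp: sums_iff)
  moreover have "AE z in \<mu> \<Otimes>\<^sub>M \<mu>. 0 \<le> (f (fst z) - f (snd z))^2 * J (fst z) (snd z)"
    by (intro AE_I2) (auto simp: space_pair jump_kernel_nonneg)
  moreover have "(\<lambda>z. (f (fst z) - f (snd z))^2 * J (fst z) (snd z)) \<in> borel_measurable (\<mu> \<Otimes>\<^sub>M \<mu>)" by measurable
  ultimately have "has_bochner_integral (\<mu> \<Otimes>\<^sub>M \<mu>) (\<lambda>z. (f (fst z) - f (snd z))^2 * J (fst z) (snd z)) (2 * s)"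
    using s0 unfolding jform_def by (intro has_bochner_integral_nn_integral) auto
  then show "integrable (\<mu> \<Otimes>\<^sub>M \<mu>) (\<lambda>z. (f (fst z) - f (snd z))^2 * J (fst z) (snd z))"
    "(\<integral>z. (f (fst z) - f (snd z))^2 * J (fst z) (snd z) \<partial>(\<mu> \<Otimes>\<^sub>M \<mu>)) = 2 * s"
    by (auto simp: has_bochner_integral_iff)
qed

text \<open>Polarisation; the factor 1/2 of the form cancels the factor 2 relating
  \<open>jform\<close> to the energy of averages.\<close>

lemma standard_form_polar:
  assumes f: "integrable \<mu> f" "integrable \<mu> f'"
    and s: "avg_energy (\<lambda>\<xi>. f \<xi> + f' \<xi>) g sums s" and t: "avg_energy (\<lambda>\<xi>. f \<xi> - f' \<xi>) g sums t"
  shows "standard_form V rt up g \<mu> f f' = (s - t) / 4"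
proof -
  let ?d = "\<lambda>f z. (f (fst z) - f (snd z))^2 * J (fst z) (snd z)"
  let ?a = "\<lambda>\<xi>. f \<xi> + f' \<xi>" and ?b = "\<lambda>\<xi>. f \<xi> - f' \<xi>"
  have a: "integrable (\<mu> \<Otimes>\<^sub>M \<mu>) (?d ?a)" "(\<integral>z. ?d ?a z \<partial>(\<mu> \<Otimes>\<^sub>M \<mu>)) = 2 * s"
    using jump_integrable[of ?a, OF _ s] f by auto
  have b: "integrable (\<mu> \<Otimes>\<^sub>M \<mu>) (?d ?b)" "(\<integral>z. ?d ?b z \<partial>(\<mu> \<Otimes>\<^sub>M \<mu>)) = 2 * t"
    using jump_integrable[of ?b, OF _ t] f by auto
  have "(\<integral>z. (f (fst z) - f (snd z)) * (f' (fst z) - f' (snd z)) * J (fst z) (snd z) \<partial>(\<mu> \<Otimes>\<^sub>M \<mu>))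
    = (\<integral>z. (?d ?a z - ?d ?b z) / 4 \<partial>(\<mu> \<Otimes>\<^sub>M \<mu>))"
    by (intro arg_cong[where f = "integral\<^sup>L (\<mu> \<Otimes>\<^sub>M \<mu>)"] ext) (simp add: power2_eq_square algebra_simps)
  also have "\<dots> = (2 * s - 2 * t) / 4" using a b by simp
  finally show ?thesis by (simp add: standard_form_def)
qed

end

section \<open>The law of a nearest neighbour random walk\<close>

locale walk = rtree V rt up
  for V :: "'v set" and rt :: 'v and up :: "'v \<Rightarrow> 'v" +
  fixes p :: "'v \<Rightarrow> 'v \<Rightarrow> real"
  assumes nn: "nn_random_walk V rt up p"
begin

abbreviation "Om \<equiv> PiM UNIV (\<lambda>_::nat. count_space V)"

lemma p_nonneg [simp]: "0 \<le> p x y" using nn by (auto simp: nn_random_walk_def)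
lemma p_pos_iff: "0 < p x y \<longleftrightarrow> y \<in> nb x" using nn by (simp add: nn_random_walk_def adj_iff_nb)
lemma p_eq_0: "y \<notin> nb x \<Longrightarrow> p x y = 0" using p_pos_iff[of x y] p_nonneg[of x y] by linarith
lemma p_sum: "x \<in> V \<Longrightarrow> (\<Sum>y\<in>nb x. p x y) = 1" using nn by (auto simp: nn_random_walk_def)

lemma space_Om: "space Om = {\<omega>. \<forall>i. \<omega> i \<in> V}" by (auto simp: space_PiM PiE_UNIV_domain)

lemma meas_coord [measurable]: "(\<lambda>\<omega>. \<omega> i) \<in> Om \<rightarrow>\<^sub>M count_space V"
  by (rule measurable_component_singleton) simp

section \<open>Trajectories and their finite-time events\<close>

definition atom :: "nat \<Rightarrow> (nat \<Rightarrow> 'v) \<Rightarrow> (nat \<Rightarrow> 'v) set" where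
  "atom n y = {\<omega>\<in>space Om. \<forall>i\<le>n. \<omega> i = y i}"

lemma coord_sets: "{\<omega>\<in>space Om. \<omega> i \<in> A} \<in> sets Om"
proof -
  have "(\<lambda>\<omega>. \<omega> i) -` (A \<inter> V) \<inter> space Om \<in> sets Om" by (rule measurable_sets[OF meas_coord]) auto
  moreover have "(\<lambda>\<omega>. \<omega> i) -` (A \<inter> V) \<inter> space Om = {\<omega>\<in>space Om. \<omega> i \<in> A}" by (auto simp: space_Om)
  ultimately show ?thesis by simp
qed

lemma coord_pred [measurable]: "Measurable.pred Om (\<lambda>\<omega>. P (\<omega> i))"
  using coord_sets[of i "{x. P x}"] by (simp add: pred_def)

lemma coord_pred2 [measurable]: "Measurable.pred Om (\<lambda>\<omega>. P (\<omega> i) (\<omega> j))"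
proof -
  have "{\<omega>\<in>space Om. P (\<omega> i) (\<omega> j)} = (\<Union>x\<in>V. {\<omega>\<in>space Om. \<omega> i \<in> {x}} \<inter> {\<omega>\<in>space Om. \<omega> j \<in> {y. P x y}})"
    by (auto simp: space_Om)
  also have "\<dots> \<in> sets Om" by (intro sets.countable_UN'' countable_V sets.Int coord_sets)
  finally show ?thesis by (simp add: pred_def)
qed

lemma atom_sets [measurable, simp]: "atom n y \<in> sets Om"
  unfolding atom_def by measurable

definition atoms :: "(nat \<Rightarrow> 'v) set set" where "atoms = insert {} (range (case_prod atom))"

lemma Int_stable_atoms: "Int_stable atoms"
proof -
  have "atom n y \<inter> atom m z \<in> atoms" if "n \<le> m" for n m y z
  proof (cases "\<forall>i\<le>n. y i = z i")
    case True
    then have "atom n y \<inter> atom m z = atom m z" using that by (auto simp: atom_def)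
    then show ?thesis by (auto simp: atoms_def intro!: range_eqI[of _ _ "(m, z)"])
  next
    case False
    then have "atom n y \<inter> atom m z = {}" using that by (fastforce simp: atom_def)
    then show ?thesis by (simp add: atoms_def)
  qed
  then have "atom n y \<inter> atom m z \<in> atoms" for n m y z
    by (metis Int_commute nat_le_linear)
  then show ?thesis by (auto simp: Int_stable_def atoms_def)
qed

lemma atoms_Pow: "atoms \<subseteq> Pow (space Om)" by (auto simp: atoms_def atom_def)

text \<open>A condition on coordinate i is a countable union of atoms, one for each word of i + 1
  vertices that ends as required.\<close>

lemma sets_Om: "sets Om = sigma_sets (space Om) atoms"
proof
  show "sigma_sets (space Om) atoms \<subseteq> sets Om"
    by (rule sets.sigma_sets_subset) (auto simp: atoms_def)
  have cs: "{\<omega>\<in>space Om. \<omega> i = a} \<in> sigma_sets (space Om) atoms" for i a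
  proof -
    let ?L = "{l \<in> lists V. length l = Suc i \<and> l ! i = a}"
    have "{\<omega>\<in>space Om. \<omega> i = a} = (\<Union>l\<in>?L. atom i ((!) l))"
    proof (intro set_eqI iffI)
      fix \<omega> assume w: "\<omega> \<in> {\<omega>\<in>space Om. \<omega> i = a}"
      let ?l = "map \<omega> [0..<Suc i]"
      have nth: "?l ! j = \<omega> j" if "j \<le> i" for j using that by (subst nth_map) (auto simp del: upt_Suc)
      have "set ?l \<subseteq> V" using w by (auto simp: space_Om)
      then have "?l \<in> ?L" using w nth[of i] by (simp add: lists_eq_set del: upt_Suc)
      moreover have "\<omega> \<in> atom i ((!) ?l)" using w nth by (auto simp: atom_def simp del: upt_Suc)
      ultimately show "\<omega> \<in> (\<Union>l\<in>?L. atom i ((!) l))" by blast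
    qed (auto simp: atom_def)
    also have "\<dots> \<in> sigma_sets (space Om) atoms"
    proof (rule sigma_sets_UNION)
      show "countable ((\<lambda>l. atom i ((!) l)) ` ?L)"
        by (intro countable_image countable_subset[OF _ countable_lists[OF countable_V]]) auto
    qed (auto simp: atoms_def)
    finally show ?thesis .
  qed
  have "{{f \<in> (\<Pi>\<^sub>E i\<in>UNIV. space (count_space V)). f i \<in> A} |i A. i \<in> UNIV \<and> A \<in> sets (count_space V)} \<subseteq> sigma_sets (space Om) atoms"
  proof safe
    fix i :: nat and A assume "A \<in> sets (count_space V)"
    then have A: "A \<subseteq> V" by simp
    have "{f \<in> (\<Pi>\<^sub>E i\<in>UNIV. space (count_space V)). f i \<in> A} = (\<Union>a\<in>A. {\<omega>\<in>space Om. \<omega> i = a})"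
      by (auto simp: space_PiM)
    also have "\<dots> \<in> sigma_sets (space Om) atoms"
      using countable_subset[OF A countable_V] cs by (intro sigma_sets_UNION countable_image) auto
    finally show "{f \<in> (\<Pi>\<^sub>E i\<in>UNIV. space (count_space V)). f i \<in> A} \<in> sigma_sets (space Om) atoms" .
  qed
  then show "sets Om \<subseteq> sigma_sets (space Om) atoms"
    using sigma_sets_mono[of _ "space Om" atoms] unfolding sets_PiM_single space_PiM by blast
qed

definition atom_prob :: "'v \<Rightarrow> nat \<Rightarrow> (nat \<Rightarrow> 'v) \<Rightarrow> real" where
  "atom_prob x n y = (if y 0 = x then 1 else 0) * (\<Prod>i<n. p (y i) (y (Suc i)))"

text \<open>The predicate inside the definite description \<open>walk_law\<close>; existence and
  uniqueness are shown so that the description denotes the law.\<close>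

definition is_law :: "'v \<Rightarrow> (nat \<Rightarrow> 'v) measure \<Rightarrow> bool" where
  "is_law x Q \<longleftrightarrow> sets Q = sets Om \<and> prob_space Q \<and> (\<forall>n y. emeasure Q (atom n y) = ennreal (atom_prob x n y))"

lemma walk_law_eq: "walk_law V p x = (THE Q. is_law x Q)"
proof -
  have "(sets Q = sets Om \<and> prob_space Q \<and> (\<forall>n y. emeasure Q {\<omega> \<in> space Q. \<forall>i\<le>n. \<omega> i = y i} =
        ennreal ((if y 0 = x then 1 else 0) * (\<Prod>i<n. p (y i) (y (Suc i)))))) \<longleftrightarrow> is_law x Q" for Q
    unfolding is_law_def atom_def atom_prob_def by (auto dest: sets_eq_imp_space_eq)
  then show ?thesis unfolding walk_law_def by simp
qed

lemma law_unique: "is_law x Q \<Longrightarrow> is_law x Q' \<Longrightarrow> Q = Q'"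
proof (rule measure_eqI_generator_eq_countable[OF Int_stable_atoms atoms_Pow _ _ _ _ _ _,
    where A = "(\<lambda>x. atom 0 (\<lambda>_. x)) ` V"])
  assume Q: "is_law x Q" "is_law x Q'"
  show "sets Q = sigma_sets (space Om) atoms" "sets Q' = sigma_sets (space Om) atoms"
    using Q sets_Om by (auto simp: is_law_def)
  show "emeasure Q X = emeasure Q' X" if "X \<in> atoms" for X
    using that Q by (auto simp: atoms_def is_law_def)
  show "(\<lambda>x. atom 0 (\<lambda>_. x)) ` V \<subseteq> atoms" by (auto simp: atoms_def)
  show "\<Union> ((\<lambda>x. atom 0 (\<lambda>_. x)) ` V) = space Om" by (auto simp: atom_def space_Om)
  show "countable ((\<lambda>x. atom 0 (\<lambda>_. x)) ` V)" using countable_V by simp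
  interpret prob_space Q using Q by (simp add: is_law_def)
  show "emeasure Q a \<noteq> \<infinity>" for a by simp
qed

text \<open>Existence: at time \<open>i\<close> the walk sitting at \<open>z\<close> follows the coordinate \<open>(i, z)\<close> of an independent
  family of neighbour choices.\<close>

definition K :: "'v \<Rightarrow> 'v pmf" where
  "K x = (if x \<in> V then embed_pmf (p x) else return_pmf x)"

lemma pmf_K: "x \<in> V \<Longrightarrow> pmf (K x) y = p x y"
proof -
  assume x: "x \<in> V"
  have "(\<integral>\<^sup>+y. ennreal (p x y) \<partial>count_space UNIV) = (\<integral>\<^sup>+y. ennreal (p x y) \<partial>count_space (nb x))"
    by (intro nn_integral_count_space_eq) (auto simp: p_eq_0)
  also have "\<dots> = (\<Sum>y\<in>nb x. ennreal (p x y))"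
    using finite_nb[OF x] by (rule nn_integral_count_space_finite)
  also have "\<dots> = 1" using p_sum[OF x] by (simp add: sum_ennreal)
  finally have "pmf (embed_pmf (p x)) y = p x y" by (intro pmf_embed_pmf) auto
  then show ?thesis using x by (simp add: K_def)
qed

text \<open>Keeps the path in \<open>V\<close> for every family of choices and not merely almost
  surely. At vertices of \<open>V\<close> the choices are almost surely neighbours, so no
  probability changes.\<close>

definition clamp :: "'v \<Rightarrow> 'v" where "clamp y = (if y \<in> V then y else rt)"

primrec path :: "'v \<Rightarrow> (nat \<times> 'v \<Rightarrow> 'v) \<Rightarrow> nat \<Rightarrow> 'v" where
  "path x c 0 = x"
| "path x c (Suc n) = clamp (c (n, path x c n))"

abbreviation "Ch \<equiv> PiM UNIV (\<lambda>j::nat \<times> 'v. measure_pmf (K (snd j)))"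

lemma path_meas: "x \<in> V \<Longrightarrow> (\<lambda>c. path x c n) \<in> Ch \<rightarrow>\<^sub>M count_space V"
proof (induction n)
  case (Suc n)
  have "(\<lambda>c. clamp (c (n, z))) \<in> Ch \<rightarrow>\<^sub>M count_space V" for z
  proof -
    have "(\<lambda>c. c (n, z)) \<in> Ch \<rightarrow>\<^sub>M measure_pmf (K z)"
      using measurable_component_singleton[of "(n, z)" UNIV "\<lambda>j. measure_pmf (K (snd j))"] by simp
    moreover have "clamp \<in> measure_pmf (K z) \<rightarrow>\<^sub>M count_space V" by (auto simp: clamp_def)
    ultimately show ?thesis by (rule measurable_compose)
  qed
  then show ?case
    unfolding path.simps
    by (intro measurable_compose_countable'[where f = "\<lambda>z c. clamp (c (n, z))", OF _ Suc.IH[OF Suc.prems] countable_V])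
qed simp

text \<open>Following the word \<open>y\<close> consults the coordinates (i, y i) with i < n. They
  are pairwise distinct because the time is part of the index, so the product measure makes the
  choices independent.\<close>

lemma law_exists: assumes x: "x \<in> V" shows "is_law x (distr Ch Om (path x))"
proof -
  interpret P: product_prob_space "\<lambda>j::nat \<times> 'v. measure_pmf (K (snd j))" UNIV
    by unfold_locales
  have m: "path x \<in> Ch \<rightarrow>\<^sub>M Om"
  proof (rule measurable_PiM_single')
    show "path x \<in> space Ch \<rightarrow> (\<Pi>\<^sub>E i\<in>UNIV. space (count_space V))"
      using measurable_space[OF path_meas[OF x]] by (auto simp: PiE_UNIV_domain)
  qed (use path_meas[OF x] in simp)
  have "emeasure (distr Ch Om (path x)) (atom n y) = ennreal (atom_prob x n y)" for n y
  proof (cases "y 0 = x \<and> (\<forall>i\<le>n. y i \<in> V)")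
    case True
    define J where "J = (\<lambda>i. (i, y i)) ` {..<n}"
    define X where "X j = {w. clamp w = y (Suc (fst j))}" for j :: "nat \<times> 'v"
    have "(\<forall>i\<le>n. path x c i = y i) \<longleftrightarrow> (\<forall>i<n. clamp (c (i, y i)) = y (Suc i))" for c
    proof
      assume a: "\<forall>i\<le>n. path x c i = y i"
      show "\<forall>i<n. clamp (c (i, y i)) = y (Suc i)"
      proof (intro allI impI)
        fix i assume "i < n"
        then show "clamp (c (i, y i)) = y (Suc i)" using a[rule_format, of "Suc i"] a[rule_format, of i] by simp
      qed
    next
      assume a: "\<forall>i<n. clamp (c (i, y i)) = y (Suc i)"
      have "i \<le> n \<longrightarrow> path x c i = y i" for i by (induction i) (use a True in auto)
      then show "\<forall>i\<le>n. path x c i = y i" by blast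
    qed
    then have "path x -` atom n y \<inter> space Ch = prod_emb UNIV (\<lambda>j::nat \<times> 'v. measure_pmf (K (snd j))) J (Pi\<^sub>E J X)"
      using measurable_space[OF m]
      by (auto simp: atom_def prod_emb_def space_PiM J_def X_def PiE_iff restrict_def)
    then have "emeasure (distr Ch Om (path x)) (atom n y) = emeasure Ch (prod_emb UNIV (\<lambda>j::nat \<times> 'v. measure_pmf (K (snd j))) J (Pi\<^sub>E J X))"
      by (simp add: emeasure_distr[OF m])
    also have "\<dots> = (\<Prod>j\<in>J. emeasure (measure_pmf (K (snd j))) (X j))"
      by (rule P.emeasure_PiM_emb) (auto simp: J_def)
    also have "\<dots> = (\<Prod>i<n. emeasure (measure_pmf (K (y i))) (X (i, y i)))"
      unfolding J_def by (subst prod.reindex) (auto simp: inj_on_def)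
    also have "\<dots> = (\<Prod>i<n. ennreal (p (y i) (y (Suc i))))"
    proof (intro prod.cong refl)
      fix i assume "i \<in> {..<n}"
      then have i: "y i \<in> V" "y (Suc i) \<in> V" using True by auto
      have "emeasure (measure_pmf (K (y i))) (X (i, y i)) = emeasure (measure_pmf (K (y i))) {y (Suc i)}"
      proof (rule emeasure_eq_AE)
        have "w \<in> V" if "w \<in> set_pmf (K (y i))" for w
          using that p_eq_0 nb_V pmf_K[OF i(1)] unfolding set_pmf_iff by metis
        then show "AE w in measure_pmf (K (y i)). w \<in> X (i, y i) \<longleftrightarrow> w \<in> {y (Suc i)}"
          by (auto simp: AE_measure_pmf_iff X_def clamp_def)
      qed auto
      then show "emeasure (measure_pmf (K (y i))) (X (i, y i)) = ennreal (p (y i) (y (Suc i)))"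
        by (simp add: emeasure_pmf_single pmf_K[OF i(1)])
    qed
    also have "\<dots> = ennreal (atom_prob x n y)" using True by (simp add: atom_prob_def prod_ennreal)
    finally show ?thesis .
  next
    case False
    have "path x c \<notin> atom n y" if "c \<in> space Ch" for c
    proof
      assume a: "path x c \<in> atom n y"
      then have e: "path x c i = y i" if "i \<le> n" for i using that by (auto simp: atom_def)
      have "path x c i \<in> V" for i using a by (auto simp: atom_def space_Om)
      moreover obtain i where "i \<le> n" "y i \<notin> V" using False e[of 0] by auto
      ultimately show False using e[of i] by metis
    qed
    then have "path x -` atom n y \<inter> space Ch = {}" by auto
    then have "emeasure (distr Ch Om (path x)) (atom n y) = 0" by (simp add: emeasure_distr[OF m])
    moreover have "atom_prob x n y = 0"
    proof (cases "y 0 = x")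
      case True
      then have ex: "\<exists>i. i \<le> n \<and> y i \<notin> V" using False by blast
      \<comment> \<open>A position after the start where the word leaves \<open>V\<close>; the step
        into it has probability 0.\<close>
      define i where "i = (LEAST i. i \<le> n \<and> y i \<notin> V)"
      have i: "i \<le> n" "y i \<notin> V" using LeastI_ex[OF ex] by (auto simp: i_def)
      then have "i \<noteq> 0" using True x by (metis)
      then have "p (y (i - 1)) (y (Suc (i - 1))) = 0" using i nb_V p_eq_0 by auto
      then have "(\<Prod>i<n. p (y i) (y (Suc i))) = 0" using i \<open>i \<noteq> 0\<close> by (intro prod_zero) (auto intro!: bexI[of _ "i - 1"])
      then show ?thesis by (simp add: atom_prob_def)
    qed (simp add: atom_prob_def)
    ultimately show ?thesis by simp
  qed
  then show ?thesis unfolding is_law_def using P.prob_space_distr[OF m] by simp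
qed

section \<open>The law of the walk and its Markov property\<close>

definition Q :: "'v \<Rightarrow> (nat \<Rightarrow> 'v) measure" where "Q x = walk_law V p x"

lemma law_Q: "x \<in> V \<Longrightarrow> is_law x (Q x)"
  unfolding Q_def walk_law_eq by (rule theI) (auto intro: law_exists law_unique)

lemma sets_Q [measurable_cong]: "x \<in> V \<Longrightarrow> sets (Q x) = sets Om" using law_Q by (simp add: is_law_def)
lemma space_Q: "x \<in> V \<Longrightarrow> space (Q x) = space Om" using sets_Q sets_eq_imp_space_eq by blast
lemma prob_Q: "x \<in> V \<Longrightarrow> prob_space (Q x)" using law_Q by (simp add: is_law_def)

lemma measure_atom: "x \<in> V \<Longrightarrow> measure (Q x) (atom n y) = atom_prob x n y"
proof -
  have "0 \<le> atom_prob x n y" by (auto simp: atom_prob_def intro!: prod_nonneg)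
  moreover assume "x \<in> V"
  ultimately show ?thesis using law_Q by (simp add: is_law_def measure_def)
qed

lemma meas_cons: "x \<in> V \<Longrightarrow> case_nat x \<in> Om \<rightarrow>\<^sub>M Om"
proof (rule measurable_PiM_single')
  assume x: "x \<in> V"
  show "(\<lambda>\<omega>. case_nat x \<omega> i) \<in> Om \<rightarrow>\<^sub>M count_space V" for i
    using x meas_coord by (cases i) auto
  show "case_nat x \<in> space Om \<rightarrow> (\<Pi>\<^sub>E i\<in>UNIV. space (count_space V))"
    using x by (auto simp: space_Om PiE_UNIV_domain split: nat.split)
qed

lemma cons_sets: "x \<in> V \<Longrightarrow> A \<in> sets Om \<Longrightarrow> {\<omega>\<in>space Om. case_nat x \<omega> \<in> A} \<in> sets Om"
  using measurable_sets[OF meas_cons, of x A] by (simp add: vimage_def Collect_conj_eq Int_commute)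

text \<open>Both sides are compatible with complements and countable disjoint unions of A, so atoms
  suffice, and there the first factor of the product splits off. \<open>case_nat x\<close> puts
  \<open>x\<close> in front of a trajectory started at a neighbour.\<close>

lemma markov:
  assumes x: "x \<in> V" and A: "A \<in> sets Om"
  shows "measure (Q x) A = (\<Sum>y\<in>nb x. p x y * measure (Q y) {\<omega>\<in>space Om. case_nat x \<omega> \<in> A})"
proof -
  interpret X: prob_space "Q x" using prob_Q x by blast
  let ?c = "\<lambda>A. {\<omega>\<in>space Om. case_nat x \<omega> \<in> A}"
  have "A \<in> sigma_sets (space Om) atoms" using A sets_Om by simp
  with atoms_Pow show ?thesis
  proof (induction rule: sigma_sets_induct_disjoint[OF Int_stable_atoms, consumes 2, case_names basic empty compl union])
    case (basic A)
    show ?case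
    proof (cases "A = {}")
      case False
      then obtain n z where A: "A = atom n z" using basic by (auto simp: atoms_def)
      show ?thesis
      proof (cases "z 0 = x")
        case True
        show ?thesis
        proof (cases n)
          case 0
          have "?c A = space Om" using x True by (auto simp: A 0 atom_def space_Om split: nat.split)
          then have "measure (Q y) (?c A) = 1" if "y \<in> nb x" for y
            using prob_space.prob_space[OF prob_Q[OF nb_V[OF that]]] space_Q[OF nb_V[OF that]] by simp
          then have "(\<Sum>y\<in>nb x. p x y * measure (Q y) (?c A)) = 1" using p_sum[OF x] by simp
          then show ?thesis by (simp add: A measure_atom x atom_prob_def 0 True)
        next
          case (Suc m)
          have "?c A = atom m (\<lambda>i. z (Suc i))"
          proof (intro set_eqI iffI)
            fix \<omega> assume "\<omega> \<in> ?c A"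
            then have w: "\<omega> \<in> space Om" "\<And>i. i \<le> n \<Longrightarrow> case_nat x \<omega> i = z i" by (auto simp: A atom_def)
            show "\<omega> \<in> atom m (\<lambda>i. z (Suc i))" using w(1) w(2)[of "Suc _"] by (auto simp: atom_def Suc)
          next
            fix \<omega> assume "\<omega> \<in> atom m (\<lambda>i. z (Suc i))"
            then show "\<omega> \<in> ?c A" using x True by (auto simp: atom_def space_Om A Suc split: nat.split)
          qed
          then have "(\<Sum>y\<in>nb x. p x y * measure (Q y) (?c A)) = (\<Sum>y\<in>nb x. p x y * atom_prob y m (\<lambda>i. z (Suc i)))"
            by (intro sum.cong refl) (simp add: measure_atom nb_V)
          also have "\<dots> = (\<Sum>y\<in>nb x. if y = z (Suc 0) then p x y * (\<Prod>i<m. p (z (Suc i)) (z (Suc (Suc i)))) else 0)"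
            by (intro sum.cong) (auto simp: atom_prob_def)
          also have "\<dots> = p x (z (Suc 0)) * (\<Prod>i<m. p (z (Suc i)) (z (Suc (Suc i))))"
            using finite_nb[OF x] p_eq_0[of "z (Suc 0)" x] by (simp add: sum.delta)
          also have "\<dots> = atom_prob x n z"
            using True by (simp add: atom_prob_def Suc prod.lessThan_Suc_shift del: prod.lessThan_Suc)
          finally show ?thesis by (simp add: A measure_atom x)
        qed
      next
        case False
        then have e: "?c A = {}" by (auto simp: A atom_def intro!: exI[of _ 0])
        show ?thesis unfolding e using False by (simp add: A measure_atom x atom_prob_def)
      qed
    qed simp
  next
    case empty
    then show ?case by simp
  next
    case (compl A)
    then have A: "A \<in> sets Om" by (simp add: sets_Om)
    have "measure (Q y) (?c (space Om - A)) = 1 - measure (Q y) (?c A)" if "y \<in> nb x" for y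
    proof -
      interpret Y: prob_space "Q y" using prob_Q nb_V that by blast
      have "?c (space Om - A) = space (Q y) - ?c A"
        using measurable_space[OF meas_cons[OF x]] space_Q[OF nb_V[OF that]] by auto
      then show ?thesis using Y.prob_compl[of "?c A"] cons_sets[OF x A] sets_Q[OF nb_V[OF that]] by simp
    qed
    then have "(\<Sum>y\<in>nb x. p x y * measure (Q y) (?c (space Om - A))) = (\<Sum>y\<in>nb x. p x y - p x y * measure (Q y) (?c A))"
      by (intro sum.cong) (auto simp: right_diff_distrib)
    also have "\<dots> = 1 - measure (Q x) A" using compl p_sum[OF x] by (simp add: sum_subtractf)
    also have "\<dots> = measure (Q x) (space Om - A)" using X.prob_compl[of A] A sets_Q[OF x] space_Q[OF x] by simp
    finally show ?case by simp
  next
    case (union F)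
    have F: "F i \<in> sets Om" for i using union(2) rangeI[of F i] unfolding sets_Om by blast
    have "(\<lambda>i. measure (Q y) (?c (F i))) sums measure (Q y) (?c (\<Union>i. F i))" if "y \<in> nb x" for y
    proof -
      interpret Y: prob_space "Q y" using prob_Q nb_V that by blast
      have "(\<lambda>i. measure (Q y) (?c (F i))) sums measure (Q y) (\<Union>i. ?c (F i))"
      proof (rule Y.finite_measure_UNION)
        show "range (\<lambda>i. ?c (F i)) \<subseteq> sets (Q y)" using F cons_sets[OF x] sets_Q[OF nb_V[OF that]] by auto
        show "disjoint_family (\<lambda>i. ?c (F i))" using union(1) unfolding disjoint_family_on_def by blast
      qed
      moreover have "(\<Union>i. ?c (F i)) = ?c (\<Union>i. F i)" by auto
      ultimately show ?thesis by simp
    qed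
    then have "(\<lambda>i. \<Sum>y\<in>nb x. p x y * measure (Q y) (?c (F i))) sums (\<Sum>y\<in>nb x. p x y * measure (Q y) (?c (\<Union>i. F i)))"
      by (intro sums_sum sums_mult)
    moreover have "(\<lambda>i. measure (Q x) (F i)) sums measure (Q x) (\<Union>i. F i)"
      using F sets_Q[OF x] union(1) by (intro X.finite_measure_UNION) auto
    ultimately show ?case using union(3) by (metis (no_types, lifting) sums_unique2 sums_cong)
  qed
qed

lemma law_start: "x \<in> V \<Longrightarrow> measure (Q x) {\<omega>\<in>space Om. P (\<omega> 0)} = (if P x then 1 else 0)"
proof -
  assume x: "x \<in> V"
  interpret X: prob_space "Q x" using prob_Q x by blast
  have "X.prob (atom 0 (\<lambda>_. x)) = 1" using x by (simp add: measure_atom atom_prob_def)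
  then have "AE \<omega> in Q x. \<omega> \<in> atom 0 (\<lambda>_. x)"
    using sets_Q[OF x] by (subst X.prob_eq_1[symmetric]) auto
  then have "AE \<omega> in Q x. P (\<omega> 0) = P x" by eventually_elim (auto simp: atom_def)
  then have "X.prob {\<omega>\<in>space Om. P (\<omega> 0)} = X.prob (if P x then space (Q x) else {})"
    using sets_Q[OF x] space_Q[OF x] coord_sets[of 0 "{y. P y}"]
    by (intro X.finite_measure_eq_AE) auto
  then show ?thesis using X.prob_space by simp
qed

lemma measure_trans_n: "x \<in> V \<Longrightarrow> measure (Q x) {\<omega>\<in>space Om. \<omega> n = y} = trans_n V rt up p n x y"
proof (induction n arbitrary: x)
  case 0
  then show ?case using law_start[of x "\<lambda>z. z = y"] by auto
next
  case (Suc n)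
  have "{\<omega>\<in>space Om. case_nat x \<omega> \<in> {\<omega>\<in>space Om. \<omega> (Suc n) = y}} = {\<omega>\<in>space Om. \<omega> n = y}"
    using measurable_space[OF meas_cons[OF Suc.prems]] by auto
  then show ?case using Suc.IH nb_V
    by (subst markov[OF Suc.prems]) (auto intro!: sum.cong)
qed

lemma step_nb: "x \<in> V \<Longrightarrow> measure (Q x) {\<omega>\<in>space Om. \<omega> (Suc n) \<notin> nb (\<omega> n)} = 0"
proof (induction n arbitrary: x)
  case 0
  have "{\<omega>\<in>space Om. case_nat x \<omega> \<in> {\<omega>\<in>space Om. \<omega> (Suc 0) \<notin> nb (\<omega> 0)}} = {\<omega>\<in>space Om. \<omega> 0 \<notin> nb x}"
    using measurable_space[OF meas_cons[OF 0]] by auto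
  then show ?case using law_start[of _ "\<lambda>z. z \<notin> nb x"] nb_V
    by (subst markov[OF 0]) (auto intro!: sum.neutral)
next
  case (Suc n)
  have "{\<omega>\<in>space Om. case_nat x \<omega> \<in> {\<omega>\<in>space Om. \<omega> (Suc (Suc n)) \<notin> nb (\<omega> (Suc n))}} = {\<omega>\<in>space Om. \<omega> (Suc n) \<notin> nb (\<omega> n)}"
    using measurable_space[OF meas_cons[OF Suc.prems]] by auto
  then show ?case using Suc.IH nb_V
    by (subst markov[OF Suc.prems]) (auto intro!: sum.neutral)
qed

lemma AE_nb: "x \<in> V \<Longrightarrow> AE \<omega> in Q x. \<forall>n. \<omega> (Suc n) \<in> nb (\<omega> n)"
proof -
  assume x: "x \<in> V"
  interpret X: prob_space "Q x" using prob_Q x by blast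
  have "AE \<omega> in Q x. \<omega> (Suc n) \<in> nb (\<omega> n)" for n
  proof -
    have s: "{\<omega>\<in>space Om. \<omega> (Suc n) \<notin> nb (\<omega> n)} \<in> sets Om" by measurable
    have "{\<omega>\<in>space Om. \<omega> (Suc n) \<notin> nb (\<omega> n)} \<in> null_sets (Q x)"
      using step_nb[OF x, of n] s sets_Q[OF x] by (auto simp: null_sets_def X.emeasure_eq_measure)
    then have "AE \<omega> in Q x. \<omega> \<notin> {\<omega>\<in>space Om. \<omega> (Suc n) \<notin> nb (\<omega> n)}" by (rule AE_not_in)
    then show ?thesis using AE_space by eventually_elim (auto simp: space_Q[OF x])
  qed
  then show ?thesis by (simp add: AE_all_countable)
qed

end

section \<open>Convergence to the boundary\<close>

context rtree
begin

section \<open>Cones and the edges that leave them\<close>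

lemma T_iff: "x \<in> V \<Longrightarrow> y \<in> T x \<longleftrightarrow> y \<in> V \<and> dep x \<le> dep y \<and> (up ^^ (dep y - dep x)) y = x"
proof -
  assume x: "x \<in> V"
  have "k = dep y - dep x \<and> dep x \<le> dep y" if "y \<in> V" "k \<le> dep y" "(up ^^ k) y = x" for k
    using funpow_V[OF that(1,2)] that by auto
  then show ?thesis using x by (auto simp: subtree_def intro: diff_le_self)
qed

lemma T_V: "y \<in> T x \<Longrightarrow> y \<in> V" by (simp add: subtree_def)
lemma T_self: "x \<in> V \<Longrightarrow> x \<in> T x" by (auto simp: T_iff)
lemma T_rt: "T rt = V" by (auto simp: T_iff funpow_dep)
lemma T_dep: "y \<in> T x \<Longrightarrow> x \<in> V \<Longrightarrow> dep x \<le> dep y" by (simp add: T_iff)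

text \<open>The recursive description of cones, which serves the inductions over depth.\<close>

lemma T_up: assumes "x \<in> V" "y \<in> V" shows "y \<in> T x \<longleftrightarrow> y = x \<or> (y \<noteq> rt \<and> up y \<in> T x)"
proof
  assume y: "y \<in> T x"
  show "y = x \<or> (y \<noteq> rt \<and> up y \<in> T x)"
  proof (cases "dep x = dep y")
    case True
    then show ?thesis using y assms by (simp add: T_iff)
  next
    case False
    then have lt: "dep x < dep y" using y assms by (simp add: T_iff)
    then have r: "y \<noteq> rt" by auto
    note d = dep_Suc[OF assms(2) r]
    have "dep y - dep x = Suc (dep (up y) - dep x)" using lt d by simp
    then have "(up ^^ (dep (up y) - dep x)) (up y) = x" using y assms
      by (simp add: T_iff funpow_swap1)
    then show ?thesis using r lt d up_V[OF assms(2) r] assms by (simp add: T_iff)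
  qed
next
  assume "y = x \<or> (y \<noteq> rt \<and> up y \<in> T x)"
  then show "y \<in> T x"
  proof
    assume y: "y \<noteq> rt \<and> up y \<in> T x"
    then have d: "dep y = Suc (dep (up y))" using dep_Suc assms by blast
    have "dep x \<le> dep (up y)" using y assms by (simp add: T_iff)
    then have "dep y - dep x = Suc (dep (up y) - dep x)" using d by simp
    then show ?thesis using y d assms by (simp add: T_iff funpow_swap1)
  qed (use assms T_self in simp)
qed

lemma T_trans: assumes "x \<in> V" "y \<in> T x" "z \<in> T y" shows "z \<in> T x"
proof -
  have y: "y \<in> V" using assms T_V by blast
  have "z \<in> V \<Longrightarrow> z \<in> T y \<Longrightarrow> z \<in> T x" for z
  proof (induction "dep z" arbitrary: z)
    case 0
    then have "z = y" using T_up[OF y, of z] dep_0_iff by auto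
    then show ?case using assms by simp
  next
    case (Suc n)
    show ?case
    proof (cases "z = y")
      case False
      then have "z \<noteq> rt" "up z \<in> T y" using Suc.prems T_up[OF y] by auto
      then show ?thesis using Suc.hyps dep_Suc[OF Suc.prems(1)] up_V[OF Suc.prems(1)] T_up[OF assms(1) Suc.prems(1)] by simp
    qed (use assms in simp)
  qed
  then show ?thesis using assms T_V by blast
qed

lemma T_same_dep: "x \<in> V \<Longrightarrow> y \<in> V \<Longrightarrow> dep x = dep y \<Longrightarrow> z \<in> T x \<Longrightarrow> z \<in> T y \<Longrightarrow> x = y"
  by (simp add: T_iff)

lemma T_ch: assumes "x \<in> V" "y \<in> T x" "y \<noteq> x" shows "\<exists>c\<in>ch x. y \<in> T c"
proof -
  have yV: "y \<in> V" using assms T_V by blast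
  have "dep y \<ge> dep x" "dep y \<noteq> dep x" using assms by (auto simp: T_iff)
  then have lt: "dep x < dep y" by simp
  let ?c = "(up ^^ (dep y - Suc (dep x))) y"
  have c: "?c \<in> V" "dep ?c = Suc (dep x)" using funpow_V[OF yV, of "dep y - Suc (dep x)"] lt by auto
  have "up ?c = (up ^^ (dep y - dep x)) y" using lt by (metis Suc_diff_Suc comp_apply funpow.simps(2))
  then have "up ?c = x" using assms by (simp add: T_iff)
  moreover have "?c \<noteq> rt" using c by auto
  moreover have "y \<in> T ?c" using c yV lt by (subst T_iff) auto
  ultimately show ?thesis using c by (auto simp: ch_iff)
qed

lemma T_comparable: assumes "x \<in> V" "y \<in> V" "z \<in> T x" "z \<in> T y" "dep x \<le> dep y" shows "y \<in> T x"
proof -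
  have "(up ^^ (dep y - dep x)) y = (up ^^ (dep y - dep x)) ((up ^^ (dep z - dep y)) z)"
    using assms by (simp add: T_iff)
  also have "\<dots> = (up ^^ ((dep y - dep x) + (dep z - dep y))) z" by (simp add: funpow_add)
  also have "(dep y - dep x) + (dep z - dep y) = dep z - dep x" using assms by (simp add: T_iff)
  finally show ?thesis using assms by (simp add: T_iff)
qed

lemma Cyl_T: "x \<in> V \<Longrightarrow> y \<in> T x \<Longrightarrow> Cyl y \<subseteq> Cyl x"
proof
  fix \<xi> assume a: "x \<in> V" "y \<in> T x" "\<xi> \<in> Cyl y"
  then have "\<xi> \<in> Ends" "\<xi> (dep y) = y" by (auto simp: Cyl_iff)
  moreover have "dep x \<le> dep y" "(up ^^ (dep y - dep x)) y = x" using a by (simp_all add: T_iff)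
  ultimately have "\<xi> (dep x) = x" using ends_funpow[of \<xi> "dep y - dep x" "dep y"] by (metis diff_diff_cancel diff_le_self)
  then show "\<xi> \<in> Cyl x" using \<open>\<xi> \<in> Ends\<close> by (simp add: Cyl_iff)
qed

lemma Cyl_T_disjoint: assumes "x \<in> V" "y \<in> V" "y \<notin> T x" "x \<notin> T y" shows "Cyl x \<inter> Cyl y = {}"
proof (rule ccontr)
  assume "Cyl x \<inter> Cyl y \<noteq> {}"
  then obtain \<xi> where xi: "\<xi> \<in> Ends" "\<xi> (dep x) = x" "\<xi> (dep y) = y" by (auto simp: Cyl_iff)
  have "x \<in> T y \<or> y \<in> T x"
    using ends_funpow[OF xi(1), of "dep x - dep y" "dep x"] ends_funpow[OF xi(1), of "dep y - dep x" "dep y"] xi assms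
    by (cases "dep x \<le> dep y") (auto simp: T_iff)
  then show False using assms by blast
qed

text \<open>In a tree only the edge from \<open>x\<close> to its predecessor joins the cone to its
  complement. This forces walks out of the cone through x^- and walks into it through
  \<open>x\<close>.\<close>

lemma nb_leave_T: assumes "x \<in> V" "y \<in> T x" "z \<in> nb y" "z \<notin> T x" shows "y = x" "x \<noteq> rt" "z = up x"
proof -
  have V: "y \<in> V" "z \<in> V" using assms T_V nb_V by auto
  have "z \<notin> ch y" using assms T_up[OF assms(1) V(2)] by (auto simp: ch_iff)
  then have z: "y \<noteq> rt" "z = up y" using assms nb_eq[OF V(1)] by (auto split: if_splits)
  show "y = x" using z assms T_up[OF assms(1) V(1)] by auto
  then show "x \<noteq> rt" "z = up x" using z by auto
qed

lemma nb_enter_T: "x \<in> V \<Longrightarrow> y \<in> V \<Longrightarrow> y \<notin> T x \<Longrightarrow> z \<in> nb y \<Longrightarrow> z \<in> T x \<Longrightarrow> z = x"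
  using nb_leave_T[of x z y] nb_sym by blast

section \<open>Trajectories that converge to an end\<close>

definition ev_in :: "'v \<Rightarrow> (nat \<Rightarrow> 'v) \<Rightarrow> bool" where "ev_in y \<omega> \<longleftrightarrow> (\<exists>N. \<forall>n\<ge>N. \<omega> n \<in> T y)"

lemma converges_iff: "converges_to_end V rt up \<omega> \<xi> \<longleftrightarrow> \<xi> \<in> Ends \<and> (\<forall>n. ev_in (\<xi> n) \<omega>)"
  by (simp add: converges_to_end_def ev_in_def eventually_sequentially)

lemma ev_in_mono: "x \<in> V \<Longrightarrow> y \<in> T x \<Longrightarrow> ev_in y \<omega> \<Longrightarrow> ev_in x \<omega>"
  unfolding ev_in_def using T_trans by blast

lemma ev_in_disjoint: "x \<in> V \<Longrightarrow> y \<in> V \<Longrightarrow> dep x = dep y \<Longrightarrow> ev_in x \<omega> \<Longrightarrow> ev_in y \<omega> \<Longrightarrow> x = y"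
  unfolding ev_in_def using T_same_dep by (metis nat_le_linear)

text \<open>Convergence without naming the limit: countably many conditions on cones, hence a
  measurable event.\<close>

definition to_end :: "(nat \<Rightarrow> 'v) \<Rightarrow> bool" where "to_end \<omega> \<longleftrightarrow> (\<forall>n. \<exists>y\<in>level n. ev_in y \<omega>)"

text \<open>At each level at most one cone contains the trajectory eventually, so the chosen
  vertices are successive and form the limit ray.\<close>

lemma to_end_iff: "to_end \<omega> \<longleftrightarrow> (\<exists>\<xi>. converges_to_end V rt up \<omega> \<xi>)"
proof
  assume a: "to_end \<omega>"
  define \<xi> where "\<xi> n = (SOME y. y \<in> level n \<and> ev_in y \<omega>)" for n
  have xi: "\<xi> n \<in> level n \<and> ev_in (\<xi> n) \<omega>" for n
  proof -
    have "\<exists>y. y \<in> level n \<and> ev_in y \<omega>" using a unfolding to_end_def by blast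
    then show ?thesis unfolding \<xi>_def by (rule someI_ex)
  qed
  have "\<xi> 0 = rt" using xi[of 0] by (simp add: level_0)
  moreover have "\<xi> (Suc n) \<in> V \<and> \<xi> (Suc n) \<noteq> rt \<and> up (\<xi> (Suc n)) = \<xi> n" for n
  proof -
    have V: "\<xi> (Suc n) \<in> V" "dep (\<xi> (Suc n)) = Suc n" using xi[of "Suc n"] levelD by auto
    then have r: "\<xi> (Suc n) \<noteq> rt" by (metis dep_rt nat.distinct(1))
    have u: "up (\<xi> (Suc n)) \<in> V" "dep (up (\<xi> (Suc n))) = n" using up_V[OF V(1) r] dep_Suc[OF V(1) r] V by auto
    have "\<xi> (Suc n) \<in> T (up (\<xi> (Suc n)))" using T_up[OF u(1) V(1)] r T_self u by blast
    then have "ev_in (up (\<xi> (Suc n))) \<omega>" using ev_in_mono u xi by blast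
    then have "up (\<xi> (Suc n)) = \<xi> n" using ev_in_disjoint[OF u(1)] xi[of n] u levelD by metis
    then show ?thesis using V r by blast
  qed
  ultimately have "\<xi> \<in> Ends" by (auto simp: ends_def)
  then show "\<exists>\<xi>. converges_to_end V rt up \<omega> \<xi>" using xi by (auto simp: converges_iff)
next
  assume "\<exists>\<xi>. converges_to_end V rt up \<omega> \<xi>"
  then show "to_end \<omega>" using ends_level unfolding converges_iff to_end_def by blast
qed

lemma converges_unique: "converges_to_end V rt up \<omega> \<xi> \<Longrightarrow> converges_to_end V rt up \<omega> \<eta> \<Longrightarrow> \<xi> = \<eta>"
  unfolding converges_iff using ev_in_disjoint ends_V ends_dep by (intro ext) metis

lemma limit_end_converges: "to_end \<omega> \<Longrightarrow> converges_to_end V rt up \<omega> (limit_end V rt up \<omega>)"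
  unfolding limit_end_def using to_end_iff converges_unique theI'[of "converges_to_end V rt up \<omega>"] by auto

lemma Ends_nonempty: "Ends \<noteq> {}" using Cyl_nonempty[OF rt_V] by (simp add: Cyl_rt)

lemma limit_end_Ends: "limit_end V rt up \<omega> \<in> Ends"
proof (cases "to_end \<omega>")
  case True
  then show ?thesis using limit_end_converges by (auto simp: converges_iff)
next
  case False
  then show ?thesis using some_in_eq[of Ends] Ends_nonempty to_end_iff by (auto simp: limit_end_def)
qed

lemma limit_end_Cyl: "to_end \<omega> \<Longrightarrow> y \<in> V \<Longrightarrow> limit_end V rt up \<omega> \<in> Cyl y \<longleftrightarrow> ev_in y \<omega>"
  using limit_end_converges[of \<omega>] ev_in_disjoint[of y] ends_V ends_dep limit_end_Ends[of \<omega>]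
  unfolding converges_iff Cyl_iff by metis

text \<open>After its last visit to \<open>x\<close> the trajectory cannot cross the boundary of the
  cone of \<open>x\<close>, so it ends up inside or outside. Inside and away from \<open>x\<close>
  it lies in one of finitely many child cones, one of which therefore retains it.\<close>

lemma path_to_end:
  assumes V: "\<And>n. \<omega> n \<in> V" and nbs: "\<And>n. \<omega> (Suc n) \<in> nb (\<omega> n)" and tr: "\<And>y. y \<in> V \<Longrightarrow> \<exists>N. \<forall>n\<ge>N. \<omega> n \<noteq> y"
  shows "to_end \<omega>"
  unfolding to_end_def
proof
  have dich: "ev_in x \<omega> \<or> (\<exists>N. \<forall>n\<ge>N. \<omega> n \<notin> T x)" if x: "x \<in> V" for x
  proof -
    obtain N where N: "\<And>n. n \<ge> N \<Longrightarrow> \<omega> n \<noteq> x" using tr[OF x] by blast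
    have "\<omega> (N + k) \<in> T x \<longleftrightarrow> \<omega> N \<in> T x" for k
    proof (induction k)
      case (Suc k)
      have "\<omega> (N + Suc k) \<in> T x \<longleftrightarrow> \<omega> (N + k) \<in> T x"
        using nb_leave_T(1)[OF x, of "\<omega> (N + k)" "\<omega> (N + Suc k)"] nb_enter_T[OF x V, of "N + k" "\<omega> (N + Suc k)"]
          N[of "N + k"] N[of "N + Suc k"] nbs[of "N + k"] by auto
      then show ?case using Suc by simp
    qed simp
    then have "\<forall>n\<ge>N. \<omega> n \<in> T x \<longleftrightarrow> \<omega> N \<in> T x" by (metis le_Suc_ex)
    then show ?thesis unfolding ev_in_def by blast
  qed
  show "\<exists>y\<in>level n. ev_in y \<omega>" for n
  proof (induction n)
    case 0
    show ?case using V by (auto simp: level_0 ev_in_def T_rt)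
  next
    case (Suc n)
    then obtain x where x: "x \<in> level n" "ev_in x \<omega>" by blast
    then have xV: "x \<in> V" using levelD by blast
    show ?case
    proof (rule ccontr)
      assume "\<not> ?case"
      then have "\<forall>c\<in>ch x. \<not> ev_in c \<omega>" using x by (auto simp: level_Suc)
      then have "\<forall>c\<in>ch x. \<exists>N. \<forall>n\<ge>N. \<omega> n \<notin> T c" using dich ch_V by blast
      then have "\<forall>c\<in>ch x. \<forall>\<^sub>F n in sequentially. \<omega> n \<notin> T c" by (simp add: eventually_sequentially)
      then have "\<forall>\<^sub>F n in sequentially. \<forall>c\<in>ch x. \<omega> n \<notin> T c" using finite_ch by (simp add: eventually_ball_finite)
      moreover have "\<forall>\<^sub>F n in sequentially. \<omega> n \<noteq> x" using tr[OF xV] by (simp add: eventually_sequentially)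
      moreover have "\<forall>\<^sub>F n in sequentially. \<omega> n \<in> T x" using x by (simp add: ev_in_def eventually_sequentially)
      ultimately have "\<forall>\<^sub>F n in sequentially. False" by eventually_elim (use T_ch[OF xV] in blast)
      then show False by simp
    qed
  qed
qed

end

section \<open>Limit distributions and first passages\<close>

locale transient_walk = walk V rt up p
  for V :: "'v set" and rt up p +
  assumes tr: "transient V rt up p"
begin

definition ev :: "'v \<Rightarrow> (nat \<Rightarrow> 'v) set" where "ev y = {\<omega>\<in>space Om. ev_in y \<omega>}"

lemma meas_ev_in [measurable]: "Measurable.pred Om (ev_in y)"
  unfolding ev_in_def by measurable

lemma ev_sets [simp]: "ev y \<in> sets Om" unfolding ev_def by measurable

lemma meas_to_end [measurable]: "Measurable.pred Om to_end"
proof -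
  have "Measurable.pred Om (\<lambda>\<omega>. \<exists>y\<in>level n. ev_in y \<omega>)" for n
    using finite_level[of n] by measurable
  then show ?thesis unfolding to_end_def by measurable
qed

text \<open>On non-convergent trajectories the default end turns membership in a cylinder into a
  constant condition, so the case distinction is measurable.\<close>

lemma meas_limit_end: "limit_end V rt up \<in> Om \<rightarrow>\<^sub>M BE"
proof (rule measurable_sigma_sets[OF sets_BE_Cyl])
  show "insert {} (Cyl ` V) \<subseteq> Pow Ends" using Cyl_sub by auto
  show "limit_end V rt up \<in> space Om \<rightarrow> Ends" using limit_end_Ends by auto
  fix A assume "A \<in> insert {} (Cyl ` V)"
  then consider "A = {}" | y where "y \<in> V" "A = Cyl y" by blast
  then show "limit_end V rt up -` A \<inter> space Om \<in> sets Om"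
  proof cases
    case 2
    have "limit_end V rt up \<omega> \<in> Cyl y \<longleftrightarrow> (if to_end \<omega> then ev_in y \<omega> else (SOME \<xi>. \<xi> \<in> Ends) \<in> Cyl y)" for \<omega>
    proof (cases "to_end \<omega>")
      case False
      then show ?thesis by (simp add: limit_end_def to_end_iff)
    qed (simp add: limit_end_Cyl 2)
    then have "limit_end V rt up -` A \<inter> space Om = {\<omega>\<in>space Om. if to_end \<omega> then ev_in y \<omega> else (SOME \<xi>. \<xi> \<in> Ends) \<in> Cyl y}"
      using 2 by blast
    also have "\<dots> \<in> sets Om" by measurable
    finally show ?thesis .
  qed simp
qed

text \<open>Transience makes the probabilities of being at a given vertex summable in time; by
  Borel-Cantelli each vertex is almost surely left for good.\<close>

lemma AE_to_end: assumes x: "x \<in> V" shows "AE \<omega> in Q x. to_end \<omega>"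
proof -
  interpret X: prob_space "Q x" using prob_Q x by blast
  have "AE \<omega> in Q x. \<exists>N. \<forall>n\<ge>N. \<omega> n \<noteq> y" if y: "y \<in> V" for y
  proof -
    have s: "{\<omega>\<in>space Om. \<omega> n = y} \<in> sets (Q x)" for n using coord_sets[of n "{y}"] sets_Q[OF x] by simp
    have "summable (\<lambda>n. X.prob {\<omega>\<in>space Om. \<omega> n = y})"
      using tr x y by (simp add: measure_trans_n transient_def)
    then have "AE \<omega> in Q x. \<forall>\<^sub>F n in sequentially. \<omega> \<in> space (Q x) - {\<omega>\<in>space Om. \<omega> n = y}"
      using s by (intro borel_cantelli_AE1) (auto simp: X.emeasure_eq_measure)
    then show ?thesis
      by eventually_elim (auto simp: eventually_sequentially space_Q[OF x])
  qed
  then have "AE \<omega> in Q x. \<forall>y\<in>V. \<exists>N. \<forall>n\<ge>N. \<omega> n \<noteq> y" using countable_V by (simp add: AE_ball_countable)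
  with AE_nb[OF x] AE_space show ?thesis
  proof eventually_elim
    case (elim \<omega>)
    then show ?case by (intro path_to_end) (auto simp: space_Q[OF x] space_Om)
  qed
qed

definition nu :: "'v \<Rightarrow> (nat \<Rightarrow> 'v) measure" where "nu x = limit_distribution V rt up p x"

lemma nu_eq: "x \<in> V \<Longrightarrow> nu x = distr (Q x) BE (limit_end V rt up)"
  by (simp add: nu_def limit_distribution_def Q_def)

lemma meas_limit_Q: "x \<in> V \<Longrightarrow> limit_end V rt up \<in> Q x \<rightarrow>\<^sub>M BE"
  using meas_limit_end measurable_cong_sets[OF sets_Q refl] by blast

lemma sets_nu: "x \<in> V \<Longrightarrow> sets (nu x) = sets BE" by (simp add: nu_eq)

lemma prob_nu: "x \<in> V \<Longrightarrow> prob_space (nu x)"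
  using prob_space.prob_space_distr[OF prob_Q meas_limit_Q] by (simp add: nu_eq)

lemma nu_Cyl: assumes "x \<in> V" "y \<in> V" shows "measure (nu x) (Cyl y) = measure (Q x) (ev y)"
proof -
  interpret X: prob_space "Q x" using prob_Q assms by blast
  have "measure (nu x) (Cyl y) = X.prob (limit_end V rt up -` Cyl y \<inter> space (Q x))"
    using assms by (simp add: nu_eq measure_distr meas_limit_Q)
  also have "\<dots> = X.prob (ev y)"
  proof (rule X.finite_measure_eq_AE)
    show "AE \<omega> in Q x. (\<omega> \<in> limit_end V rt up -` Cyl y \<inter> space (Q x)) = (\<omega> \<in> ev y)"
      using AE_to_end[OF assms(1)] AE_space
      by eventually_elim (use assms in \<open>auto simp: ev_def limit_end_Cyl space_Q\<close>)
    show "limit_end V rt up -` Cyl y \<inter> space (Q x) \<in> X.events"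
      using meas_limit_Q[OF assms(1)] by (rule measurable_sets) simp
    show "ev y \<in> X.events" using sets_Q[OF assms(1)] by simp
  qed
  finally show ?thesis .
qed

text \<open>Events not affected by adding a first step. For them the Markov property becomes
  harmonicity in the starting point, and the walk may be restarted at its first visit to a
  vertex.\<close>

definition invariant :: "(nat \<Rightarrow> 'v) set \<Rightarrow> bool" where
  "invariant E \<longleftrightarrow> E \<in> sets Om \<and> (\<forall>x\<in>V. \<forall>\<omega>\<in>space Om. case_nat x \<omega> \<in> E \<longleftrightarrow> \<omega> \<in> E)"

lemma invariant_space: "invariant (space Om)"
  using measurable_space[OF meas_cons] by (auto simp: invariant_def)

lemma invariant_ev: "invariant (ev y)"
proof -
  have "ev_in y (case_nat x \<omega>) \<longleftrightarrow> ev_in y \<omega>" for x \<omega>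
  proof
    assume "ev_in y (case_nat x \<omega>)"
    then obtain N where N: "\<And>n. n \<ge> N \<Longrightarrow> case_nat x \<omega> n \<in> T y" by (auto simp: ev_in_def)
    then have "\<omega> n \<in> T y" if "n \<ge> N" for n using N[of "Suc n"] that by simp
    then show "ev_in y \<omega>" by (auto simp: ev_in_def)
  next
    assume "ev_in y \<omega>"
    then obtain N where N: "\<And>n. n \<ge> N \<Longrightarrow> \<omega> n \<in> T y" by (auto simp: ev_in_def)
    have "case_nat x \<omega> n \<in> T y" if "n \<ge> Suc N" for n using that N[of "n - 1"] by (cases n) auto
    then show "ev_in y (case_nat x \<omega>)" by (auto simp: ev_in_def)
  qed
  moreover have "case_nat x \<omega> \<in> space Om" if "x \<in> V" "\<omega> \<in> space Om" for x \<omega>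
    using measurable_space[OF meas_cons] that by blast
  ultimately show ?thesis by (auto simp: invariant_def ev_def)
qed

lemma invariant_harmonic: "invariant E \<Longrightarrow> x \<in> V \<Longrightarrow> measure (Q x) E = (\<Sum>y\<in>nb x. p x y * measure (Q y) E)"
proof -
  assume E: "invariant E" and x: "x \<in> V"
  have "E \<subseteq> space Om" using E sets.sets_into_space[of E Om] by (simp add: invariant_def)
  then have "{\<omega>\<in>space Om. case_nat x \<omega> \<in> E} = E" using E x unfolding invariant_def by blast
  then show ?thesis using markov[OF x, of E] E by (simp add: invariant_def)
qed

definition avoid :: "'v \<Rightarrow> nat \<Rightarrow> (nat \<Rightarrow> 'v) set" where "avoid w n = {\<omega>\<in>space Om. \<forall>i\<le>n. \<omega> i \<noteq> w}"
definition never :: "'v \<Rightarrow> (nat \<Rightarrow> 'v) set" where "never w = {\<omega>\<in>space Om. \<forall>i. \<omega> i \<noteq> w}"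

lemma avoid_sets [measurable, simp]: "avoid w n \<in> sets Om" unfolding avoid_def by measurable
lemma never_sets [measurable, simp]: "never w \<in> sets Om" unfolding never_def by measurable

abbreviation "fp \<equiv> first_pass_n V rt up p"

lemma fp_self: "fp k w w = (if k = 0 then 1 else 0)" by (cases k) auto

lemma fp_nonneg: "0 \<le> fp k x w" by (induction k arbitrary: x) (auto intro!: sum_nonneg)

text \<open>The strong Markov property at the first visit to \<open>w\<close>, obtained by
  first-step analysis instead of a stopping time: started at \<open>w\<close> the remainder is null,
  elsewhere one step is peeled off on both sides.\<close>

lemma first_pass_split:
  assumes E: "invariant E" and w: "w \<in> V"
  shows "z \<in> V \<Longrightarrow> measure (Q z) E = (\<Sum>k\<le>n. fp k z w) * measure (Q w) E + measure (Q z) (E \<inter> avoid w n)"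
proof (induction n arbitrary: z)
  have Es: "E \<in> sets Om" using E by (simp add: invariant_def)
  have zero: "measure (Q w) (E \<inter> avoid w n) = 0" for n
  proof -
    interpret W: prob_space "Q w" using prob_Q w by blast
    have "W.prob (E \<inter> avoid w n) \<le> W.prob {\<omega>\<in>space Om. \<omega> 0 \<noteq> w}"
      using coord_sets[of 0 "{x. x \<noteq> w}"] sets_Q[OF w] by (intro W.finite_measure_mono) (auto simp: avoid_def)
    then show ?thesis using law_start[OF w, of "\<lambda>z. z \<noteq> w"] by (simp add: measure_le_0_iff)
  qed
  {
    case 0
    show ?case
    proof (cases "z = w")
      case False
      interpret Z: prob_space "Q z" using prob_Q 0 by blast
      have "Z.prob {\<omega>\<in>space Om. \<omega> 0 \<noteq> w} = 1" using law_start[OF 0, of "\<lambda>z. z \<noteq> w"] False by simp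
      then have "AE \<omega> in Q z. \<omega> \<in> {\<omega>\<in>space Om. \<omega> 0 \<noteq> w}"
        using coord_sets[of 0 "{x. x \<noteq> w}"] sets_Q[OF 0] by (subst Z.prob_eq_1[symmetric]) auto
      then have "AE \<omega> in Q z. \<omega> \<in> E \<inter> avoid w 0 \<longleftrightarrow> \<omega> \<in> E" by eventually_elim (auto simp: avoid_def)
      then have "Z.prob (E \<inter> avoid w 0) = Z.prob E"
        using Es sets_Q[OF 0] by (intro Z.finite_measure_eq_AE) auto
      then show ?thesis using False by simp
    qed (simp add: zero)
  next
    case (Suc n)
    show ?case
    proof (cases "z = w")
      case True
      have "(\<Sum>k\<le>Suc n. fp k w w) = 1" by (simp add: fp_self sum.delta)
      then show ?thesis using True by (simp add: zero)
    next
      case False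
      have "{\<omega>\<in>space Om. case_nat z \<omega> \<in> E \<inter> avoid w (Suc n)} = E \<inter> avoid w n"
      proof (intro set_eqI iffI)
        fix \<omega> assume "\<omega> \<in> {\<omega>\<in>space Om. case_nat z \<omega> \<in> E \<inter> avoid w (Suc n)}"
        then have w': "\<omega> \<in> space Om" "case_nat z \<omega> \<in> E" "\<And>i. i \<le> Suc n \<Longrightarrow> case_nat z \<omega> i \<noteq> w" by (auto simp: avoid_def)
        then show "\<omega> \<in> E \<inter> avoid w n" using E Suc.prems w'(3)[of "Suc _"] by (auto simp: avoid_def invariant_def)
      next
        fix \<omega> assume a: "\<omega> \<in> E \<inter> avoid w n"
        then have "case_nat z \<omega> \<in> space Om" using measurable_space[OF meas_cons[OF Suc.prems]] by (auto simp: avoid_def)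
        then show "\<omega> \<in> {\<omega>\<in>space Om. case_nat z \<omega> \<in> E \<inter> avoid w (Suc n)}"
          using a E Suc.prems False by (auto simp: avoid_def invariant_def split: nat.split)
      qed
      then have 1: "measure (Q z) (E \<inter> avoid w (Suc n)) = (\<Sum>y\<in>nb z. p z y * measure (Q y) (E \<inter> avoid w n))"
        using markov[OF Suc.prems, of "E \<inter> avoid w (Suc n)"] Es by simp
      have "(\<Sum>k\<le>Suc n. fp k z w) = (\<Sum>k\<le>n. \<Sum>y\<in>nb z. p z y * fp k y w)"
        using False by (simp add: sum.atMost_shift atLeast0AtMost lessThan_Suc_atMost del: sum.atMost_Suc)
      also have "\<dots> = (\<Sum>y\<in>nb z. p z y * (\<Sum>k\<le>n. fp k y w))"
        by (subst sum.swap) (simp add: sum_distrib_left)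
      finally have 2: "(\<Sum>k\<le>Suc n. fp k z w) = (\<Sum>y\<in>nb z. p z y * (\<Sum>k\<le>n. fp k y w))" .
      have "measure (Q z) E = (\<Sum>y\<in>nb z. p z y * measure (Q y) E)" by (rule invariant_harmonic[OF E Suc.prems])
      also have "\<dots> = (\<Sum>y\<in>nb z. p z y * (\<Sum>k\<le>n. fp k y w) * measure (Q w) E + p z y * measure (Q y) (E \<inter> avoid w n))"
        using Suc.IH nb_V by (intro sum.cong refl) (simp add: distrib_left)
      also have "\<dots> = (\<Sum>y\<in>nb z. p z y * (\<Sum>k\<le>n. fp k y w)) * measure (Q w) E + (\<Sum>y\<in>nb z. p z y * measure (Q y) (E \<inter> avoid w n))"
        by (simp add: sum.distrib sum_distrib_right)
      finally show ?thesis unfolding 1 2 .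
    qed
  }
qed

text \<open>The split of the sure event bounds the partial sums by 1.\<close>

lemma fp_summable: assumes "z \<in> V" "w \<in> V" shows "summable (\<lambda>k. fp k z w)"
proof (rule bounded_imp_summable)
  show "0 \<le> fp k z w" for k by (rule fp_nonneg)
  show "(\<Sum>k\<le>n. fp k z w) \<le> 1" for n
  proof -
    have "measure (Q x) (space Om) = 1" if "x \<in> V" for x
      using prob_space.prob_space[OF prob_Q[OF that]] space_Q[OF that] by simp
    then have "1 = (\<Sum>k\<le>n. fp k z w) * 1 + measure (Q z) (space Om \<inter> avoid w n)"
      using first_pass_split[OF invariant_space assms(2,1), of n] assms by metis
    then show ?thesis using measure_nonneg[of "Q z" "space Om \<inter> avoid w n"] by linarith
  qed
qed

lemma hit_split:
  assumes E: "invariant E" and w: "w \<in> V" and z: "z \<in> V"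
  shows "measure (Q z) E = hit_prob V rt up p z w * measure (Q w) E + measure (Q z) (E \<inter> never w)"
proof -
  interpret Z: prob_space "Q z" using prob_Q z by blast
  have Es: "E \<in> sets Om" using E by (simp add: invariant_def)
  have "(\<lambda>n. Z.prob (E \<inter> avoid w n)) \<longlonglongrightarrow> Z.prob (\<Inter>n. E \<inter> avoid w n)"
  proof (rule Z.finite_Lim_measure_decseq)
    show "range (\<lambda>n. E \<inter> avoid w n) \<subseteq> sets (Q z)"
      unfolding sets_Q[OF z] using Es by (intro image_subsetI sets.Int avoid_sets)
    show "decseq (\<lambda>n. E \<inter> avoid w n)" unfolding decseq_def avoid_def using order_trans by blast
  qed
  also have "(\<Inter>n. E \<inter> avoid w n) = E \<inter> never w" by (auto simp: avoid_def never_def)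
  finally have 1: "(\<lambda>n. Z.prob (E \<inter> avoid w n)) \<longlonglongrightarrow> Z.prob (E \<inter> never w)" .
  have "(\<lambda>n. \<Sum>k\<le>n. fp k z w) \<longlonglongrightarrow> hit_prob V rt up p z w"
    unfolding hit_prob_def using fp_summable[OF z w] by (simp add: summable_LIMSEQ')
  from tendsto_add[OF tendsto_mult_right[OF this, of "measure (Q w) E"] 1]
  have "(\<lambda>n. Z.prob E) \<longlonglongrightarrow> hit_prob V rt up p z w * measure (Q w) E + Z.prob (E \<inter> never w)"
    by (simp add: first_pass_split[OF E w z, symmetric])
  then show ?thesis by (rule LIMSEQ_unique[OF tendsto_const])
qed

abbreviation "F x \<equiv> hit_prob V rt up p x (up x)"

lemma never_T: assumes x: "x \<in> V" "x \<noteq> rt" shows "AE \<omega> in Q x. \<omega> \<in> never (up x) \<longrightarrow> (\<forall>n. \<omega> n \<in> T x)"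
proof -
  interpret X: prob_space "Q x" using prob_Q x by blast
  have "X.prob {\<omega>\<in>space Om. \<omega> 0 = x} = 1" using law_start[OF x(1), of "\<lambda>z. z = x"] by simp
  then have "AE \<omega> in Q x. \<omega> \<in> {\<omega>\<in>space Om. \<omega> 0 = x}"
    using coord_sets[of 0 "{x}"] sets_Q[OF x(1)] by (subst X.prob_eq_1[symmetric]) auto
  with AE_nb[OF x(1)] show ?thesis
  proof eventually_elim
    case (elim \<omega>)
    show ?case
    proof (intro impI allI)
      fix n assume nv: "\<omega> \<in> never (up x)"
      show "\<omega> n \<in> T x"
      proof (induction n)
        case (Suc n)
        show ?case
        proof (rule ccontr)
          assume "\<omega> (Suc n) \<notin> T x"
          then have "\<omega> (Suc n) = up x" using nb_leave_T(3)[OF x(1) Suc.IH] elim by blast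
          then show False using nv by (auto simp: never_def)
        qed
      qed (use elim x T_self in auto)
    qed
  qed
qed

text \<open>Without a visit to x^- the walk stays in the cone of \<open>x\<close>, which is disjoint
  from that of \<open>y\<close>.\<close>

lemma nu_outside:
  assumes x: "x \<in> V" "x \<noteq> rt" and y: "y \<in> V" "y \<notin> T x" "x \<notin> T y"
  shows "measure (nu x) (Cyl y) = F x * measure (nu (up x)) (Cyl y)"
proof -
  interpret X: prob_space "Q x" using prob_Q x by blast
  have "AE \<omega> in Q x. \<omega> \<notin> ev y \<inter> never (up x)"
    using never_T[OF x]
  proof eventually_elim
    case (elim \<omega>)
    have "T x \<inter> T y = {}"
      using T_comparable[OF x(1) y(1)] T_comparable[OF y(1) x(1)] y by (metis disjoint_iff nat_le_linear)
    then show ?case using elim by (auto simp: ev_def ev_in_def)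
  qed
  moreover have "ev y \<inter> never (up x) \<in> X.events"
    unfolding sets_Q[OF x(1)] by (intro sets.Int ev_sets never_sets)
  ultimately have "X.prob (ev y \<inter> never (up x)) = 0" by (simp only: X.prob_eq_0)
  then show ?thesis using hit_split[OF invariant_ev up_V[OF x] x(1), of y] x y up_V by (simp add: nu_Cyl)
qed

text \<open>Without a visit to x^- the walk stays in the cone of \<open>x\<close>, hence in that of
  \<open>y\<close>, and contributes its full probability 1 - F(x, x^-).\<close>

lemma nu_inside:
  assumes x: "x \<in> V" "x \<noteq> rt" and y: "y \<in> V" "x \<in> T y"
  shows "measure (nu x) (Cyl y) = F x * measure (nu (up x)) (Cyl y) + (1 - F x)"
proof -
  interpret X: prob_space "Q x" using prob_Q x by blast
  have "AE \<omega> in Q x. \<omega> \<in> ev y \<inter> never (up x) \<longleftrightarrow> \<omega> \<in> space Om \<inter> never (up x)"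
    using never_T[OF x]
  proof eventually_elim
    case (elim \<omega>)
    then show ?case using T_trans[OF y] by (auto simp: ev_def ev_in_def never_def)
  qed
  then have "X.prob (ev y \<inter> never (up x)) = X.prob (space Om \<inter> never (up x))"
  proof (rule X.finite_measure_eq_AE)
    show "ev y \<inter> never (up x) \<in> X.events" "space Om \<inter> never (up x) \<in> X.events"
      unfolding sets_Q[OF x(1)] by (intro sets.Int sets.top ev_sets never_sets)+
  qed
  also have "\<dots> = 1 - F x"
    using hit_split[OF invariant_space up_V[OF x] x(1)] prob_space.prob_space[OF prob_Q] space_Q x up_V by simp
  finally show ?thesis using hit_split[OF invariant_ev up_V[OF x] x(1), of y] x y up_V by (simp add: nu_Cyl)
qed

lemma nu_harmonic:
  assumes "x \<in> V" "y \<in> V"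
  shows "measure (nu x) (Cyl y) = (\<Sum>z\<in>nb x. p x z * measure (nu z) (Cyl y))"
  using invariant_harmonic[OF invariant_ev assms(1), of y] assms nb_V by (simp add: nu_Cyl cong: sum.cong)

end

section \<open>Potential theory of the walk\<close>

context walk
begin

abbreviation "tn \<equiv> trans_n V rt up p"

lemma tn_nonneg: "0 \<le> tn n x y" by (induction n arbitrary: x) (auto intro!: sum_nonneg)

lemma tn_dep_pos: "x \<in> V \<Longrightarrow> 0 < tn (dep x) x rt"
proof (induction "dep x" arbitrary: x)
  case 0
  then show ?case using dep_0_iff[of x] by simp
next
  case (Suc n)
  have r: "x \<noteq> rt" using Suc by auto
  have n: "n = dep (up x)" using dep_Suc[OF Suc.prems r] Suc.hyps(2) by simp
  have "up x \<in> nb x" using nb_eq[OF Suc.prems] r by simp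
  then have "0 < p x (up x) * tn n (up x) rt"
    using Suc.hyps(1)[OF n up_V[OF Suc.prems r]] n p_pos_iff by simp
  also have "\<dots> \<le> (\<Sum>y\<in>nb x. p x y * tn n y rt)"
    using finite_nb[OF Suc.prems] \<open>up x \<in> nb x\<close> tn_nonneg by (intro member_le_sum[where f = "\<lambda>y. p x y * tn n y rt"]) auto
  finally show ?case unfolding Suc.hyps(2)[symmetric] by simp
qed

end

section \<open>The Green function and the reversing measure\<close>

context transient_walk
begin

abbreviation "m \<equiv> rev_measure V rt up p"
abbreviation "a \<equiv> conductance V rt up p"

definition gr :: "'v \<Rightarrow> real" where "gr x = green V rt up p x rt"

lemma tn_summable: "x \<in> V \<Longrightarrow> y \<in> V \<Longrightarrow> summable (\<lambda>n. tn n x y)" using tr by (simp add: transient_def)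

lemma gr_harmonic: assumes x: "x \<in> V" shows "gr x = (if x = rt then 1 else 0) + (\<Sum>y\<in>nb x. p x y * gr y)"
proof -
  have "gr x = tn 0 x rt + (\<Sum>n. tn (Suc n) x rt)"
    unfolding gr_def green_def using suminf_split_head[OF tn_summable[OF x rt_V]] by simp
  also have "(\<Sum>n. tn (Suc n) x rt) = (\<Sum>n. \<Sum>y\<in>nb x. p x y * tn n y rt)" by simp
  also have "\<dots> = (\<Sum>y\<in>nb x. \<Sum>n. p x y * tn n y rt)"
    using tn_summable nb_V by (intro suminf_sum summable_mult) auto
  also have "\<dots> = (\<Sum>y\<in>nb x. p x y * gr y)"
    unfolding gr_def green_def using tn_summable nb_V by (intro sum.cong refl suminf_mult) auto
  finally show ?thesis by simp
qed

lemma gr_pos: "x \<in> V \<Longrightarrow> 0 < gr x"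
  unfolding gr_def green_def using tn_dep_pos tn_summable tn_nonneg by (intro suminf_pos2) auto

text \<open>From the cone of \<open>x\<close> the root is reached only through x^-. The starting
  point x^- is included so that the induction covers all neighbours of points of the cone.\<close>

lemma tn_convolution:
  assumes x: "x \<in> V" "x \<noteq> rt" and z: "z \<in> T x \<or> z = up x"
  shows "tn n z rt = (\<Sum>k\<le>n. fp k z (up x) * tn (n - k) (up x) rt)"
  using z
proof (induction n arbitrary: z)
  have w: "up x \<in> V" "dep x = Suc (dep (up x))" using up_V dep_Suc x by auto
  then have wT: "up x \<notin> T x" using T_dep[OF _ x(1)] by fastforce
  have base: "tn n (up x) rt = (\<Sum>k\<le>n. fp k (up x) (up x) * tn (n - k) (up x) rt)" for n
  proof -
    have "(\<Sum>k\<le>n. fp k (up x) (up x) * tn (n - k) (up x) rt) = (\<Sum>k\<le>n. if k = 0 then tn n (up x) rt else 0)"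
      by (intro sum.cong) (auto simp: fp_self)
    then show ?thesis by (simp add: sum.delta)
  qed
  {
    case 0
    show ?case
    proof (cases "z = up x")
      case False
      then have "z \<in> T x" using 0 by simp
      then have "z \<noteq> rt" using T_dep[OF _ x(1)] w by fastforce
      then show ?thesis using False by simp
    next
      case True
      show ?thesis unfolding True by (rule base)
    qed
  next
    case (Suc n)
    show ?case
    proof (cases "z = up x")
      case False
      then have zT: "z \<in> T x" using Suc.prems by simp
      have "tn (Suc n) z rt = (\<Sum>y\<in>nb z. p z y * (\<Sum>k\<le>n. fp k y (up x) * tn (n - k) (up x) rt))"
      proof -
        have "y \<in> T x \<or> y = up x" if "y \<in> nb z" for y using nb_leave_T(3)[OF x(1) zT that] by blast
        then have "tn n y rt = (\<Sum>k\<le>n. fp k y (up x) * tn (n - k) (up x) rt)" if "y \<in> nb z" for y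
          using Suc.IH that by blast
        then show ?thesis by simp
      qed
      also have "\<dots> = (\<Sum>k\<le>n. fp (Suc k) z (up x) * tn (n - k) (up x) rt)"
        using False by (simp add: sum_distrib_left sum_distrib_right mult.assoc) (rule sum.swap)
      also have "\<dots> = (\<Sum>k\<le>Suc n. fp k z (up x) * tn (Suc n - k) (up x) rt)"
        using False by (subst sum.atMost_Suc_shift) simp
      finally show ?thesis .
    next
      case True
      show ?thesis unfolding True by (rule base)
    qed
  }
qed

lemma gr_F: assumes x: "x \<in> V" "x \<noteq> rt" shows "gr x = F x * gr (up x)"
proof -
  note w = up_V[OF x]
  have "(\<lambda>n. \<Sum>k\<le>n. fp k x (up x) * tn (n - k) (up x) rt) sums ((\<Sum>k. fp k x (up x)) * (\<Sum>k. tn k (up x) rt))"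
    using fp_summable[OF x(1) w] tn_summable[OF w rt_V] fp_nonneg tn_nonneg
    by (intro Cauchy_product_sums) auto
  moreover have "(\<Sum>k\<le>n. fp k x (up x) * tn (n - k) (up x) rt) = tn n x rt" for n
    using tn_convolution[OF x, of x n] T_self x by simp
  ultimately show ?thesis by (simp add: gr_def green_def hit_prob_def sums_iff)
qed

lemma F_eq: "x \<in> V \<Longrightarrow> x \<noteq> rt \<Longrightarrow> F x = gr x / gr (up x)"
  using gr_F gr_pos up_V by (metis less_irrefl nonzero_mult_div_cancel_right)

lemma m_rt: "m rt = 1" by (simp add: rev_measure_def)

text \<open>Detailed balance, which makes \<open>a\<close> the conductance of the edge in both
  directions.\<close>

lemma m_up: assumes x: "x \<in> V" "x \<noteq> rt" shows "m x * p x (up x) = m (up x) * p (up x) x"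
proof -
  have "0 < p x (up x)" using p_pos_iff nb_eq[OF x(1)] x by simp
  moreover have "m x = p (up x) x / p x (up x) * m (up x)"
    unfolding rev_measure_def dep_Suc[OF x] by (simp add: prod.lessThan_Suc_shift funpow_swap1 del: prod.lessThan_Suc)
  ultimately show ?thesis by simp
qed

lemma m_pos: "x \<in> V \<Longrightarrow> 0 < m x"
  unfolding rev_measure_def
proof (rule prod_pos)
  fix k assume x: "x \<in> V" and k: "k \<in> {..<dep x}"
  let ?y = "(up ^^ k) x"
  have y: "?y \<in> V" "dep ?y = dep x - k" using funpow_V[OF x, of k] k by auto
  then have "0 < dep ?y" using k by simp
  then have r: "?y \<noteq> rt" by (metis dep_rt less_irrefl)
  have "up ?y \<in> nb ?y" using nb_eq[OF y(1)] r by simp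
  then have "0 < p ?y (up ?y)" "0 < p (up ?y) ?y" using p_pos_iff nb_sym by auto
  then show "0 < p ((up ^^ Suc k) x) ?y / p ?y ((up ^^ Suc k) x)" by simp
qed

lemma a_pos: "x \<in> V \<Longrightarrow> x \<noteq> rt \<Longrightarrow> 0 < a x"
  unfolding conductance_def using m_pos p_pos_iff[of x "up x"] nb_eq[of x] by simp

lemma a_ch: "v \<in> ch u \<Longrightarrow> a v = m u * p u v"
  using m_up[of v] by (simp add: conductance_def ch_iff)

section \<open>The Wronskian flow\<close>

definition wronskian :: "'v \<Rightarrow> 'v \<Rightarrow> real" where
  "wronskian y x = a x * (gr (up x) * measure (nu x) (Cyl y) - measure (nu (up x)) (Cyl y) * gr x)"

text \<open>Both functions are harmonic apart from the unit source of \<open>gr\<close> at the root,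
  so the antisymmetric sum over the neighbours of \<open>u\<close> sees only that source. Detailed
  balance turns its terms into Wronskians of edges, the one towards u^- with the opposite
  sign.\<close>

lemma wronskian_flow:
  assumes u: "u \<in> V" and y: "y \<in> V"
  shows "(\<Sum>v\<in>ch u. wronskian y v) = (if u = rt then measure (nu rt) (Cyl y) else wronskian y u)"
proof -
  define f where "f z = measure (nu z) (Cyl y)" for z
  have "(\<Sum>z\<in>nb u. p u z * (f z * gr u - gr z * f u)) = (\<Sum>z\<in>nb u. p u z * f z) * gr u - (\<Sum>z\<in>nb u. p u z * gr z) * f u"
    by (simp add: sum_distrib_right sum_subtractf right_diff_distrib mult.assoc)
  also have "(\<Sum>z\<in>nb u. p u z * f z) = f u" using nu_harmonic[OF u y] by (simp add: f_def)
  also have "(\<Sum>z\<in>nb u. p u z * gr z) = gr u - (if u = rt then 1 else 0)" using gr_harmonic[OF u] by simp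
  finally have 1: "(\<Sum>z\<in>nb u. p u z * (f z * gr u - gr z * f u)) = (if u = rt then f rt else 0)"
    by (simp add: algebra_simps)
  have "m u * (\<Sum>v\<in>ch u. p u v * (f v * gr u - gr v * f u)) = (\<Sum>v\<in>ch u. wronskian y v)"
    unfolding sum_distrib_left by (intro sum.cong refl) (auto simp: wronskian_def a_ch ch_iff f_def algebra_simps)
  moreover have "m u * (p u (up u) * (f (up u) * gr u - gr (up u) * f u)) = - wronskian y u"
    by (simp add: wronskian_def conductance_def f_def algebra_simps)
  moreover have "(\<Sum>v\<in>ch u. p u v * (f v * gr u - gr v * f u)) =
     (if u = rt then f rt else 0) - (if u = rt then 0 else p u (up u) * (f (up u) * gr u - gr (up u) * f u))"
    using 1 sum_nb[OF u, of "\<lambda>z. p u z * (f z * gr u - gr z * f u)"] by simp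
  ultimately show ?thesis by (auto simp: m_rt f_def split: if_splits)
qed

text \<open>At a vertex of the geodesic the flow can leave only towards \<open>y\<close>: on a
  sibling \<open>v\<close> off the geodesic, \<open>nu_outside\<close> and \<open>gr_F\<close>
  multiply both functions by the same F(v, v^-), and the Wronskian vanishes.\<close>

lemma wronskian_path:
  assumes y: "y \<in> V"
  shows "x \<in> V \<Longrightarrow> x \<noteq> rt \<Longrightarrow> y \<in> T x \<Longrightarrow> wronskian y x = measure (nu rt) (Cyl y)"
proof (induction "dep x" arbitrary: x)
  case 0
  then show ?case using dep_0_iff by simp
next
  case (Suc n)
  let ?u = "up x"
  have u: "?u \<in> V" "dep ?u = n" using up_V dep_Suc Suc by fastforce+
  have yu: "y \<in> T ?u" using T_up[OF u(1) Suc.prems(1)] T_trans[OF u(1) _ Suc.prems(3)] T_self u Suc.prems by blast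
  have zero: "wronskian y v = 0" if v: "v \<in> ch ?u" "v \<noteq> x" for v
  proof -
    have vV: "v \<in> V" "v \<noteq> rt" "up v = ?u" "dep v = dep x" using v dep_ch[OF v(1)] Suc.hyps(2) u by (auto simp: ch_iff)
    have 1: "y \<notin> T v" using T_same_dep[OF Suc.prems(1) vV(1)] vV Suc.prems v by auto
    have 2: "v \<notin> T y"
    proof
      assume "v \<in> T y"
      then have "v \<in> T x" using T_trans[OF Suc.prems(1,3)] by blast
      then show False using vV v by (simp add: T_iff Suc.prems)
    qed
    show ?thesis using nu_outside[OF vV(1,2) y 1 2] gr_F[OF vV(1,2)] by (simp add: wronskian_def)
  qed
  have "wronskian y x = (\<Sum>v\<in>ch ?u. wronskian y v)"
    using sum.remove[OF finite_ch ch_up[OF Suc.prems(1,2)], of "wronskian y"] zero by simp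
  also have "\<dots> = measure (nu rt) (Cyl y)"
    using wronskian_flow[OF u(1) y] Suc.hyps(1)[of ?u] u yu by simp
  finally show ?case .
qed

theorem nu_rt_Cyl:
  assumes y: "y \<in> V" "y \<noteq> rt"
  shows "measure (nu rt) (Cyl y) = a y * (gr (up y) - gr y)"
proof -
  have "measure (nu rt) (Cyl y) = wronskian y y" using wronskian_path[OF y(1) y T_self[OF y(1)]] by simp
  also have "\<dots> = a y * (gr (up y) - gr y)"
  proof -
    have "wronskian y y = a y * gr (up y) * (measure (nu y) (Cyl y) - F y * measure (nu (up y)) (Cyl y))"
      unfolding wronskian_def gr_F[OF y] by (simp add: algebra_simps)
    also have "measure (nu y) (Cyl y) - F y * measure (nu (up y)) (Cyl y) = 1 - F y"
      using nu_inside[OF y y(1) T_self[OF y(1)]] by simp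
    also have "a y * gr (up y) * (1 - F y) = a y * (gr (up y) - gr y)"
      unfolding gr_F[OF y] by (simp add: algebra_simps)
    finally show ?thesis .
  qed
  finally show ?thesis .
qed

end

section \<open>Harmonic extensions of integrable functions\<close>

locale boundary_walk = transient_walk V rt up p
  for V :: "'v set" and rt up p +
  assumes F_less: "\<And>x. x \<in> V \<Longrightarrow> x \<noteq> rt \<Longrightarrow> hit_prob V rt up p x (up x) < 1"
    and gr_fin: "\<And>e. 0 < e \<Longrightarrow> finite {x \<in> V. e \<le> green V rt up p x rt}"
begin

lemma gr_up: assumes "x \<in> V" "x \<noteq> rt" shows "gr x < gr (up x)"
  using gr_F[OF assms] F_less[OF assms] gr_pos[OF up_V[OF assms]] by simp

text \<open>F < 1 gives strict decrease. A ray visits each vertex at most once, so it leaves every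
  finite superlevel set for good.\<close>

lemma gr_ultra: "ultra gr"
proof -
  have "(\<lambda>n. gr (\<xi> n)) \<longlonglongrightarrow> 0" if xi: "\<xi> \<in> Ends" for \<xi>
  proof (rule LIMSEQ_I)
    fix e :: real assume e: "0 < e"
    have "inj \<xi>" using ends_dep[OF xi] by (metis injI)
    then have "finite (\<xi> -` {x \<in> V. e \<le> green V rt up p x rt})" by (intro finite_vimageI gr_fin e)
    then obtain N where N: "\<forall>n\<in>\<xi> -` {x \<in> V. e \<le> green V rt up p x rt}. n < N" by (meson finite_nat_set_iff_bounded)
    have "\<forall>n\<ge>N. norm (gr (\<xi> n) - 0) < e"
    proof (intro allI impI)
      fix n assume "N \<le> n"
      then have "n \<notin> \<xi> -` {x \<in> V. e \<le> green V rt up p x rt}" using N by auto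
      then have "gr (\<xi> n) < e" using ends_V[OF xi] by (simp add: gr_def)
      then show "norm (gr (\<xi> n) - 0) < e" using gr_pos[OF ends_V[OF xi], of n] by simp
    qed
    then show "\<exists>N. \<forall>n\<ge>N. norm (gr (\<xi> n) - 0) < e" by blast
  qed
  then show ?thesis using gr_pos gr_up by (auto simp: ultrametric_element_def)
qed

text \<open>Full support of \<open>nu rt\<close> follows from \<open>nu_rt_Cyl\<close>, where both
  factors are positive; the root is treated apart.\<close>

sublocale em: end_measure V rt up "nu rt"
proof (intro end_measure.intro end_measure_axioms.intro)
  show "rtree V rt up" by (rule rtree_axioms)
  show "prob_space (nu rt)" by (rule prob_nu) simp
  show "sets (nu rt) = sets BE" by (rule sets_nu) simp
  show "0 < measure (nu rt) (Cyl x)" if x: "x \<in> V" for x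
  proof (cases "x = rt")
    case True
    interpret prob_space "nu rt" by (rule prob_nu) simp
    have "space (nu rt) = Ends" using sets_nu[of rt, THEN sets_eq_imp_space_eq] by simp
    then show ?thesis using prob_space True by (simp add: Cyl_rt)
  next
    case False
    then show ?thesis using nu_rt_Cyl[OF x False] a_pos[OF x False] gr_up[OF x False] by simp
  qed
qed

sublocale we: weighted_ends V rt up "nu rt" gr
  by unfold_locales (rule gr_ultra)

text \<open>The cylinder of \<open>y\<close> contains that of \<open>x\<close>, lies in it, or is
  disjoint from it. In the second case the Wronskian at \<open>x\<close> yields
  \<open>em.mu y\<close>, and comparison with \<open>em.mu x\<close> eliminates the
  conductance.\<close>

lemma nu_recursion:
  assumes x: "x \<in> V" "x \<noteq> rt" and y: "y \<in> V"
  shows "measure (nu x) (Cyl y) = F x * measure (nu (up x)) (Cyl y)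
     + (1 - F x) / em.mu x * measure (nu rt) (Cyl x \<inter> Cyl y)"
proof -
  have mx: "em.mu x \<noteq> 0" using em.mu_neq_0 x by simp
  consider "x \<in> T y" | "y \<in> T x" | "x \<notin> T y" "y \<notin> T x" by blast
  then show ?thesis
  proof cases
    case 1
    then have "Cyl x \<inter> Cyl y = Cyl x" using Cyl_T[OF y 1] by blast
    then show ?thesis using nu_inside[OF x y 1] mx by simp
  next
    case 2
    then have e: "Cyl x \<inter> Cyl y = Cyl y" using Cyl_T[OF x(1) 2] by blast
    have "a x * gr (up x) * (measure (nu x) (Cyl y) - F x * measure (nu (up x)) (Cyl y)) = em.mu y"
      using wronskian_path[OF y x 2] gr_F[OF x] by (simp add: wronskian_def algebra_simps)
    moreover have "em.mu x = a x * gr (up x) * (1 - F x)"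
      using nu_rt_Cyl[OF x] gr_F[OF x] by (simp add: algebra_simps)
    moreover have "0 < a x * gr (up x)" using a_pos x gr_pos up_V by simp
    moreover have "0 < 1 - F x" using F_less x by simp
    ultimately have "em.mu y = (a x * gr (up x)) * (measure (nu x) (Cyl y) - F x * measure (nu (up x)) (Cyl y))"
      "(1 - F x) / em.mu x = 1 / (a x * gr (up x))" by simp_all
    moreover have "1 / P * (P * z) = z" if "0 < P" for P z :: real using that by simp
    ultimately show ?thesis unfolding e using \<open>0 < a x * gr (up x)\<close> by (metis add_diff_cancel_left' diff_add_cancel add.commute)
  next
    case 3
    then have "Cyl x \<inter> Cyl y = {}" using Cyl_T_disjoint x y by blast
    then show ?thesis using nu_outside[OF x y 3(2,1)] by simp
  qed
qed

lemma F_bounds: "x \<in> V \<Longrightarrow> x \<noteq> rt \<Longrightarrow> 0 < F x \<and> F x < 1"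
  using F_eq gr_pos up_V F_less by simp

lemma nu_density_step:
  assumes x: "x \<in> V" "x \<noteq> rt" and k: "k \<in> borel_measurable (nu rt)" "\<And>\<xi>. 0 \<le> k \<xi>" "\<And>\<xi>. k \<xi> \<le> B"
    and d: "nu (up x) = density (nu rt) (\<lambda>\<xi>. ennreal (k \<xi>))"
  shows "nu x = density (nu rt) (\<lambda>\<xi>. ennreal (F x * k \<xi> + (1 - F x) / em.mu x * indicator (Cyl x) \<xi>))"
proof (rule measure_eqI_Cyl)
  define c where "c = (1 - F x) / em.mu x"
  have c0: "0 \<le> c" using F_bounds[OF x] by (simp add: c_def)
  have F0: "0 \<le> F x" using F_bounds[OF x] by simp
  note [measurable] = k(1)
  show "sets (nu x) = sets BE" using sets_nu x by simp
  show "sets (density (nu rt) (\<lambda>\<xi>. ennreal (F x * k \<xi> + (1 - F x) / em.mu x * indicator (Cyl x) \<xi>))) = sets BE"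
    using em.sets_mu by simp
  interpret X: prob_space "nu x" using prob_nu x by blast
  show "emeasure (nu x) Ends \<noteq> \<infinity>" by simp
  fix y assume y: "y \<in> V"
  interpret U: prob_space "nu (up x)" using prob_nu up_V x by blast
  have "emeasure (density (nu rt) (\<lambda>\<xi>. ennreal (F x * k \<xi> + c * indicator (Cyl x) \<xi>))) (Cyl y)
    = (\<integral>\<^sup>+\<xi>. ennreal (F x * k \<xi> + c * indicator (Cyl x) \<xi>) * indicator (Cyl y) \<xi> \<partial>nu rt)"
    by (intro emeasure_density) auto
  also have "\<dots> = (\<integral>\<^sup>+\<xi>. ennreal (F x) * (ennreal (k \<xi>) * indicator (Cyl y) \<xi>) + ennreal c * indicator (Cyl x \<inter> Cyl y) \<xi> \<partial>nu rt)"
    using F0 c0 k(2) by (intro nn_integral_cong) (auto simp: indicator_def ennreal_plus ennreal_mult)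
  also have "\<dots> = ennreal (F x) * (\<integral>\<^sup>+\<xi>. ennreal (k \<xi>) * indicator (Cyl y) \<xi> \<partial>nu rt) + ennreal c * emeasure (nu rt) (Cyl x \<inter> Cyl y)"
    by (subst nn_integral_add) (auto simp: nn_integral_cmult)
  also have "(\<integral>\<^sup>+\<xi>. ennreal (k \<xi>) * indicator (Cyl y) \<xi> \<partial>nu rt) = emeasure (nu (up x)) (Cyl y)"
    unfolding d by (intro emeasure_density[symmetric]) auto
  also have "ennreal (F x) * emeasure (nu (up x)) (Cyl y) + ennreal c * emeasure (nu rt) (Cyl x \<inter> Cyl y) = emeasure (nu x) (Cyl y)"
    using nu_recursion[OF x y] F0 c0
    by (simp add: X.emeasure_eq_measure U.emeasure_eq_measure em.emeasure_eq_measure c_def[symmetric] ennreal_mult[symmetric] ennreal_plus[symmetric] del: ennreal_plus)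
  finally show "emeasure (nu x) (Cyl y) = emeasure (density (nu rt) (\<lambda>\<xi>. ennreal (F x * k \<xi> + (1 - F x) / em.mu x * indicator (Cyl x) \<xi>))) (Cyl y)"
    by (simp add: c_def)
qed

text \<open>Each step away from the root rescales the density and adds a multiple of a cylinder
  indicator. Boundedness makes every function in L^1(nu_o) integrable for all nu_x, so that its
  extension is defined and linear.\<close>

lemma nu_density:
  "x \<in> V \<Longrightarrow> \<exists>k B. k \<in> borel_measurable (nu rt) \<and> (\<forall>\<xi>. 0 \<le> k \<xi> \<and> k \<xi> \<le> B) \<and> nu x = density (nu rt) (\<lambda>\<xi>. ennreal (k \<xi>))"
proof (induction "dep x" arbitrary: x)
  case 0
  then have "x = rt" using dep_0_iff by simp
  then show ?case by (intro exI[of _ "\<lambda>_. 1"] exI[of _ 1]) (simp add: density_1)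
next
  case (Suc n)
  have r: "x \<noteq> rt" using Suc by auto
  then have "n = dep (up x)" "up x \<in> V" using dep_Suc[of x] up_V Suc by auto
  then obtain k B where k: "k \<in> borel_measurable (nu rt)" "\<And>\<xi>. 0 \<le> k \<xi>" "\<And>\<xi>. k \<xi> \<le> B" "nu (up x) = density (nu rt) (\<lambda>\<xi>. ennreal (k \<xi>))"
    using Suc.hyps(1) by metis
  let ?k = "\<lambda>\<xi>. F x * k \<xi> + (1 - F x) / em.mu x * indicator (Cyl x) \<xi>"
  note [measurable] = k(1)
  note Fb = F_bounds[OF Suc.prems r]
  have "?k \<in> borel_measurable (nu rt)" by measurable
  moreover have "0 \<le> ?k \<xi>" for \<xi> using Fb k(2) by (auto intro!: add_nonneg_nonneg mult_nonneg_nonneg)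
  moreover have "?k \<xi> \<le> F x * B + (1 - F x) / em.mu x" for \<xi>
  proof (rule add_mono)
    show "F x * k \<xi> \<le> F x * B" using Fb k(3) by simp
    show "(1 - F x) / em.mu x * indicator (Cyl x) \<xi> \<le> (1 - F x) / em.mu x" using Fb by (auto simp: indicator_def)
  qed
  ultimately show ?case using nu_density_step[OF Suc.prems r k] by blast
qed

abbreviation "hx \<equiv> harm_ext V rt up p"

lemma hx_nu: "hx f x = (\<integral>\<xi>. f \<xi> \<partial>nu x)" by (simp add: harm_ext_def nu_def)

lemma integrable_bounded_mult:
  assumes f: "integrable (nu rt) f" and k: "k \<in> borel_measurable (nu rt)" "\<And>\<xi>. 0 \<le> k \<xi> \<and> k \<xi> \<le> (B::real)"
  shows "integrable (nu rt) (\<lambda>\<xi>. k \<xi> * f \<xi> :: real)"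
proof (rule Bochner_Integration.integrable_bound[of _ "\<lambda>\<xi>. B * f \<xi>"])
  show "AE \<xi> in nu rt. norm (k \<xi> * f \<xi>) \<le> norm (B * f \<xi>)"
  proof (rule AE_I2)
    fix \<xi>
    have "\<bar>k \<xi>\<bar> \<le> \<bar>B\<bar>" using k(2)[of \<xi>] by linarith
    then show "norm (k \<xi> * f \<xi>) \<le> norm (B * f \<xi>)" by (simp add: abs_mult mult_right_mono)
  qed
qed (use f k in auto)

lemma nu_integrable: assumes f: "integrable (nu rt) f" and x: "x \<in> V" shows "integrable (nu x) (f :: _ \<Rightarrow> real)"
proof -
  obtain k B where k: "k \<in> borel_measurable (nu rt)" "\<And>\<xi>. 0 \<le> k \<xi> \<and> k \<xi> \<le> B" "nu x = density (nu rt) (\<lambda>\<xi>. ennreal (k \<xi>))"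
    using nu_density[OF x] by metis
  show ?thesis unfolding k(3) using k f integrable_bounded_mult[OF f k(1,2)]
    by (subst integrable_real_density) auto
qed

lemma hx_recursion:
  assumes f: "integrable (nu rt) f" and x: "x \<in> V" "x \<noteq> rt"
  shows "hx f x = F x * hx f (up x) + (1 - F x) * em.avg f x"
proof -
  obtain k B where k: "k \<in> borel_measurable (nu rt)" "\<And>\<xi>. 0 \<le> k \<xi> \<and> k \<xi> \<le> B" "nu (up x) = density (nu rt) (\<lambda>\<xi>. ennreal (k \<xi>))"
    using nu_density[OF up_V[OF x]] by metis
  note [measurable] = k(1)
  have fm [measurable]: "f \<in> borel_measurable (nu rt)" using f by auto
  let ?c = "(1 - F x) / em.mu x"
  have c0: "0 \<le> ?c" "0 \<le> F x" using F_bounds[OF x] by auto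
  have d: "nu x = density (nu rt) (\<lambda>\<xi>. ennreal (F x * k \<xi> + ?c * indicator (Cyl x) \<xi>))"
    using nu_density_step[OF x k(1) _ _ k(3)] k(2) by blast
  have i1: "integrable (nu rt) (\<lambda>\<xi>. k \<xi> * f \<xi>)" by (rule integrable_bounded_mult[OF f k(1,2)])
  have i2: "integrable (nu rt) (\<lambda>\<xi>. indicator (Cyl x) \<xi> * f \<xi>)"
    using em.set_int[OF f, of x] by (simp add: set_integrable_def)
  have "hx f x = (\<integral>\<xi>. (F x * k \<xi> + ?c * indicator (Cyl x) \<xi>) * f \<xi> \<partial>nu rt)"
  proof -
    have "0 \<le> F x * k \<xi> + ?c * indicator (Cyl x) \<xi>" for \<xi>
      using c0 k(2) by (intro add_nonneg_nonneg mult_nonneg_nonneg) auto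
    then show ?thesis unfolding hx_nu d by (intro integral_real_density AE_I2) measurable
  qed
  also have "\<dots> = (\<integral>\<xi>. F x * (k \<xi> * f \<xi>) + ?c * (indicator (Cyl x) \<xi> * f \<xi>) \<partial>nu rt)"
    by (intro arg_cong[where f = "integral\<^sup>L (nu rt)"] ext) (simp add: algebra_simps)
  also have "\<dots> = F x * (\<integral>\<xi>. k \<xi> * f \<xi> \<partial>nu rt) + ?c * (\<integral>\<xi>. indicator (Cyl x) \<xi> * f \<xi> \<partial>nu rt)"
    using i1 i2 by simp
  also have "(\<integral>\<xi>. k \<xi> * f \<xi> \<partial>nu rt) = hx f (up x)"
    unfolding hx_nu k(3) using k(2) by (intro integral_real_density[symmetric]) auto
  also have "?c * (\<integral>\<xi>. indicator (Cyl x) \<xi> * f \<xi> \<partial>nu rt) = (1 - F x) * em.avg f x"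
    by (simp add: em.avg_def set_lebesgue_integral_def)
  finally show ?thesis .
qed

lemma harmonic_average: "integrable (nu rt) f \<Longrightarrow> harmonic_average V rt up (nu rt) gr f (hx f)"
  by unfold_locales (auto simp: gr_ultra em.avg_rt hx_nu[of f rt] hx_recursion F_eq)

section \<open>The Dirichlet energy and the standard form of the Green function\<close>

definition edge_energy :: "((nat \<Rightarrow> 'v) \<Rightarrow> real) \<Rightarrow> 'v \<Rightarrow> real" where
  "edge_energy f x = (hx f x - hx f (up x))^2 * a x"

text \<open>By \<open>nu_rt_Cyl\<close>, cylinder mass divided by the decrease of \<open>gr\<close>
  is the conductance.\<close>

lemma ext_energy_eq: "em.ext_energy (hx f) gr n = (\<Sum>x\<in>level (Suc n). edge_energy f x)"
proof -
  have "em.ext_energy (hx f) gr n = (\<Sum>u\<in>level n. \<Sum>x\<in>ch u. em.mu x * ((hx f x - hx f u)^2 / (gr u - gr x)))"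
    unfolding em.ext_energy_def by (rule em.integral_lev2)
  also have "\<dots> = (\<Sum>u\<in>level n. \<Sum>x\<in>ch u. edge_energy f x)"
  proof (intro sum.cong refl)
    fix u x assume "x \<in> ch u"
    then have x: "x \<in> V" "x \<noteq> rt" "up x = u" by (auto simp: ch_iff)
    then show "em.mu x * ((hx f x - hx f u)^2 / (gr u - gr x)) = edge_energy f x"
      using nu_rt_Cyl[OF x(1,2)] gr_up[OF x(1,2)] by (simp add: edge_energy_def)
  qed
  finally show ?thesis by (simp add: sum_level_Suc)
qed

text \<open>Finite unions of levels are cofinal among the finite subsets, so an unordered sum may be
  evaluated level by level.\<close>

lemma has_sum_levels:
  assumes "(f has_sum s) (V - {rt})"
  shows "(\<lambda>n. \<Sum>x\<in>level (Suc n). (f x :: real)) sums s"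
proof -
  define L where "L n = (\<Union>k<n. level (Suc k))" for n
  have L: "finite (L n)" "L n \<subseteq> V - {rt}" for n
    using finite_level by (auto simp: L_def level_def)
  have sumL: "sum f (L n) = (\<Sum>k<n. \<Sum>x\<in>level (Suc k). f x)" for n
    unfolding L_def using finite_level by (intro sum.UNION_disjoint) (auto simp: level_def)
  have "filterlim L (finite_subsets_at_top (V - {rt})) sequentially"
    unfolding filterlim_finite_subsets_at_top
  proof (intro allI impI)
    fix X assume X: "finite X \<and> X \<subseteq> V - {rt}"
    then obtain N where N: "\<forall>x\<in>X. dep x < N" by (metis finite_imageI finite_nat_set_iff_bounded imageI)
    have "X \<subseteq> L n" if n: "n \<ge> N" for n
    proof
      fix x assume x: "x \<in> X"
      then have "x \<in> V" "x \<noteq> rt" "dep x < N" using X N by auto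
      then have "x \<in> level (Suc (dep x - 1))" "dep x - 1 < n" using dep_0_iff[of x] n by (auto simp: level_def)
      then show "x \<in> L n" unfolding L_def by blast
    qed
    then show "\<forall>\<^sub>F y in sequentially. finite (L y) \<and> X \<subseteq> L y \<and> L y \<subseteq> V - {rt}"
      using L unfolding eventually_sequentially by blast
  qed
  then have "(\<lambda>n. sum f (L n)) \<longlonglongrightarrow> s"
    using assms unfolding has_sum_def by (rule filterlim_compose[rotated])
  then show ?thesis by (simp add: sumL sums_def)
qed

lemma edge_energy_nonneg: "x \<in> V - {rt} \<Longrightarrow> 0 \<le> edge_energy f x"
  using a_pos[of x] by (simp add: edge_energy_def)

text \<open>For nonnegative terms the converse holds as well, since every finite set lies in
  finitely many levels.\<close>

lemma has_sum_levels_iff: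
  assumes "\<And>x. x \<in> V - {rt} \<Longrightarrow> 0 \<le> f x"
  shows "(f has_sum s) (V - {rt}) \<longleftrightarrow> (\<lambda>n. \<Sum>x\<in>level (Suc n). (f x :: real)) sums s"
proof
  assume s: "(\<lambda>n. \<Sum>x\<in>level (Suc n). f x) sums s"
  have lev: "level (Suc n) \<subseteq> V - {rt}" for n by (auto simp: level_def)
  have le: "t \<le> s" if X: "finite X" "X \<subseteq> V - {rt}" "t = sum f X" for X t
  proof -
    obtain N where N: "\<forall>x\<in>X. dep x < N" using X by (metis finite_imageI finite_nat_set_iff_bounded imageI)
    have sub: "X \<subseteq> (\<Union>k<N. level (Suc k))"
    proof
      fix x assume x: "x \<in> X"
      then have "x \<in> V" "x \<noteq> rt" "dep x < N" using X N by auto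
      then have "x \<in> level (Suc (dep x - 1))" "dep x - 1 < N" using dep_0_iff[of x] by (auto simp: level_def)
      then show "x \<in> (\<Union>k<N. level (Suc k))" by blast
    qed
    then have "t \<le> sum f (\<Union>k<N. level (Suc k))"
    proof -
      have "0 \<le> f b" if "b \<in> level (Suc k)" for b k using assms lev that by blast
      then show ?thesis unfolding X(3) using sub finite_level by (intro sum_mono2) auto
    qed
    also have "\<dots> = (\<Sum>k<N. \<Sum>x\<in>level (Suc k). f x)"
      using finite_level by (intro sum.UNION_disjoint) (auto simp: level_def)
    also have "\<dots> \<le> s"
    proof -
      have "0 \<le> (\<Sum>x\<in>level (Suc k). f x)" for k using lev[of k] assms by (intro sum_nonneg) blast
      then show ?thesis using s sum_le_suminf[of "\<lambda>n. \<Sum>x\<in>level (Suc n). f x" "{..<N}"] by (auto simp: sums_iff)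
    qed
    finally show ?thesis .
  qed
  have "f summable_on (V - {rt})"
  proof (rule nonneg_bounded_partial_sums_imp_summable_on[OF assms, where C = s])
    show "\<forall>\<^sub>F X in finite_subsets_at_top (V - {rt}). sum f X \<le> s"
      by (intro eventually_finite_subsets_at_top_weakI) (rule le[OF _ _ refl])
  qed
  then obtain t where t: "(f has_sum t) (V - {rt})" by (auto simp: summable_on_def)
  then show "(f has_sum s) (V - {rt})" using has_sum_levels[OF t] s sums_unique2 by blast
qed (rule has_sum_levels)

lemma energy_has_sum_iff:
  assumes f: "integrable (nu rt) f"
  shows "(edge_energy f has_sum s) (V - {rt}) \<longleftrightarrow> em.avg_energy f gr sums s"
proof -
  interpret harmonic_average V rt up "nu rt" gr f "hx f" by (rule harmonic_average[OF f])
  have "em.ext_energy (hx f) gr = (\<lambda>n. \<Sum>x\<in>level (Suc n). edge_energy f x)" using ext_energy_eq by blast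
  then show ?thesis
    using energy_sums_iff[of s] has_sum_levels_iff[of "edge_energy f" s, OF edge_energy_nonneg] by simp
qed

lemma HD_domain_iff: "f \<in> HD_domain V rt up p \<longleftrightarrow> integrable (nu rt) f \<and> (\<exists>s. em.avg_energy f gr sums s)"
proof -
  have "f \<in> HD_domain V rt up p \<longleftrightarrow> integrable (nu rt) f \<and> edge_energy f summable_on (V - {rt})"
    by (simp add: HD_domain_def nu_def edge_energy_def[abs_def])
  then show ?thesis using energy_has_sum_iff[of f] by (auto simp: summable_on_def)
qed

lemma hx_add: assumes "integrable (nu rt) f" "integrable (nu rt) f'" "x \<in> V"
  shows "hx (\<lambda>\<xi>. f \<xi> + f' \<xi>) x = hx f x + hx f' x" "hx (\<lambda>\<xi>. f \<xi> - f' \<xi>) x = hx f x - hx f' x"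
  unfolding hx_nu using nu_integrable assms by auto

text \<open>Polarisation: the sum and the difference of two functions of the domain again have
  finite energy, and their quadratic identities are subtracted.\<close>

theorem HD_form_standard:
  assumes "f \<in> HD_domain V rt up p" "f' \<in> HD_domain V rt up p"
  shows "HD_form V rt up p f f' = standard_form V rt up gr (nu rt) f f'"
proof -
  have f: "integrable (nu rt) f" "integrable (nu rt) f'" using assms HD_domain_iff by auto
  have sm: "edge_energy f summable_on (V - {rt})" "edge_energy f' summable_on (V - {rt})"
    using assms by (auto simp: HD_domain_def edge_energy_def[abs_def])
  let ?a = "\<lambda>\<xi>. f \<xi> + f' \<xi>" and ?b = "\<lambda>\<xi>. f \<xi> - f' \<xi>"
  have ab: "edge_energy ?a x = ((hx f x - hx f (up x)) + (hx f' x - hx f' (up x)))^2 * a x"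
    "edge_energy ?b x = ((hx f x - hx f (up x)) - (hx f' x - hx f' (up x)))^2 * a x" if "x \<in> V - {rt}" for x
  proof -
    have "hx ?a x - hx ?a (up x) = (hx f x - hx f (up x)) + (hx f' x - hx f' (up x))"
      "hx ?b x - hx ?b (up x) = (hx f x - hx f (up x)) - (hx f' x - hx f' (up x))"
      using that up_V hx_add[OF f] by auto
    then show "edge_energy ?a x = ((hx f x - hx f (up x)) + (hx f' x - hx f' (up x)))^2 * a x"
      "edge_energy ?b x = ((hx f x - hx f (up x)) - (hx f' x - hx f' (up x)))^2 * a x"
      by (simp_all only: edge_energy_def)
  qed
  have sq: "(u + v)^2 * c \<le> 2 * (u^2 * c) + 2 * (v^2 * c)" "(u - v)^2 * c \<le> 2 * (u^2 * c) + 2 * (v^2 * c)" if "0 \<le> c" for u v c :: real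
  proof -
    have "0 \<le> (u - v)^2" "0 \<le> (u + v)^2" by auto
    then have "(u + v)^2 \<le> 2 * u^2 + 2 * v^2" "(u - v)^2 \<le> 2 * u^2 + 2 * v^2"
      by (auto simp: power2_eq_square algebra_simps)
    then show "(u + v)^2 * c \<le> 2 * (u^2 * c) + 2 * (v^2 * c)" "(u - v)^2 * c \<le> 2 * (u^2 * c) + 2 * (v^2 * c)"
      using mult_right_mono[OF _ that] by (fastforce simp: distrib_right)+
  qed
  have bound: "(\<lambda>x. 2 * edge_energy f x + 2 * edge_energy f' x) summable_on (V - {rt})"
    using sm by (intro summable_on_add summable_on_cmult_right)
  have bs: "edge_energy ?a x \<le> 2 * edge_energy f x + 2 * edge_energy f' x"
    "edge_energy ?b x \<le> 2 * edge_energy f x + 2 * edge_energy f' x" if x: "x \<in> V - {rt}" for x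
  proof -
    have "0 \<le> a x" using a_pos[of x] x by auto
    from sq[OF this] show "edge_energy ?a x \<le> 2 * edge_energy f x + 2 * edge_energy f' x"
      "edge_energy ?b x \<le> 2 * edge_energy f x + 2 * edge_energy f' x"
      unfolding ab[OF x] by (simp_all only: edge_energy_def)
  qed
  have "edge_energy ?a summable_on (V - {rt})" "edge_energy ?b summable_on (V - {rt})"
    by (rule summable_on_comparison_test[OF bound bs(1) edge_energy_nonneg]; assumption)
       (rule summable_on_comparison_test[OF bound bs(2) edge_energy_nonneg]; assumption)
  then obtain s t where st: "(edge_energy ?a has_sum s) (V - {rt})" "(edge_energy ?b has_sum t) (V - {rt})"
    by (auto simp: summable_on_def)
  have "((\<lambda>x. 1/4 * edge_energy ?a x + (-1/4) * edge_energy ?b x) has_sum (1/4 * s + (-1/4) * t)) (V - {rt})"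
    using st by (intro has_sum_add has_sum_cmult_right)
  then have "((\<lambda>x. (hx f x - hx f (up x)) * (hx f' x - hx f' (up x)) * a x) has_sum (1/4 * s + (-1/4) * t)) (V - {rt})"
    by (rule has_sum_cong[THEN iffD1, rotated]) (simp add: ab power2_eq_square algebra_simps)
  then have "HD_form V rt up p f f' = (s - t) / 4"
    by (simp add: HD_form_def tree_energy_def infsumI)
  moreover have "em.avg_energy ?a gr sums s" "em.avg_energy ?b gr sums t"
    using st energy_has_sum_iff f by auto
  ultimately show ?thesis using we.standard_form_polar[OF f, of s t] by simp
qed

end

section \<open>The jump kernel determines the ultrametric element\<close>

context end_measure
begin

lemma avg_indicator_ch:
  assumes u: "x \<in> ch u" and y: "dep y \<le> dep u"
  shows "avg (indicator (Cyl y)) x = avg (indicator (Cyl y)) u"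
proof -
  have V: "x \<in> V" "u \<in> V" using u ch_V ch_parent_V by auto
  have sub: "Cyl x \<subseteq> Cyl u" using Cyl_ch[OF V(2)] u by blast
  have val: "avg (indicator (Cyl y)) v = c" if "v \<in> V" "\<And>\<xi>. \<xi> \<in> Cyl v \<Longrightarrow> indicator (Cyl y) \<xi> = c" for v c
  proof -
    have "avg (indicator (Cyl y)) v = avg (\<lambda>_. c) v"
      unfolding avg_def using that by (intro arg_cong2[where f = "(/)"] set_lebesgue_integral_cong) auto
    then show ?thesis using that by (simp add: avg_const)
  qed
  have "Cyl u \<subseteq> Cyl y \<or> Cyl y \<inter> Cyl u = {}" using y by (rule Cyl_nested)
  then show ?thesis
  proof
    assume a: "Cyl u \<subseteq> Cyl y"
    have "avg (indicator (Cyl y)) x = 1" by (rule val) (use V sub a in auto)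
    moreover have "avg (indicator (Cyl y)) u = 1" by (rule val) (use V a in auto)
    ultimately show ?thesis by simp
  next
    assume a: "Cyl y \<inter> Cyl u = {}"
    have "avg (indicator (Cyl y)) x = 0" by (rule val) (use V sub a in \<open>auto simp: indicator_def\<close>)
    moreover have "avg (indicator (Cyl y)) u = 0" by (rule val) (use V a in \<open>auto simp: indicator_def\<close>)
    ultimately show ?thesis by simp
  qed
qed

text \<open>From level \<open>dep y\<close> on the averages of the indicator no longer change, so
  only finitely many terms survive. This puts cylinder indicators into the domain whatever
  \<open>g\<close> is.\<close>

lemma avg_energy_indicator_sums: "\<exists>s. avg_energy (indicator (Cyl y)) g sums s"
proof -
  have "avg_energy (indicator (Cyl y)) g n = 0" if n: "n \<notin> {..<dep y}" for n
  proof -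
    have "avg_energy (indicator (Cyl y)) g n = (\<integral>\<xi>. 0 \<partial>\<mu>)"
      unfolding avg_energy_def
    proof (rule integral_cong_ends)
      fix \<xi> assume xi: "\<xi> \<in> Ends"
      show "(avg (indicator (Cyl y)) (\<xi> (Suc n)) - avg (indicator (Cyl y)) (\<xi> n))^2 / g (\<xi> n) = 0"
        using avg_indicator_ch[OF ends_ch[OF xi, of n], of y] n by (simp add: ends_dep[OF xi])
    qed
    then show ?thesis by simp
  qed
  then have "avg_energy (indicator (Cyl y)) g sums (\<Sum>n\<in>{..<dep y}. avg_energy (indicator (Cyl y)) g n)"
    by (intro sums_finite) auto
  then show ?thesis by blast
qed

end

context weighted_ends
begin

text \<open>The product of the two differences is -1 on \<open>Cyl y\<close> times
  \<open>Cyl z\<close> and on its mirror image, and 0 elsewhere. There \<open>J\<close> is constant,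
  because all these pairs branch at \<open>u\<close>; the two copies cancel the factor 1/2.\<close>

lemma standard_form_siblings:
  assumes yz: "y \<in> ch u" "z \<in> ch u" "y \<noteq> z" and xi: "\<xi> \<in> Cyl u"
  shows "standard_form V rt up g \<mu> (indicator (Cyl y)) (indicator (Cyl z))
    = - (mu y * mu z * (\<Sum>i\<le>dep u. step (\<xi> i) / mu (\<xi> i)))"
proof -
  let ?k = "\<Sum>i\<le>dep u. step (\<xi> i) / mu (\<xi> i)"
  have d: "dep y = Suc (dep u)" "dep z = Suc (dep u)" "up y = u" "up z = u" using yz dep_ch by (auto simp: ch_iff)
  have J: "J \<alpha> \<beta> = ?k" if ab: "\<alpha> \<in> Cyl y \<and> \<beta> \<in> Cyl z \<or> \<alpha> \<in> Cyl z \<and> \<beta> \<in> Cyl y" for \<alpha> \<beta>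
  proof -
    have E: "\<alpha> \<in> Ends" "\<beta> \<in> Ends" "\<xi> \<in> Ends" "\<xi> (dep u) = u" using ab xi by (auto simp: Cyl_iff)
    have S: "\<alpha> (Suc (dep u)) \<noteq> \<beta> (Suc (dep u))" using ab yz(3) d by (auto simp: Cyl_iff)
    have U: "\<alpha> (dep u) = u" "\<beta> (dep u) = u" using ab d ends_up[OF E(1), of "dep u"] ends_up[OF E(2), of "dep u"] by (auto simp: Cyl_iff)
    have "\<alpha> i = \<beta> i \<longleftrightarrow> i \<le> dep u" for i
      using ends_agree[OF E(1,2), of "dep u" i] ends_agree[OF E(1,2), of i "Suc (dep u)"] U S by (metis not_less_eq_eq)
    moreover have "\<alpha> \<noteq> \<beta>" using S by auto
    ultimately have "J \<alpha> \<beta> = (\<Sum>i\<le>dep u. step (\<alpha> i) / mu (\<alpha> i))" using E by (intro jump_kernel_eq)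
    also have "\<dots> = ?k"
      using ends_agree[OF E(1,3), of "dep u"] U E by (intro sum.cong) auto
    finally show ?thesis .
  qed
  have dj: "Cyl y \<inter> Cyl z = {}" using Cyl_disjoint[of y z] d yz by simp
  have eq: "(indicator (Cyl y) (fst w) - indicator (Cyl y) (snd w)) * (indicator (Cyl z) (fst w) - indicator (Cyl z) (snd w)) * J (fst w) (snd w)
    = - ?k * (indicator (Cyl y \<times> Cyl z) w + indicator (Cyl z \<times> Cyl y) w)" for w
    using J[of "fst w" "snd w"] dj
    by (cases w) (auto simp: indicator_def jump_kernel_def)
  interpret pp: pair_prob_space \<mu> \<mu> ..
  have ms: "measure (\<mu> \<Otimes>\<^sub>M \<mu>) (Cyl y' \<times> Cyl z') = mu y' * mu z'" for y' z'
    by (simp add: measure_def emeasure_pair_measure_Times enn2real_mult)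
  have int: "integrable (\<mu> \<Otimes>\<^sub>M \<mu>) (indicator (Cyl y' \<times> Cyl z') :: _ \<Rightarrow> real)" for y' z'
    by (simp add: integrable_indicator_iff pp.emeasure_eq_measure)
  have sp: "A \<times> B \<inter> space (\<mu> \<Otimes>\<^sub>M \<mu>) = A \<times> B" if "A \<subseteq> Ends" "B \<subseteq> Ends" for A B :: "(nat \<Rightarrow> 'v) set"
    using that by (auto simp: space_pair)
  have "(\<integral>w. (indicator (Cyl y) (fst w) - indicator (Cyl y) (snd w)) * (indicator (Cyl z) (fst w) - indicator (Cyl z) (snd w)) * J (fst w) (snd w) \<partial>(\<mu> \<Otimes>\<^sub>M \<mu>))
    = - ?k * (measure (\<mu> \<Otimes>\<^sub>M \<mu>) (Cyl y \<times> Cyl z) + measure (\<mu> \<Otimes>\<^sub>M \<mu>) (Cyl z \<times> Cyl y))"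
    unfolding eq using int sp[OF Cyl_sub Cyl_sub] by simp
  then show ?thesis unfolding standard_form_def ms by (simp add: algebra_simps)
qed

end

text \<open>Each vertex of a ray has two children, so siblings reveal all partial sums of the kernel
  along the ray. Their differences give the values of \<open>step\<close>, and these add up to
  1/g.\<close>

lemma (in end_measure) ultra_determined:
  assumes g: "ultra g" "ultra g'"
    and eq: "\<And>u y z. y \<in> ch u \<Longrightarrow> z \<in> ch u \<Longrightarrow> y \<noteq> z \<Longrightarrow>
       standard_form V rt up g \<mu> (indicator (Cyl y)) (indicator (Cyl z)) = standard_form V rt up g' \<mu> (indicator (Cyl y)) (indicator (Cyl z))"
    and x: "x \<in> V"
  shows "g x = g' x"
proof -
  interpret G: weighted_ends V rt up \<mu> g by unfold_locales (rule g(1))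
  interpret H: weighted_ends V rt up \<mu> g' by unfold_locales (rule g(2))
  obtain \<xi> where xi: "\<xi> \<in> Cyl x" using Cyl_nonempty[OF x] by blast
  then have E: "\<xi> \<in> Ends" "\<xi> (dep x) = x" by (auto simp: Cyl_iff)
  have S: "(\<Sum>i\<le>n. G.step (\<xi> i) / mu (\<xi> i)) = (\<Sum>i\<le>n. H.step (\<xi> i) / mu (\<xi> i))" for n
  proof -
    obtain y z where yz: "y \<in> ch (\<xi> n)" "z \<in> ch (\<xi> n)" "y \<noteq> z" using two_children[OF ends_V[OF E(1)]] by blast
    have "mu y * mu z \<noteq> 0" using mu_neq_0 yz ch_V by simp
    then show ?thesis
      using eq[OF yz] G.standard_form_siblings[OF yz Cyl_ends[OF E(1)]] H.standard_form_siblings[OF yz Cyl_ends[OF E(1)]]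
      by (simp add: ends_dep[OF E(1)])
  qed
  have "G.step (\<xi> i) = H.step (\<xi> i)" for i
  proof -
    have "G.step (\<xi> i) / mu (\<xi> i) = H.step (\<xi> i) / mu (\<xi> i)"
      using S[of i] S[of "i - 1"] by (cases i) auto
    then show ?thesis using mu_neq_0[OF ends_V[OF E(1)], of i] by simp
  qed
  then have "1 / g (\<xi> (dep x)) = 1 / g' (\<xi> (dep x))"
    using G.sum_step[OF E(1), of "dep x"] H.sum_step[OF E(1), of "dep x"] by simp
  then show ?thesis by (simp add: E)
qed

section \<open>Existence and uniqueness\<close>

context rtree
begin

lemma ultra_le_T: assumes g: "ultra g" and x: "x \<in> V" shows "y \<in> T x \<Longrightarrow> g y \<le> g x"
proof (induction "dep y" arbitrary: y)
  case 0
  then have "y = x" using T_up[OF x T_V[OF 0(2)]] dep_0_iff[OF T_V[OF 0(2)]] by auto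
  then show ?case by simp
next
  case (Suc n)
  have yV: "y \<in> V" using Suc.prems T_V by blast
  show ?case
  proof (cases "y = x")
    case False
    then have u: "y \<noteq> rt" "up y \<in> T x" using T_up[OF x yV] Suc.prems by auto
    then have "g (up y) \<le> g x" using Suc dep_Suc[OF yV u(1)] by simp
    moreover have "g y < g (up y)" using g yV u by (auto simp: ultrametric_element_def)
    ultimately show ?thesis by simp
  qed simp
qed

text \<open>Compactness (Koenig): an infinite superlevel set would contain a ray along which \<open>g\<close> does not vanish.\<close>

lemma ultra_finite: assumes g: "ultra g" and e: "0 < e" shows "finite {x\<in>V. e \<le> g x}"
proof (rule ccontr)
  assume inf: "infinite {x\<in>V. e \<le> g x}"
  define B where "B x \<longleftrightarrow> x \<in> V \<and> infinite {y \<in> T x. e \<le> g y}" for x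
  have "B rt" using inf by (simp add: B_def T_rt)
  have st: "\<exists>c. B c \<and> c \<in> ch x" if Bx: "B x" for x
  proof (rule ccontr)
    assume no: "\<nexists>c. B c \<and> c \<in> ch x"
    have xV: "x \<in> V" using Bx by (simp add: B_def)
    have "finite {y \<in> T c. e \<le> g y}" if "c \<in> ch x" for c using no that ch_V by (auto simp: B_def)
    then have "finite (insert x (\<Union>c\<in>ch x. {y \<in> T c. e \<le> g y}))" using finite_ch by auto
    moreover have "{y \<in> T x. e \<le> g y} \<subseteq> insert x (\<Union>c\<in>ch x. {y \<in> T c. e \<le> g y})" using T_ch[OF xV] by blast
    ultimately have "finite {y \<in> T x. e \<le> g y}" by (rule finite_subset[rotated])
    then show False using Bx by (simp add: B_def)
  qed
  define \<xi> where "\<xi> = rec_nat rt (\<lambda>_ x. SOME c. B c \<and> c \<in> ch x)"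
  have xi: "B (\<xi> n)" for n
    by (induction n) (use \<open>B rt\<close> someI_ex[OF st] in \<open>auto simp: \<xi>_def\<close>)
  have ch: "\<xi> (Suc n) \<in> ch (\<xi> n)" for n
    using someI_ex[OF st[OF xi[of n]]] by (simp add: \<xi>_def)
  have "\<xi> 0 = rt" by (simp add: \<xi>_def)
  then have "\<xi> \<in> Ends" using ch by (auto simp: ends_def ch_iff)
  then have "(\<lambda>n. g (\<xi> n)) \<longlonglongrightarrow> 0" using g by (simp add: ultrametric_element_def)
  moreover have "e \<le> g (\<xi> n)" for n
  proof -
    have "{y \<in> T (\<xi> n). e \<le> g y} \<noteq> {}" using xi[of n] by (metis B_def finite.emptyI)
    then obtain y where "y \<in> T (\<xi> n)" "e \<le> g y" by blast
    then show ?thesis using ultra_le_T[OF g] xi[of n] unfolding B_def by fastforce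
  qed
  ultimately have "e \<le> 0" by (intro LIMSEQ_le_const) auto
  then show False using e by simp
qed

text \<open>The Green function is identified on \<open>V\<close> only, while the form takes
  functions on the whole type; the values it uses are at the root and at confluents of ends.\<close>

lemma standard_form_cong:
  assumes g: "\<And>x. x \<in> V \<Longrightarrow> g x = g' x" and s: "sets M = sets BE"
  shows "standard_form V rt up g M f f' = standard_form V rt up g' M f f'"
proof -
  have c: "g (confluent \<xi> \<eta>) = g' (confluent \<xi> \<eta>)" if "\<xi> \<in> Ends" for \<xi> \<eta>
    using that by (auto simp: confluent_def intro!: g ends_V)
  then have b: "um_ball V rt up g \<xi> r = um_ball V rt up g' \<xi> r" if "\<xi> \<in> Ends" for \<xi> r
    using that by (auto simp: um_ball_def)
  have "jump_kernel V rt up g M \<xi> \<eta> = jump_kernel V rt up g' M \<xi> \<eta>" if "\<xi> \<in> Ends" for \<xi> \<eta>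
    unfolding jump_kernel_def using that by (simp add: b c g)
  moreover have "space M = Ends" using sets_eq_imp_space_eq[OF s] by simp
  ultimately show ?thesis
    unfolding standard_form_def by (intro arg_cong2[where f = "(*)"] Bochner_Integration.integral_cong refl) (auto simp: space_pair_measure)
qed

end

section \<open>Conductances prescribed by an ultrametric element\<close>

context end_measure
begin

text \<open>The formula of \<open>nu_rt_Cyl\<close> solved for the conductance; the weight of an
  edge is indexed by its lower vertex.\<close>

definition edge_weight :: "('v \<Rightarrow> real) \<Rightarrow> 'v \<Rightarrow> real" where
  "edge_weight g x = mu x / (g (up x) - g x)"

text \<open>The value 0 off neighbours matters: uniqueness of the walk is equality of functions on
  the whole type, also outside \<open>V\<close>.\<close>

definition nb_weight :: "('v \<Rightarrow> real) \<Rightarrow> 'v \<Rightarrow> 'v \<Rightarrow> real" where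
  "nb_weight g x y = (if y \<in> ch x then edge_weight g y else if y \<in> nb x then edge_weight g x else 0)"

definition weight_walk :: "('v \<Rightarrow> real) \<Rightarrow> 'v \<Rightarrow> 'v \<Rightarrow> real" where
  "weight_walk g x y = nb_weight g x y / (\<Sum>z\<in>nb x. nb_weight g x z)"

lemma nb_cases: "y \<in> nb x \<Longrightarrow> y \<in> ch x \<or> (x \<noteq> rt \<and> y = up x \<and> x \<in> ch y)"
  by (auto simp: nbrs_def adj_def ch_iff)

lemma ch_nb: "y \<in> ch x \<Longrightarrow> y \<in> nb x"
  using ch_parent_V[of y x] by (simp add: nbrs_def adj_def ch_iff)

lemma edge_weight_cong: "(\<And>x. x \<in> V \<Longrightarrow> g x = g' x) \<Longrightarrow> x \<in> V \<Longrightarrow> x \<noteq> rt \<Longrightarrow> edge_weight g x = edge_weight g' x"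
  using up_V by (simp add: edge_weight_def)

lemma weight_walk_cong: assumes "\<And>x. x \<in> V \<Longrightarrow> g x = g' x" shows "weight_walk g = weight_walk g'"
proof -
  have "nb_weight g x y = nb_weight g' x y" for x y
    using edge_weight_cong[of g g', OF assms] nb_cases[of y x] nb_dom[of y x] by (auto simp: nb_weight_def ch_iff)
  then show ?thesis by (simp add: weight_walk_def fun_eq_iff)
qed

end

text \<open>The weight of an edge is m(x) p(x,y) from either end, so m(x) is the total weight at x
  and p the normalised weight; at the root m is 1.\<close>

lemma (in boundary_walk) walk_eq_weight_walk: "p = em.weight_walk gr" and edge_weight_sum: "(\<Sum>y\<in>ch rt. em.edge_weight gr y) = 1"
proof -
  have ea: "em.edge_weight gr x = a x" if "x \<in> V" "x \<noteq> rt" for x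
    using nu_rt_Cyl[OF that] gr_up[OF that] by (simp add: em.edge_weight_def)
  have w: "em.nb_weight gr x y = m x * p x y" if "y \<in> nb x" for x y
  proof (cases "y \<in> ch x")
    case True
    then show ?thesis using ea[of y] a_ch by (simp add: em.nb_weight_def ch_iff)
  next
    case False
    then have "x \<noteq> rt" "y = up x" using em.nb_cases[OF that] by auto
    then show ?thesis using ea[of x] nb_dom[OF that] that False by (simp add: em.nb_weight_def conductance_def)
  qed
  have sum_w: "(\<Sum>z\<in>nb x. em.nb_weight gr x z) = m x" if "x \<in> V" for x
    using p_sum[OF that] by (simp add: w sum_distrib_left[symmetric])
  show "p = em.weight_walk gr"
  proof (intro ext)
    fix x y
    show "p x y = em.weight_walk gr x y"
    proof (cases "y \<in> nb x")
      case True
      then show ?thesis using sum_w[of x] m_pos[of x] nb_dom[OF True] by (simp add: em.weight_walk_def w)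
    next
      case False
      then have "y \<notin> ch x" using em.ch_nb by blast
      then show ?thesis using False by (simp add: em.weight_walk_def em.nb_weight_def p_eq_0)
    qed
  qed
  have "(\<Sum>y\<in>ch rt. em.edge_weight gr y) = (\<Sum>z\<in>nb rt. em.nb_weight gr rt z)"
    using nb_eq[OF rt_V] by (intro sum.cong) (auto simp: em.nb_weight_def)
  then show "(\<Sum>y\<in>ch rt. em.edge_weight gr y) = 1" by (simp add: sum_w m_rt)
qed

text \<open>Cylinder indicators belong to the domain, so the form determines the Green function as C
  phi. The edge weights of C phi are those of phi divided by C, and summing to 1 at the root they
  give C.\<close>

lemma (in boundary_walk) identify:
  assumes phi: "ultra \<phi>" and C: "0 < C"
    and eq: "\<And>f f'. f \<in> HD_domain V rt up p \<Longrightarrow> f' \<in> HD_domain V rt up p \<Longrightarrow>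
      HD_form V rt up p f f' = standard_form V rt up (\<lambda>x. C * \<phi> x) (nu rt) f f'"
  shows "C = (\<Sum>y\<in>ch rt. em.edge_weight \<phi> y)" and "p = em.weight_walk (\<lambda>x. C * \<phi> x)"
proof -
  have uC: "ultra (\<lambda>x. C * \<phi> x)"
    using phi C tendsto_mult_right_zero[of _ sequentially C] by (auto simp: ultrametric_element_def)
  have dom: "indicator (Cyl y) \<in> HD_domain V rt up p" for y
    using HD_domain_iff em.avg_energy_indicator_sums em.integrable_ind by auto
  have gC: "gr x = C * \<phi> x" if "x \<in> V" for x
    using em.ultra_determined[OF gr_ultra uC _ that] HD_form_standard[OF dom dom] eq[OF dom dom] by metis
  show "p = em.weight_walk (\<lambda>x. C * \<phi> x)" using walk_eq_weight_walk em.weight_walk_cong[OF gC] by simp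
  have "1 = (\<Sum>y\<in>ch rt. em.edge_weight (\<lambda>x. C * \<phi> x) y)"
    unfolding edge_weight_sum[symmetric] by (intro sum.cong refl em.edge_weight_cong gC) (auto simp: ch_iff)
  also have "\<dots> = (\<Sum>y\<in>ch rt. em.edge_weight \<phi> y / C)"
    by (intro sum.cong refl) (simp add: em.edge_weight_def right_diff_distrib[symmetric])
  finally show "C = (\<Sum>y\<in>ch rt. em.edge_weight \<phi> y)" using C by (simp add: sum_divide_distrib[symmetric])
qed

section \<open>Existence: the walk with the prescribed conductances\<close>

locale conductance_walk = weighted_ends V rt up \<mu> g
  for V :: "'v set" and rt up \<mu> g +
  assumes norm: "(\<Sum>y\<in>ch rt. edge_weight g y) = 1"
begin

abbreviation "pp \<equiv> weight_walk g"
abbreviation "M x \<equiv> \<Sum>z\<in>nb x. nb_weight g x z"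

lemma edge_weight_pos: "x \<in> V \<Longrightarrow> x \<noteq> rt \<Longrightarrow> 0 < edge_weight g x"
  using mu_pos g_up by (simp add: edge_weight_def)

lemma nb_weight_pos: "y \<in> nb x \<Longrightarrow> 0 < nb_weight g x y"
  using nb_cases[of y x] edge_weight_pos nb_dom[of y x] by (auto simp: nb_weight_def ch_iff)

lemma nb_weight_0: "y \<notin> nb x \<Longrightarrow> nb_weight g x y = 0"
  using ch_nb by (auto simp: nb_weight_def)

lemma nb_weight_ch: "y \<in> ch x \<Longrightarrow> nb_weight g x y = edge_weight g y" by (simp add: nb_weight_def)
lemma nb_weight_up: "x \<in> V \<Longrightarrow> x \<noteq> rt \<Longrightarrow> nb_weight g x (up x) = edge_weight g x" using up_notin_ch[of x] nb_eq[of x] by (simp add: nb_weight_def)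

lemma M_pos: "x \<in> V \<Longrightarrow> 0 < M x"
  using finite_nb[of x] nb_weight_pos ch_nonempty[of x] ch_nb by (intro sum_pos) blast+

lemma M_rt: "M rt = 1"
  unfolding norm[symmetric] using nb_eq[OF rt_V] by (intro sum.cong) (auto simp: nb_weight_ch)

sublocale W: walk V rt up pp
proof unfold_locales
  have "0 \<le> pp x y" for x y
    using nb_weight_pos nb_weight_0 unfolding weight_walk_def by (intro divide_nonneg_nonneg sum_nonneg) (metis less_imp_le order_refl)+
  moreover have "0 < pp x y \<longleftrightarrow> adj V rt up x y" for x y
    using nb_weight_pos[of y x] nb_weight_0[of y x] M_pos[of x] nb_dom[of y x] by (cases "y \<in> nb x") (auto simp: weight_walk_def adj_iff_nb)
  moreover have "(\<Sum>y\<in>nb x. pp x y) = 1" if "x \<in> V" for x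
    using M_pos[OF that] by (simp add: weight_walk_def sum_divide_distrib[symmetric])
  ultimately show "nn_random_walk V rt up pp" by (simp add: nn_random_walk_def)
qed

text \<open>The flow of \<open>g\<close> from \<open>x\<close> to a child y is \<open>mu y\<close>,
  in total \<open>mu x\<close> by additivity of the measure, and the flow from x^- to
  \<open>x\<close> is \<open>mu x\<close> too. They cancel except at the root, where a source of
  strength 1 remains.\<close>

lemma g_harmonic: assumes x: "x \<in> V" shows "g x = (if x = rt then 1 else 0) + (\<Sum>y\<in>nb x. pp x y * g y)"
proof -
  have pM: "nb_weight g x y = M x * pp x y" for y using M_pos[OF x] by (simp add: weight_walk_def)
  have "(\<Sum>y\<in>nb x. nb_weight g x y * g y) = M x * (\<Sum>y\<in>nb x. pp x y * g y)"
    unfolding sum_distrib_left[of "M x"] by (intro sum.cong refl) (subst pM, simp only: mult.assoc)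
  then have "M x * g x - M x * (\<Sum>y\<in>nb x. pp x y * g y) = (\<Sum>y\<in>nb x. nb_weight g x y * (g x - g y))"
    by (simp add: sum_distrib_right right_diff_distrib sum_subtractf)
  also have "\<dots> = (if x = rt then 0 else edge_weight g x * (g x - g (up x))) + (\<Sum>y\<in>ch x. edge_weight g y * (g x - g y))"
    using sum_nb[OF x, of "\<lambda>y. nb_weight g x y * (g x - g y)"] nb_weight_up[OF x] by (auto simp: nb_weight_ch cong: sum.cong)
  also have "(\<Sum>y\<in>ch x. edge_weight g y * (g x - g y)) = mu x"
    unfolding mu_ch[OF x]
  proof (intro sum.cong refl)
    fix y assume "y \<in> ch x"
    then show "edge_weight g y * (g x - g y) = mu y" using g_up[of y] by (simp add: edge_weight_def ch_iff)
  qed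
  also have "(if x = rt then 0 else edge_weight g x * (g x - g (up x))) + mu x = (if x = rt then 1 else 0)"
    using g_up[OF x] by (auto simp: edge_weight_def divide_simps algebra_simps)
  finally have "M x * (g x - (\<Sum>y\<in>nb x. pp x y * g y)) = (if x = rt then 1 else 0)" by (simp add: right_diff_distrib)
  then show ?thesis using M_pos[OF x] M_rt by (auto split: if_splits)
qed

text \<open>\<open>g\<close> is positive and solves the equation of the Green function; iterating
  that equation bounds all partial sums.\<close>

lemma tn_sum_le: "x \<in> V \<Longrightarrow> (\<Sum>k<n. W.tn k x rt) \<le> g x"
proof (induction n arbitrary: x)
  case 0
  then show ?case using g_pos by (simp add: less_imp_le)
next
  case (Suc n)
  have "(\<Sum>k<Suc n. W.tn k x rt) = (if x = rt then 1 else 0) + (\<Sum>k<n. \<Sum>y\<in>nb x. pp x y * W.tn k y rt)"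
    by (simp add: sum.lessThan_Suc_shift del: sum.lessThan_Suc)
  also have "(\<Sum>k<n. \<Sum>y\<in>nb x. pp x y * W.tn k y rt) = (\<Sum>y\<in>nb x. pp x y * (\<Sum>k<n. W.tn k y rt))"
    by (subst sum.swap) (simp add: sum_distrib_left)
  finally have "(\<Sum>k<Suc n. W.tn k x rt) = (if x = rt then 1 else 0) + (\<Sum>y\<in>nb x. pp x y * (\<Sum>k<n. W.tn k y rt))" .
  moreover have "(\<Sum>y\<in>nb x. pp x y * (\<Sum>k<n. W.tn k y rt)) \<le> (\<Sum>y\<in>nb x. pp x y * g y)"
    using Suc.IH nb_V by (intro sum_mono mult_left_mono) auto
  ultimately show ?case using g_harmonic[OF Suc.prems] by linarith
qed

lemma tn_mult_le: "x \<in> V \<Longrightarrow> W.tn n x y * W.tn k y z \<le> W.tn (n + k) x z"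
proof (induction n arbitrary: x)
  case 0
  then show ?case using W.tn_nonneg by simp
next
  case (Suc n)
  have "W.tn (Suc n) x y * W.tn k y z = (\<Sum>v\<in>nb x. pp x v * (W.tn n v y * W.tn k y z))"
    by (simp add: sum_distrib_right mult.assoc)
  also have "\<dots> \<le> (\<Sum>v\<in>nb x. pp x v * W.tn (n + k) v z)"
    using Suc.IH nb_V by (intro sum_mono mult_left_mono) auto
  finally show ?case by simp
qed

text \<open>Visits to the root are controlled by \<open>g\<close>. For another vertex
  \<open>y\<close>, each visit is followed with a fixed positive probability by an arrival at the
  root \<open>dep y\<close> steps later.\<close>

sublocale TW: transient_walk V rt up pp
proof unfold_locales
  have rts: "summable (\<lambda>n. W.tn n x rt)" if "x \<in> V" for x
    using tn_sum_le[OF that] W.tn_nonneg by (intro summableI_nonneg_bounded) auto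
  have "summable (\<lambda>n. W.tn n x y)" if x: "x \<in> V" and y: "y \<in> V" for x y
  proof -
    let ?t = "W.tn (dep y) y rt"
    have t: "0 < ?t" by (rule W.tn_dep_pos[OF y])
    have "summable (\<lambda>n. W.tn (n + dep y) x rt)" using rts[OF x] by (rule summable_ignore_initial_segment)
    then have s: "summable (\<lambda>n. W.tn (n + dep y) x rt / ?t)" by (rule summable_divide)
    show ?thesis
    proof (rule summable_comparison_test'[OF s])
      show "norm (W.tn n x y) \<le> W.tn (n + dep y) x rt / ?t" for n
        using tn_mult_le[OF x, of n y "dep y" rt] W.tn_nonneg[of n x y] t by (simp add: field_simps)
    qed
  qed
  then show "transient V rt up pp" by (simp add: transient_def)
qed

text \<open>The Green function is \<open>g\<close>: the difference is harmonic, nonnegative and below \<open>g\<close>, so a positive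
  value would force it to attain a maximum, and the maximum would spread to all descendants.\<close>

lemma green_eq: assumes x0: "x0 \<in> V" shows "TW.gr x0 = g x0"
proof -
  define u where "u x = g x - TW.gr x" for x
  have u0: "0 \<le> u x" if "x \<in> V" for x
    using suminf_le_const[OF TW.tn_summable[OF that rt_V] tn_sum_le[OF that]] by (simp add: u_def TW.gr_def green_def)
  have harm: "u x = (\<Sum>y\<in>nb x. pp x y * u y)" if "x \<in> V" for x
    using g_harmonic[OF that] TW.gr_harmonic[OF that] by (simp add: u_def right_diff_distrib sum_subtractf)
  have "u x0 \<le> 0"
  proof (rule ccontr)
    assume "\<not> u x0 \<le> 0"
    then have pos: "0 < u x0" by simp
    \<comment> \<open>By \<open>ultra_finite\<close> this set is finite, so the supremum of
      \<open>u\<close> over the infinite set \<open>V\<close> is attained.\<close>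
    define S where "S = {x\<in>V. u x0 \<le> u x}"
    have "u x \<le> g x" if "x \<in> V" for x using TW.gr_pos[OF that] by (simp add: u_def)
    then have "S \<subseteq> {x\<in>V. u x0 \<le> g x}" unfolding S_def by fastforce
    then have S: "finite S" "x0 \<in> S" using ultra_finite[OF g pos] x0 finite_subset by (auto simp: S_def)
    define mx where "mx = Max (u ` S)"
    have mx: "u x \<le> mx" if "x \<in> V" for x
    proof (cases "x \<in> S")
      case False
      then have "u x < u x0" using that by (simp add: S_def)
      moreover have "u x0 \<le> mx" unfolding mx_def using S by (intro Max_ge) auto
      ultimately show ?thesis by simp
    qed (use S in \<open>auto simp: mx_def\<close>)
    define A where "A = {x\<in>V. u x = mx}"
    have "mx \<in> u ` S" unfolding mx_def using S by (intro Max_in) auto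
    then have "A \<noteq> {}" by (auto simp: A_def S_def)
    have "u x0 \<le> mx" by (rule mx[OF x0])
    then have "A \<subseteq> S" by (auto simp: A_def S_def)
    then have fA: "finite A" using S finite_subset by blast
    have spread: "y \<in> A" if x: "x \<in> A" and y: "y \<in> ch x" for x y
    proof -
      have xV: "x \<in> V" "u x = mx" using x by (auto simp: A_def)
      have ynb: "y \<in> nb x" using y by (rule ch_nb)
      have "(\<Sum>z\<in>nb x. pp x z * (mx - u z)) = mx * (\<Sum>z\<in>nb x. pp x z) - (\<Sum>z\<in>nb x. pp x z * u z)"
        by (simp add: sum_distrib_left algebra_simps sum_subtractf)
      also have "\<dots> = 0" using W.p_sum[OF xV(1)] harm[OF xV(1)] xV by simp
      finally have "pp x y * (mx - u y) = 0"
        using sum_nonneg_eq_0_iff[OF finite_nb[OF xV(1)], of "\<lambda>z. pp x z * (mx - u z)"] mx nb_V ynb by auto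
      then show ?thesis using W.p_pos_iff[of x y] ynb nb_V[OF ynb] by (auto simp: A_def)
    qed
    \<comment> \<open>A deepest maximum point; its children would be maximum points that are deeper
      still.\<close>
    obtain x where x: "x \<in> A" "dep x = Max (dep ` A)"
    proof -
      have "Max (dep ` A) \<in> dep ` A" using fA \<open>A \<noteq> {}\<close> by (intro Max_in) auto
      then show ?thesis using that by (metis imageE)
    qed
    obtain y where y: "y \<in> ch x" using ch_nonempty x by (auto simp: A_def)
    then have "dep y \<le> Max (dep ` A)" using spread[OF x(1) y] fA by (intro Max_ge) auto
    then show False using dep_ch[OF y] x by simp
  qed
  then show ?thesis using u0[OF x0] by (simp add: u_def)
qed

sublocale BW: boundary_walk V rt up pp
proof unfold_locales
  show "hit_prob V rt up pp x (up x) < 1" if "x \<in> V" "x \<noteq> rt" for x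
    using TW.F_eq[OF that] green_eq g_up[OF that] g_pos up_V that by simp
  show "finite {x \<in> V. e \<le> green V rt up pp x rt}" if "0 < e" for e
  proof -
    have "{x \<in> V. e \<le> green V rt up pp x rt} = {x\<in>V. e \<le> g x}" using green_eq by (auto simp: TW.gr_def)
    then show ?thesis using ultra_finite[OF g that] by simp
  qed
qed

text \<open>Detailed balance carries the equality down from the root, where \<open>norm\<close>
  makes the total weight 1.\<close>

lemma m_eq: "x \<in> V \<Longrightarrow> TW.m x = M x"
proof (induction "dep x" arbitrary: x)
  case 0
  then show ?case using dep_0_iff TW.m_rt M_rt by simp
next
  case (Suc n)
  have r: "x \<noteq> rt" using Suc by auto
  note u = up_V[OF Suc.prems r]
  have IH: "TW.m (up x) = M (up x)" using Suc.hyps u dep_Suc[OF Suc.prems r] by simp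
  have "TW.m x * (edge_weight g x / M x) = M (up x) * (edge_weight g x / M (up x))"
    using TW.m_up[OF Suc.prems r] nb_weight_up[OF Suc.prems r] nb_weight_ch[OF ch_up[OF Suc.prems r]] by (simp add: IH weight_walk_def)
  then show ?case using M_pos[OF Suc.prems] M_pos[OF u] edge_weight_pos[OF Suc.prems r] by (simp add: field_simps)
qed

text \<open>The conductances were chosen so that the formula of \<open>nu_rt_Cyl\<close> returns the
  prescribed masses, once \<open>g\<close> is known to be the Green function.\<close>

lemma nu_eq_mu: "TW.nu rt = \<mu>"
proof (rule measure_eqI_Cyl)
  show "sets (TW.nu rt) = sets BE" by (rule TW.sets_nu) simp
  show "sets \<mu> = sets BE" by (rule sets_mu)
  show "emeasure (TW.nu rt) Ends \<noteq> \<infinity>" by simp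
  fix x assume x: "x \<in> V"
  show "emeasure (TW.nu rt) (Cyl x) = emeasure \<mu> (Cyl x)"
  proof (cases "x = rt")
    case True
    have "emeasure (TW.nu rt) Ends = 1" "emeasure \<mu> Ends = 1"
      using BW.em.emeasure_space_1 emeasure_space_1 TW.sets_nu[of rt, THEN sets_eq_imp_space_eq] by simp_all
    then show ?thesis by (simp add: True Cyl_rt)
  next
    case False
    have "measure (TW.nu rt) (Cyl x) = TW.a x * (g (up x) - g x)"
      using TW.nu_rt_Cyl[OF x False] green_eq x up_V[OF x False] by simp
    also have "TW.a x = edge_weight g x"
      using m_eq[OF x] M_pos[OF x] nb_weight_up[OF x False] by (simp add: conductance_def weight_walk_def)
    also have "edge_weight g x * (g (up x) - g x) = mu x" using g_up[OF x False] by (simp add: edge_weight_def)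
    finally show ?thesis by (simp add: BW.em.emeasure_eq_measure emeasure_eq_measure)
  qed
qed

lemma form_eq:
  assumes "f \<in> HD_domain V rt up pp" "f' \<in> HD_domain V rt up pp"
  shows "HD_form V rt up pp f f' = standard_form V rt up g \<mu> f f'"
  using BW.HD_form_standard[OF assms] standard_form_cong[of TW.gr g \<mu>, OF green_eq sets_mu] by (simp add: nu_eq_mu)

end

theorem theorem4p3:
  fixes V :: "'v set" and rt :: 'v and up :: "'v \<Rightarrow> 'v"
    and \<phi> :: "'v \<Rightarrow> real" and \<mu> :: "(nat \<Rightarrow> 'v) measure"
  assumes tree: "rooted_tree V rt up"
    and lf: "locally_finite V rt up"
    and inf: "infinite V"
    and deg: "\<forall>x\<in>V. forward_degree V rt up x \<ge> 2"
    and um: "ultrametric_element V rt up \<phi>"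
    and borel: "sets \<mu> = sets (ends_borel V rt up)"
    and prob: "prob_space \<mu>"
    and supp: "measure_support V rt up \<mu> = ends V rt up"
  shows "\<exists>!(C, p). C > 0 \<and> nn_random_walk V rt up p \<and> transient V rt up p \<and>
           (\<forall>x\<in>V - {rt}. hit_prob V rt up p x (up x) < 1) \<and>
           (\<forall>\<epsilon>>0. finite {x \<in> V. green V rt up p x rt \<ge> \<epsilon>}) \<and>
           limit_distribution V rt up p rt = \<mu> \<and>
           (\<forall>\<phi>' \<psi>'. \<phi>' \<in> HD_domain V rt up p \<longrightarrow> \<psi>' \<in> HD_domain V rt up p \<longrightarrow>
              HD_form V rt up p \<phi>' \<psi>' = standard_form V rt up (\<lambda>x. C * \<phi> x) \<mu> \<phi>' \<psi>')"
proof -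
  interpret rtree V rt up using tree lf deg by unfold_locales
  interpret end_measure V rt up \<mu>
  proof (intro end_measure.intro end_measure_axioms.intro rtree_axioms prob borel)
    fix x assume x: "x \<in> V"
    then obtain \<xi> where xi: "\<xi> \<in> Cyl x" using Cyl_nonempty by blast
    then have "\<xi> \<in> measure_support V rt up \<mu>" using supp Cyl_sub by blast
    then have "0 < emeasure \<mu> (Cyl x)" using open_Cyl xi by (auto simp: measure_support_def)
    then show "0 < measure \<mu> (Cyl x)"
      using prob_space.finite_measure[OF prob, THEN finite_measure.emeasure_eq_measure] by simp
  qed
  \<comment> \<open>The scale at which the edge weights of C phi at the root add up to 1.\<close>
  define C where "C = (\<Sum>y\<in>ch rt. edge_weight \<phi> y)"
  have pos: "0 < edge_weight \<phi> y" if "y \<in> ch rt" for y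
    using that mu_pos um by (auto simp: edge_weight_def ch_iff ultrametric_element_def)
  then have C: "0 < C" unfolding C_def using finite_ch ch_nonempty[OF rt_V] by (intro sum_pos) auto
  have uC: "ultra (\<lambda>x. C * \<phi> x)"
    using um C tendsto_mult_right_zero[of _ sequentially C] by (auto simp: ultrametric_element_def)
  have "(\<Sum>y\<in>ch rt. edge_weight (\<lambda>x. C * \<phi> x) y) = (\<Sum>y\<in>ch rt. edge_weight \<phi> y / C)"
    by (intro sum.cong refl) (simp add: edge_weight_def right_diff_distrib[symmetric])
  also have "\<dots> = 1" using C by (simp add: sum_divide_distrib[symmetric] C_def)
  finally have norm: "(\<Sum>y\<in>ch rt. edge_weight (\<lambda>x. C * \<phi> x) y) = 1" .
  interpret E: conductance_walk V rt up \<mu> "\<lambda>x. C * \<phi> x"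
    by unfold_locales (rule uC, rule norm)
  show ?thesis
  proof (rule ex1I[of _ "(C, weight_walk (\<lambda>x. C * \<phi> x))"], clarsimp, intro conjI)
    show "0 < C" by (rule C)
    show "nn_random_walk V rt up (weight_walk (\<lambda>x. C * \<phi> x))" by (rule E.W.nn)
    show "transient V rt up (weight_walk (\<lambda>x. C * \<phi> x))" by (rule E.TW.tr)
    show "\<forall>x\<in>V - {rt}. hit_prob V rt up (weight_walk (\<lambda>x. C * \<phi> x)) x (up x) < 1" using E.BW.F_less by blast
    show "\<forall>\<epsilon>>0. finite {x \<in> V. \<epsilon> \<le> green V rt up (weight_walk (\<lambda>x. C * \<phi> x)) x rt}" using E.BW.gr_fin by blast
    show "limit_distribution V rt up (weight_walk (\<lambda>x. C * \<phi> x)) rt = \<mu>" using E.nu_eq_mu by (simp add: E.TW.nu_def)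
    show "\<forall>\<phi>'. \<phi>' \<in> HD_domain V rt up (weight_walk (\<lambda>x. C * \<phi> x)) \<longrightarrow> (\<forall>\<psi>'. \<psi>' \<in> HD_domain V rt up (weight_walk (\<lambda>x. C * \<phi> x)) \<longrightarrow>
      HD_form V rt up (weight_walk (\<lambda>x. C * \<phi> x)) \<phi>' \<psi>' = standard_form V rt up (\<lambda>x. C * \<phi> x) \<mu> \<phi>' \<psi>')"
      using E.form_eq by blast
  next
    fix Cp :: "real \<times> ('v \<Rightarrow> 'v \<Rightarrow> real)"
    assume *: "case Cp of (C, p) \<Rightarrow> C > 0 \<and> nn_random_walk V rt up p \<and> transient V rt up p \<and>
           (\<forall>x\<in>V - {rt}. hit_prob V rt up p x (up x) < 1) \<and>
           (\<forall>\<epsilon>>0. finite {x \<in> V. green V rt up p x rt \<ge> \<epsilon>}) \<and>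
           limit_distribution V rt up p rt = \<mu> \<and>
           (\<forall>\<phi>' \<psi>'. \<phi>' \<in> HD_domain V rt up p \<longrightarrow> \<psi>' \<in> HD_domain V rt up p \<longrightarrow>
              HD_form V rt up p \<phi>' \<psi>' = standard_form V rt up (\<lambda>x. C * \<phi> x) \<mu> \<phi>' \<psi>')"
    obtain D p where Cp: "Cp = (D, p)" by (cases Cp)
    interpret B: boundary_walk V rt up p
      using * unfolding Cp by unfold_locales auto
    have nu: "B.nu rt = \<mu>" using * by (simp add: Cp B.nu_def)
    \<comment> \<open>The constant is determined by the edge weights of \<phi> alone, and the walk
      is then determined by the constant.\<close>
    have "D = (\<Sum>y\<in>ch rt. edge_weight \<phi> y)" "p = weight_walk (\<lambda>x. D * \<phi> x)"
      using B.identify[OF um, of D, unfolded nu] * by (auto simp: Cp)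
    then show "Cp = (C, weight_walk (\<lambda>x. C * \<phi> x))" by (simp add: Cp C_def)
  qed
qed



end
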